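(* There is a randomized algorithm that, given a system $E=\{P_j(x)\}_{j=1}^m$ of polynomial equations over $\mathbb{F}_2$ of degree at most $d$ in $n$ Boolean variables (each $P_j$ given by its algebraic normal form), with high probability either finds a solution to $E$ or correctly decides that $E$ has no solution. Its running time is bounded by $O(2^{0.6943n})$ for $d=2$ and by $O(2^{(1-1/(2d))n})$ for $d>2$.
   Context: A polynomial $P\in\mathbb{F}_2[x_1,\dots,x_n]$ is given by its algebraic normal form (ANF), i.e., as a sum of multilinear monomials $\prod_{i} x_i^{u_i}$, $u\in\{0,1\}^n$. A solution to $E$ is a vector $\bar x\in\{0,1\}^n$ with $P_j(\bar x)=0$ for all $j=1,\dots,m$. The degree $d$ is a fixed constant. Standing assumption: $m\le\sum_{i=0}^{d}\binom{n}{i}$ (so $m$ is polynomial in $n$). *)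

theory Defs
  imports
    "HOL-Probability.SPMF"
    "HOL-Library.Z2"
    "HOL-Library.Log_Nat"
    "HOL-Library.Landau_Symbols"
begin

section \<open>Polynomial systems over the field with two elements\<close>

text \<open>
  A multilinear monomial is the strictly increasing list of the (0-based) indices of its variables;
  the empty list is the monomial 1. An algebraic normal form lists the monomials whose coefficient
  is 1, each once and in any order; the empty list is the zero polynomial. The type \<^typ>\<open>bit\<close> is
  the field with two elements.
\<close>

type_synonym anf = "nat list list"

definition is_anf :: "nat \<Rightarrow> anf \<Rightarrow> bool" where
  "is_anf n P \<longleftrightarrow> distinct P \<and> (\<forall>u\<in>set P. sorted_wrt (<) u \<and> set u \<subseteq> {..<n})"

definition degree_at_most :: "nat \<Rightarrow> anf \<Rightarrow> bool" where
  "degree_at_most d P \<longleftrightarrow> (\<forall>u\<in>set P. length u \<le> d)"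

definition anf_eval :: "anf \<Rightarrow> bit list \<Rightarrow> bit" where
  "anf_eval P x = (\<Sum>u\<leftarrow>P. \<Prod>i\<leftarrow>u. x ! i)"

definition is_system :: "nat \<Rightarrow> nat \<Rightarrow> anf list \<Rightarrow> bool" where
  "is_system d n E \<longleftrightarrow> (\<forall>P\<in>set E. is_anf n P \<and> degree_at_most d P)"

definition solutions :: "nat \<Rightarrow> anf list \<Rightarrow> bit list set" where
  "solutions n E = {x. length x = n \<and> (\<forall>P\<in>set E. anf_eval P x = 0)}"


section \<open>Randomized random access machines with logarithmic cost\<close>

text \<open>
  Programs work on an unbounded memory of natural numbers with indirect addressing. As usual for
  the logarithmic cost criterion, handling a number costs its binary length: evaluating an
  expression costs the sum of the binary lengths of the values (constants, addresses, memory
  contents, results of operations) of all its subexpressions. Hence long numbers cannot be used to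
  obtain parallelism for free.
\<close>

type_synonym memory = "nat \<Rightarrow> nat"

datatype exp =
    Const nat
  | Load exp
  | Plus exp exp
  | Minus exp exp
  | Times exp exp
  | Div exp exp

text \<open>Subtraction is truncated at 0, and division by 0 yields 0.\<close>

primrec exp_val :: "memory \<Rightarrow> exp \<Rightarrow> nat" where
  "exp_val s (Const k) = k"
| "exp_val s (Load a) = s (exp_val s a)"
| "exp_val s (Plus a b) = exp_val s a + exp_val s b"
| "exp_val s (Minus a b) = exp_val s a - exp_val s b"
| "exp_val s (Times a b) = exp_val s a * exp_val s b"
| "exp_val s (Div a b) = exp_val s a div exp_val s b"

definition bin_length :: "nat \<Rightarrow> nat" where
  "bin_length k = max 1 (floorlog 2 k)"

primrec exp_cost :: "memory \<Rightarrow> exp \<Rightarrow> nat" where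
  "exp_cost s (Const k) = bin_length k"
| "exp_cost s (Load a) = exp_cost s a + bin_length (exp_val s (Load a))"
| "exp_cost s (Plus a b) = exp_cost s a + exp_cost s b + bin_length (exp_val s (Plus a b))"
| "exp_cost s (Minus a b) = exp_cost s a + exp_cost s b + bin_length (exp_val s (Minus a b))"
| "exp_cost s (Times a b) = exp_cost s a + exp_cost s b + bin_length (exp_val s (Times a b))"
| "exp_cost s (Div a b) = exp_cost s a + exp_cost s b + bin_length (exp_val s (Div a b))"

text \<open>
  In \<open>Assign a e\<close> and \<open>Flip a\<close> the expression \<open>a\<close> is the address of the cell that is written;
  \<open>Flip\<close> writes a fresh uniformly random bit. Tests succeed on nonzero values.
\<close>

datatype prog =
    Skip
  | Assign exp exp
  | Flip exp
  | Seq prog prog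
  | If exp prog prog
  | While exp prog

text \<open>
  The semantics maps an initial memory to the joint distribution of final memory and running time.
  The missing probability mass is the probability of divergence.
\<close>

partial_function (spmf) exec_while ::
  "exp \<Rightarrow> (memory \<Rightarrow> (memory \<times> nat) spmf) \<Rightarrow> memory \<Rightarrow> (memory \<times> nat) spmf" where
  "exec_while e body s =
     (if exp_val s e = 0 then return_spmf (s, exp_cost s e)
      else bind_spmf (body s) (\<lambda>(s1, t1).
             bind_spmf (exec_while e body s1) (\<lambda>(s2, t2).
               return_spmf (s2, exp_cost s e + t1 + t2))))"

primrec exec :: "prog \<Rightarrow> memory \<Rightarrow> (memory \<times> nat) spmf" where
  "exec Skip s = return_spmf (s, 1)"
| "exec (Assign a e) s =
     return_spmf (s(exp_val s a := exp_val s e), exp_cost s a + exp_cost s e)"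
| "exec (Flip a) s =
     bind_spmf coin_spmf (\<lambda>b.
       return_spmf (s(exp_val s a := (if b then 1 else 0)), exp_cost s a + 1))"
| "exec (Seq p q) s =
     bind_spmf (exec p s) (\<lambda>(s1, t1).
       bind_spmf (exec q s1) (\<lambda>(s2, t2). return_spmf (s2, t1 + t2)))"
| "exec (If e p q) s =
     bind_spmf (if exp_val s e \<noteq> 0 then exec p s else exec q s) (\<lambda>(s1, t1).
       return_spmf (s1, exp_cost s e + t1))"
| "exec (While e p) s = exec_while e (exec p) s"

text \<open>
  Under this condition every run takes time at most \<open>T\<close>, whatever the coin flips: a run
  exceeding \<open>T\<close> does so after finitely many flips, that is, with positive probability.
\<close>

definition runs_within :: "(memory \<times> nat) spmf \<Rightarrow> real \<Rightarrow> bool" where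
  "runs_within r T \<longleftrightarrow> lossless_spmf r \<and> (\<forall>(s, t)\<in>set_spmf r. real t \<le> T)"


section \<open>Solving polynomial systems by such programs\<close>

text \<open>
  The input consists of the number of variables, the number of equations and then the equations.
  Each polynomial is preceded by its number of monomials and each monomial by its degree.
  The input occupies the memory from address 0 on, and all other cells are initially 0.
\<close>

definition encode_monomial :: "nat list \<Rightarrow> nat list" where
  "encode_monomial u = length u # u"

definition encode_anf :: "anf \<Rightarrow> nat list" where
  "encode_anf P = length P # concat (map encode_monomial P)"

definition encode_system :: "nat \<Rightarrow> anf list \<Rightarrow> nat list" where
  "encode_system n E = n # length E # concat (map encode_anf E)"

definition input_memory :: "nat list \<Rightarrow> memory" where
  "input_memory xs = (\<lambda>i. if i < length xs then xs ! i else 0)"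

definition run_on :: "prog \<Rightarrow> nat \<Rightarrow> anf list \<Rightarrow> (memory \<times> nat) spmf" where
  "run_on p n E = exec p (input_memory (encode_system n E))"

text \<open>
  Output: cell 0 holds 1 and the next \<open>n\<close> cells hold a solution, or cell 0 holds 0, which claims
  that there is no solution.
\<close>

definition outputs_solution :: "nat \<Rightarrow> anf list \<Rightarrow> memory \<Rightarrow> bool" where
  "outputs_solution n E s \<longleftrightarrow>
     s 0 = 1 \<and> (\<exists>x\<in>solutions n E. \<forall>i<n. s (Suc i) = (if x ! i = 1 then 1 else 0))"

definition outputs_unsolvable :: "memory \<Rightarrow> bool" where
  "outputs_unsolvable s \<longleftrightarrow> s 0 = 0"

definition correct_output :: "nat \<Rightarrow> anf list \<Rightarrow> memory \<Rightarrow> bool" where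
  "correct_output n E s \<longleftrightarrow>
     outputs_solution n E s \<or> (outputs_unsolvable s \<and> solutions n E = {})"

definition success_prob :: "prog \<Rightarrow> nat \<Rightarrow> anf list \<Rightarrow> real" where
  "success_prob p n E = measure (measure_spmf (run_on p n E)) {(s, t). correct_output n E s}"

text \<open>
  The instances of the problem for degree \<open>d\<close>, with the bound on the number of equations.
\<close>

definition instances :: "nat \<Rightarrow> nat \<Rightarrow> anf list set" where
  "instances d n = {E. is_system d n E \<and> length E \<le> (\<Sum>i\<le>d. n choose i)}"

text \<open>
  With high probability: the failure probability is eventually below every inverse polynomial in
  \<open>n\<close>, uniformly over all instances.
\<close>

definition solves_whp :: "prog \<Rightarrow> nat \<Rightarrow> bool" where
  "solves_whp p d \<longleftrightarrow>
     (\<forall>c::nat. \<forall>\<^sub>F n in sequentially. \<forall>E\<in>instances d n.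
        success_prob p n E \<ge> 1 - 1 / real n ^ c)"

definition has_running_time :: "prog \<Rightarrow> nat \<Rightarrow> (nat \<Rightarrow> real) \<Rightarrow> bool" where
  "has_running_time p d T \<longleftrightarrow> (\<forall>n. \<forall>E\<in>instances d n. runs_within (run_on p n E) (T n))"

end

theory Submission
  imports
    Defs
    "HOL-Probability.Product_PMF"
    "HOL-Library.Nat_Bijection"
    "HOL-Real_Asymp.Real_Asymp"
begin

text \<open>
  The algorithm is Dinur's multiple parity counting. Random affine equations isolate a solution
  (Valiant--Vazirani), whose bits are parities of the numbers of solutions of systems with one more
  equation. To obtain, for many prefixes, the parity of the number of solutions extending the
  prefix, the system is replaced by slightly more random linear combinations of its equations than
  there are summed variables. Their indicator is a polynomial of low degree, and summing it over
  \<open>k\<close> variables lowers the degree by \<open>k\<close>, so the parities are determined by their values at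
  prefixes of low weight, which are computed recursively. A majority vote over independent
  combinations makes all parities of the next level correct. With a constant number \<open>D\<close> of levels,
  a table has at most \<open>(1 + y) ^ n\<close> entries up to a factor \<open>2 ^ (n / D)\<close> and a polynomial, for every
  \<open>y \<le> 1\<close> with \<open>(1 + y) * y ^ (d - 1) \<ge> 1\<close>.

  The program first writes all random bits to a tape and is deterministic afterwards. The same tape
  cells serve all branches of the recursion, since the failure events are treated by a union bound.
\<close>

text \<open>The condition on \<open>y\<close> balances prefix length against degree. Summing over
  one more variable shortens the prefixes, which saves a factor \<open>1 + y\<close> in the count,
  but raises the degree by \<open>d - 1\<close>, which costs a factor
  \<open>1 / y ^ (d - 1)\<close>; under the condition no level exceeds the bound for full-length
  points. The claimed exponents are strictly larger than the binary logarithm of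
  \<open>1 + y\<close>, and this slack pays for everything else: the factor
  \<open>2 ^ (n / D)\<close>, all repetitions and the cost of handling long numbers. Polynomial
  factors may therefore be estimated crudely throughout. The delicate point is that interpolation
  spreads errors: one wrong parity at a prefix of low weight can spoil every value computed from it.
  It is not enough that a typical parity is right; the parities that are read have to be right
  simultaneously. Hence a vote has to fail with a probability small enough to be multiplied by the
  number of all prefixes, which is itself exponential.\<close>

declare add_bit_eq_xor [simp del] mult_bit_eq_and [simp del]

section \<open>Cost of deterministic runs\<close>

text \<open>In units of the cell length \<open>B\<close>, a bound on the binary length of the value.
  Lengths add for sums as well as for products: a carry needs no extra unit, since no operand has
  size zero.\<close>

primrec exp_size :: "exp \<Rightarrow> nat" where
  "exp_size (Const k) = bin_length k"
| "exp_size (Load a) = exp_size a + 1"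
| "exp_size (Plus a b) = exp_size a + exp_size b"
| "exp_size (Minus a b) = exp_size a + exp_size b"
| "exp_size (Times a b) = exp_size a + exp_size b"
| "exp_size (Div a b) = exp_size a + exp_size b"

text \<open>The cost model charges every intermediate value, so the sizes of the subexpressions are
  added up, a loaded cell counting one unit.\<close>

primrec exp_weight :: "exp \<Rightarrow> nat" where
  "exp_weight (Const k) = bin_length k"
| "exp_weight (Load a) = exp_weight a + 1"
| "exp_weight (Plus a b) = exp_weight a + exp_weight b + (exp_size a + exp_size b)"
| "exp_weight (Minus a b) = exp_weight a + exp_weight b + (exp_size a + exp_size b)"
| "exp_weight (Times a b) = exp_weight a + exp_weight b + (exp_size a + exp_size b)"
| "exp_weight (Div a b) = exp_weight a + exp_weight b + (exp_size a + exp_size b)"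

primrec prog_weight :: "prog \<Rightarrow> nat" where
  "prog_weight Skip = 1"
| "prog_weight (Assign a e) = exp_weight a + exp_weight e"
| "prog_weight (Flip a) = exp_weight a + 1"
| "prog_weight (Seq p q) = prog_weight p + prog_weight q"
| "prog_weight (If e p q) = exp_weight e + prog_weight p + prog_weight q"
| "prog_weight (While e p) = exp_weight e + prog_weight p"

lemma less_power_bin_length: "k < 2 ^ bin_length k"
proof -
  have "k < 2 ^ floorlog 2 k"
    using floorlog_bounds[of k 2] by (cases "k = 0") auto
  also have "\<dots> \<le> 2 ^ bin_length k"
    by (intro power_increasing) (auto simp: bin_length_def)
  finally show ?thesis .
qed

lemma bin_length_le: "k < 2 ^ b \<Longrightarrow> 1 \<le> b \<Longrightarrow> bin_length k \<le> b"
  by (auto simp: bin_length_def floorlog_leI)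

lemma exp_size_pos: "1 \<le> exp_size e"
  by (induction e) (auto simp: bin_length_def)

lemma exp_val_less:
  assumes "\<And>i. s i < 2 ^ B" "1 \<le> B"
  shows "exp_val s e < 2 ^ (exp_size e * B)"
proof -
  have add: "x + y < 2 ^ ((a + b) * B)"
    if "x < 2 ^ (a * B)" "y < 2 ^ (b * B)" "1 \<le> a" "1 \<le> b" for x y a b :: nat
  proof -
    have two: "2 \<le> (2::nat) ^ (c * B)" if "1 \<le> c" for c
    proof -
      have "1 \<le> c * B" using that assms(2) by simp
      then have "(2::nat) ^ 1 \<le> 2 ^ (c * B)" by (intro power_increasing) auto
      then show ?thesis by simp
    qed
    \<comment> \<open>This absorbs the carry: both powers are at least 2, so the product of the two
      bounds also bounds the sum.\<close>
    have "p + q \<le> p * q" if "2 \<le> p" "2 \<le> q" for p q :: nat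
    proof -
      have "2 * q \<le> p * q" "p * 2 \<le> p * q" using that by (auto intro: mult_le_mono)
      then show ?thesis by linarith
    qed
    then have "2 ^ (a * B) + 2 ^ (b * B) \<le> (2::nat) ^ (a * B) * 2 ^ (b * B)"
      using two that by blast
    moreover have "x + y < 2 ^ (a * B) + 2 ^ (b * B)" using that by simp
    ultimately have "x + y < 2 ^ (a * B) * 2 ^ (b * B)" by linarith
    then show ?thesis by (simp add: power_add algebra_simps)
  qed
  have mul: "x * y < 2 ^ ((a + b) * B)"
    if "x < 2 ^ (a * B)" "y < 2 ^ (b * B)" for x y a b :: nat
    using mult_strict_mono[OF that] by (simp add: power_add algebra_simps)
  have mono: "x < 2 ^ ((a + b) * B)" if "x \<le> y" "y < 2 ^ (a * B)" for x y a b :: nat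
  proof -
    have "(2::nat) ^ (a * B) \<le> 2 ^ ((a + b) * B)" by (intro power_increasing) auto
    then show ?thesis using that by linarith
  qed
  show ?thesis
  proof (induction e)
    case (Const k)
    have "(2::nat) ^ bin_length k \<le> 2 ^ (bin_length k * B)"
      using assms(2) by (intro power_increasing) auto
    with less_power_bin_length[of k] show ?case unfolding exp_val.simps exp_size.simps by (rule order_less_le_trans)
  next
    case (Load a)
    have "(2::nat) ^ B \<le> 2 ^ (exp_size (Load a) * B)"
      by (intro power_increasing) auto
    then show ?case using assms(1) by (metis exp_val.simps(2) order_less_le_trans)
  next
    case (Minus a b)
    then show ?case using mono[of "exp_val s a - exp_val s b" "exp_val s a"] by simp
  next
    case (Div a b)
    then show ?case using mono[of "exp_val s a div exp_val s b" "exp_val s a"] by simp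
  next
    case (Plus a b)
    then show ?case using add exp_size_pos by simp
  next
    case (Times a b)
    then show ?case using mul by simp
  qed
qed

lemma exp_cost_le:
  assumes "\<And>i. s i < 2 ^ B" "1 \<le> B"
  shows "exp_cost s e \<le> exp_weight e * B"
proof -
  have bin: "bin_length (exp_val s e) \<le> exp_size e * B" for e
    using exp_val_less[where s=s and B=B, OF assms] exp_size_pos[of e] assms(2)
    by (intro bin_length_le) (auto intro: mult_le_mono[of 1 _ 1, simplified])
  show ?thesis
  proof (induction e)
    case (Const k)
    then show ?case using assms(2) by simp
  next
    case (Load a)
    have "bin_length (s (exp_val s a)) \<le> B" using assms by (intro bin_length_le) auto
    then show ?case using Load by (simp add: algebra_simps)
  next
    case (Plus a b) then show ?case using bin[of "Plus a b"] by (simp add: algebra_simps)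
  next
    case (Minus a b) then show ?case using bin[of "Minus a b"] by (simp add: algebra_simps)
  next
    case (Times a b) then show ?case using bin[of "Times a b"] by (simp add: algebra_simps)
  next
    case (Div a b) then show ?case using bin[of "Div a b"] by (simp add: algebra_simps)
  qed
qed

text \<open>
  Deterministic runs that keep every cell below \<open>2 ^ B\<close>, with unit costs: under this invariant a
  step costs at most a constant, depending on the program only, times \<open>B\<close>.
\<close>

inductive big :: "nat \<Rightarrow> prog \<Rightarrow> memory \<Rightarrow> memory \<Rightarrow> nat \<Rightarrow> bool" for B where
  big_Skip: "big B Skip s s 1"
| big_Assign: "exp_val s e < 2 ^ B \<Longrightarrow> big B (Assign a e) s (s(exp_val s a := exp_val s e)) 1"
| big_Seq: "big B p s s1 k1 \<Longrightarrow> big B q s1 s2 k2 \<Longrightarrow> big B (Seq p q) s s2 (k1 + k2)"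
| big_If_True: "exp_val s e \<noteq> 0 \<Longrightarrow> big B p s s1 k \<Longrightarrow> big B (If e p q) s s1 (Suc k)"
| big_If_False: "exp_val s e = 0 \<Longrightarrow> big B q s s1 k \<Longrightarrow> big B (If e p q) s s1 (Suc k)"
| big_While_False: "exp_val s e = 0 \<Longrightarrow> big B (While e p) s s 1"
| big_While_True: "exp_val s e \<noteq> 0 \<Longrightarrow> big B p s s1 k1 \<Longrightarrow> big B (While e p) s1 s2 k2 \<Longrightarrow>
    big B (While e p) s s2 (Suc (k1 + k2))"

text \<open>A unit step evaluates expressions of total weight at most \<open>prog_weight p\<close>,
  so one multiplication turns step counts into logarithmic cost. The bound on the cells is carried
  along because the cost of the next step depends on it.\<close>

lemma big_exec:
  assumes "big B p s s' k" "\<And>i. s i < 2 ^ B" "1 \<le> B"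
  shows "(\<forall>i. s' i < 2 ^ B) \<and> (\<exists>t \<le> k * (prog_weight p * B). exec p s = return_spmf (s', t))"
  using assms
proof (induction rule: big.induct)
  case (big_Skip s)
  then show ?case by auto
next
  case (big_Assign s e a)
  have "exp_cost s a + exp_cost s e \<le> prog_weight (Assign a e) * B"
    using exp_cost_le[where s=s and B=B and e=a, OF big_Assign(2,3)] exp_cost_le[where s=s and B=B and e=e, OF big_Assign(2,3)]
    by (simp add: algebra_simps)
  then show ?case using big_Assign by (auto simp: fun_eq_iff)
next
  case (big_Seq p s s1 k1 q s2 k2)
  then obtain t1 t2 where t: "t1 \<le> k1 * (prog_weight p * B)" "exec p s = return_spmf (s1, t1)"
    "t2 \<le> k2 * (prog_weight q * B)" "exec q s1 = return_spmf (s2, t2)"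
    and b: "\<forall>i. s2 i < 2 ^ B" by blast
  have "t1 + t2 \<le> (k1 + k2) * (prog_weight (Seq p q) * B)"
    using t(1,3) by (simp add: algebra_simps)
  then show ?case using t b by simp
next
  case (big_If_True s e p s1 k q)
  then obtain t where t: "t \<le> k * (prog_weight p * B)" "exec p s = return_spmf (s1, t)"
    and b: "\<forall>i. s1 i < 2 ^ B" by blast
  have "exp_cost s e + t \<le> Suc k * (prog_weight (If e p q) * B)"
    using t(1) exp_cost_le[where s=s and B=B and e=e, OF big_If_True(4,5)] by (simp add: algebra_simps)
  then show ?case using t b big_If_True(1) by simp
next
  case (big_If_False s e q s1 k p)
  then obtain t where t: "t \<le> k * (prog_weight q * B)" "exec q s = return_spmf (s1, t)"
    and b: "\<forall>i. s1 i < 2 ^ B" by blast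
  have "exp_cost s e + t \<le> Suc k * (prog_weight (If e p q) * B)"
    using t(1) exp_cost_le[where s=s and B=B and e=e, OF big_If_False(4,5)] by (simp add: algebra_simps)
  then show ?case using t b big_If_False(1) by simp
next
  case (big_While_False s e p)
  then show ?case using exp_cost_le[where s=s and B=B and e=e, OF big_While_False(2,3)]
    by (simp add: exec_while.simps[of e] algebra_simps)
next
  case (big_While_True s e p s1 k1 s2 k2)
  then obtain t1 t2 where t: "t1 \<le> k1 * (prog_weight p * B)" "exec p s = return_spmf (s1, t1)"
    "t2 \<le> k2 * (prog_weight (While e p) * B)" "exec (While e p) s1 = return_spmf (s2, t2)"
    and b: "\<forall>i. s2 i < 2 ^ B" by blast
  have le: "exp_cost s e + t1 + t2 \<le> Suc (k1 + k2) * (prog_weight (While e p) * B)"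
    using t(1,3) exp_cost_le[where s=s and B=B and e=e, OF big_While_True(6,7)] by (simp add: algebra_simps)
  have "exec (While e p) s = return_spmf (s2, exp_cost s e + t1 + t2)"
    using t(2,4) big_While_True(1) by (subst exec.simps, subst exec_while.simps) simp
  then show ?case using le b by blast
qed

subsection \<open>Memory as a table of rows\<close>

type_synonym rows = "nat \<Rightarrow> nat \<Rightarrow> nat"

text \<open>Row \<open>r\<close> occupies the addresses \<open>b0 + r + K * i\<close>. Interleaving
  provides a fixed number of arrays without any bound on their lengths, and addresses stay linear in
  the index.\<close>

definition conc :: "nat \<Rightarrow> nat \<Rightarrow> memory \<Rightarrow> rows \<Rightarrow> memory" where
  "conc b0 K inp \<sigma> = (\<lambda>a. if a < b0 then inp a else \<sigma> ((a - b0) mod K) ((a - b0) div K))"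

definition upd :: "rows \<Rightarrow> nat \<Rightarrow> nat \<Rightarrow> nat \<Rightarrow> rows" where
  "upd \<sigma> r i v = \<sigma>(r := (\<sigma> r)(i := v))"

lemma upd_same [simp]: "upd \<sigma> r i v r = (\<sigma> r)(i := v)"
  and upd_diff [simp]: "r' \<noteq> r \<Longrightarrow> upd \<sigma> r i v r' = \<sigma> r'"
  by (auto simp: upd_def)

lemma conc_input: "a < b0 \<Longrightarrow> conc b0 K inp \<sigma> a = inp a"
  by (simp add: conc_def)

lemma conc_row: "r < K \<Longrightarrow> conc b0 K inp \<sigma> (b0 + (r + K * i)) = \<sigma> r i"
  by (simp add: conc_def)

lemma conc_upd:
  assumes "r < K"
  shows "(conc b0 K inp \<sigma>)(b0 + (r + K * i) := v) = conc b0 K inp (upd \<sigma> r i v)"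
proof
  fix a
  have "(a - b0) mod K = r \<and> (a - b0) div K = i \<longleftrightarrow> a = b0 + (r + K * i)" if "b0 \<le> a"
  proof
    assume "(a - b0) mod K = r \<and> (a - b0) div K = i"
    then have "a - b0 = r + K * i" by (metis mod_mult_div_eq)
    then show "a = b0 + (r + K * i)" using that by simp
  qed (use assms in auto)
  then show "((conc b0 K inp \<sigma>)(b0 + (r + K * i) := v)) a = conc b0 K inp (upd \<sigma> r i v) a"
    by (cases "a < b0") (auto simp: conc_def upd_def)
qed

lemma conc_upd_input:
  "a < b0 \<Longrightarrow> (conc b0 K inp \<sigma>)(a := v) = conc b0 K (inp(a := v)) \<sigma>"
  by (auto simp: conc_def fun_eq_iff)

section \<open>The program\<close>

primrec powx :: "exp \<Rightarrow> nat \<Rightarrow> exp" where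
  "powx e 0 = Const 1"
| "powx e (Suc k) = Times e (powx e k)"

lemma exp_val_powx [simp]: "exp_val s (powx e k) = exp_val s e ^ k"
  by (induction k) auto

abbreviation "nx \<equiv> Load (Const 0)"
abbreviation "mx \<equiv> Load (Const 1)"

definition modx :: "exp \<Rightarrow> exp \<Rightarrow> exp" where
  "modx a b = Minus a (Times (Div a b) b)"

lemma exp_val_modx [simp]: "exp_val s (modx a b) = exp_val s a mod exp_val s b"
  by (simp add: modx_def minus_div_mult_eq_mod)

text \<open>Rows of the memory; the registers are the rows of which only cell 0 is used.\<close>

abbreviation (input) "rPOW \<equiv> 0 :: nat"
abbreviation (input) "rTAPE \<equiv> 1 :: nat"
abbreviation (input) "rLST \<equiv> 2 :: nat"
abbreviation (input) "rWT \<equiv> 3 :: nat"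
abbreviation (input) "rC \<equiv> 4 :: nat"
abbreviation (input) "rVEC \<equiv> 5 :: nat"
abbreviation (input) "rNEW \<equiv> 6 :: nat"
abbreviation (input) "rREP \<equiv> 7 :: nat"
abbreviation (input) "rX \<equiv> 8 :: nat"
abbreviation (input) "rQ \<equiv> 9 :: nat"
abbreviation (input) "rI \<equiv> 10 :: nat"
abbreviation (input) "rJ \<equiv> 11 :: nat"
abbreviation (input) "rA \<equiv> 12 :: nat"
abbreviation (input) "rV \<equiv> 13 :: nat"
abbreviation (input) "rPTR \<equiv> 14 :: nat"
abbreviation (input) "rACC \<equiv> 15 :: nat"
abbreviation (input) "rCNT \<equiv> 16 :: nat"
abbreviation (input) "rPROD \<equiv> 17 :: nat"
abbreviation (input) "rN1 \<equiv> 18 :: nat"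
abbreviation (input) "rN2 \<equiv> 19 :: nat"
abbreviation (input) "rRES \<equiv> 20 :: nat"
abbreviation (input) "rTAU \<equiv> 21 :: nat"
abbreviation (input) "rKAP \<equiv> 22 :: nat"
abbreviation (input) "rIOTA \<equiv> 23 :: nat"
abbreviation (input) "rX2 \<equiv> 24 :: nat"
abbreviation (input) "rFOUND \<equiv> 25 :: nat"
abbreviation (input) "rSOL \<equiv> 26 :: nat"
abbreviation (input) "rOK \<equiv> 27 :: nat"
abbreviation (input) "rOLD \<equiv> 28 :: nat"
abbreviation (input) "rOUT k \<equiv> 30 + 2 * k :: nat"
abbreviation (input) "rVOTE k \<equiv> 31 + 2 * k :: nat"

locale params =
  fixes d D :: nat
begin

text \<open>Start of the work area, computed from \<open>n\<close> alone; no input cell lies at or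
  behind it, by \<open>length_encoding\<close>. Every address of a row depends on cell 0, which
  therefore has to keep \<open>n\<close> until the very end.\<close>

definition bx :: exp where
  "bx = Times (Const (d + 4)) (powx (Plus nx (Const 1)) (2 * d))"

text \<open>Rows below 30 are fixed; each of the levels 0 to \<open>D\<close> adds an output row and
  a vote row, the last one being row \<open>31 + 2 * D\<close>.\<close>

definition K :: nat where "K = 32 + 2 * D"

definition addr :: "nat \<Rightarrow> exp \<Rightarrow> exp" where
  "addr r i = Plus bx (Plus (Const r) (Times (Const K) i))"

definition get :: "nat \<Rightarrow> exp \<Rightarrow> exp" where "get r i = Load (addr r i)"

definition put :: "nat \<Rightarrow> exp \<Rightarrow> exp \<Rightarrow> prog" where "put r i e = Assign (addr r i) e"

abbreviation "reg r \<equiv> get r (Const 0)"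
abbreviation "putr r e \<equiv> put r (Const 0) e"

text \<open>One number serves as vector length, number of votes, number of isolation trials and base
  of the tape addresses. The summand \<open>(n + 1) ^ d\<close> makes room for the equations;
  \<open>4 * n\<close> makes an error of order \<open>1 / 2 ^ M\<close> small enough for a union
  over \<open>2 ^ n\<close> prefixes.\<close>

definition Mx :: exp where
  "Mx = Plus (Plus (Times (Const 4) nx) (Const 8)) (powx (Plus nx (Const 1)) d)"

text \<open>Strictly larger than \<open>n / D\<close>, so that \<open>D\<close> strides cover all
  variables.\<close>

definition Sx :: exp where "Sx = Plus (Div nx (Const D)) (Const 1)"

definition bitx :: "exp \<Rightarrow> exp \<Rightarrow> exp" where
  "bitx x i = modx (Div x (get rPOW i)) (Const 2)"

text \<open>Four digits to base \<open>M\<close>: level, copy, row and column. Levels below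
  \<open>D\<close> hold the matrices and level \<open>D\<close> holds the coefficients of the hash
  equations, hence the factor \<open>Suc D\<close> in the length of the tape.\<close>

definition tapex :: "exp \<Rightarrow> exp \<Rightarrow> exp \<Rightarrow> exp \<Rightarrow> exp" where
  "tapex k j i c = get rTAPE
     (Plus (Times (Plus (Times (Plus (Times k Mx) j) Mx) i) Mx) c)"

definition nnx :: "exp \<Rightarrow> exp" where "nnx k = Minus nx (Times k Sx)"

definition ppx :: "exp \<Rightarrow> exp" where "ppx k = Minus nx (nnx k)"

definition for_loop :: "nat \<Rightarrow> nat \<Rightarrow> exp \<Rightarrow> prog \<Rightarrow> prog" where
  "for_loop r i e c =
     Seq (put r (Const i) (Const 0))
       (While (Minus e (get r (Const i)))
         (Seq c (put r (Const i) (Plus (get r (Const i)) (Const 1)))))"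

text \<open>Row \<open>rLST\<close> enumerates the points at which tables are kept.\<close>

definition each :: "prog \<Rightarrow> prog" where
  "each c = for_loop rQ 0 (reg rCNT) (Seq (putr rX (get rLST (reg rQ))) c)"

definition fill_tape :: prog where
  "fill_tape = While (Minus (Times (Const (Suc D)) (Times Mx (Times Mx Mx))) (reg rI))
     (Seq (Flip (addr rTAPE (reg rI))) (putr rI (Plus (reg rI) (Const 1))))"

definition make_powers :: prog where
  "make_powers = Seq (put rPOW (Const 0) (Const 1))
     (for_loop rI 0 Mx
        (put rPOW (Plus (reg rI) (Const 1)) (Times (Const 2) (get rPOW (reg rI)))))"

text \<open>Truncated differences act as strict comparisons and their product as a conjunction; this
  is why \<open>4 * d + 1\<close> appears where the bound in \<open>U\<close> is
  \<open>4 * d\<close>.\<close>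

definition test_member :: prog where
  "test_member = Seq (putr rOK (Const 0))
     (for_loop rA 0 (Plus nx (Const 1))
       (If (Times (Minus (get rPOW (Plus (reg rA) Sx)) (reg rX))
                  (Minus (Plus (Times (Const (d - 1)) (Minus nx (reg rA))) (Const (4 * d + 1)))
                         (get rWT (modx (reg rX) (get rPOW (reg rA))))))
          (putr rOK (Const 1)) Skip))"

text \<open>A nonzero member of \<open>U\<close> without its top bit is a member listed earlier, so
  appending bit \<open>i\<close> to the points found so far misses nothing. At most
  \<open>n * card U\<close> points are tested instead of \<open>2 ^ n\<close>. The weight of a point
  is stored before the test, which looks it up.\<close>

definition make_list :: prog where
  "make_list = Seq (put rLST (Const 0) (Const 0)) (Seq (putr rCNT (Const 1))
     (Seq (put rWT (Const 0) (Const 0))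
     (for_loop rI 0 nx (Seq (putr rOLD (reg rCNT))
        (for_loop rJ 0 (reg rOLD)
          (Seq (putr rX (Plus (get rLST (reg rJ)) (get rPOW (reg rI))))
          (Seq (put rWT (reg rX) (Plus (get rWT (get rLST (reg rJ))) (Const 1)))
          (Seq test_member
            (If (reg rOK)
               (Seq (put rLST (reg rCNT) (reg rX)) (putr rCNT (Plus (reg rCNT) (Const 1))))
               Skip)))))))))"

definition eval_monomial :: prog where
  "eval_monomial = Seq (putr rPROD (Const 1))
     (Seq (putr rN2 (Load (reg rPTR))) (Seq (putr rPTR (Plus (reg rPTR) (Const 1)))
     (for_loop rV 0 (reg rN2)
       (Seq (putr rPROD (Times (reg rPROD) (bitx (reg rX) (Load (reg rPTR)))))
            (putr rPTR (Plus (reg rPTR) (Const 1)))))))"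

definition eval_anf :: prog where
  "eval_anf = Seq (putr rACC (Const 0))
     (Seq (putr rN1 (Load (reg rPTR))) (Seq (putr rPTR (Plus (reg rPTR) (Const 1)))
     (for_loop rA 0 (reg rN1)
       (Seq eval_monomial (putr rACC (modx (Plus (reg rACC) (reg rPROD)) (Const 2)))))))"

definition eval_system :: prog where
  "eval_system = Seq (for_loop rJ 0 Mx (put rVEC (reg rJ) (Const 0)))
     (Seq (putr rPTR (Const 2))
     (for_loop rJ 0 mx (Seq eval_anf (put rVEC (reg rJ) (reg rACC)))))"

definition eval_hash :: prog where
  "eval_hash =
     Seq (for_loop rJ 0 (reg rKAP)
       (Seq (putr rACC (tapex (Const D) (reg rTAU) (reg rJ) nx))
       (Seq (for_loop rV 0 nx
          (putr rACC (modx (Plus (reg rACC)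
             (Times (tapex (Const D) (reg rTAU) (reg rJ) (reg rV)) (bitx (reg rX) (reg rV)))) (Const 2))))
        (put rVEC (Plus mx (reg rJ)) (reg rACC)))))
     (put rVEC (Plus mx (Plus nx (Const 1))) (Minus (Const 1) (bitx (reg rX) (reg rIOTA))))"

text \<open>The product is collected in a second row because each of its entries reads the whole old
  vector.\<close>

definition apply_matrix :: prog where
  "apply_matrix =
     Seq (for_loop rJ 0 Mx
       (Seq (putr rACC (Const 0))
       (Seq (If (Minus (Plus (nnx (Plus (reg rI) (Const 1))) (Const 4)) (reg rJ))
          (for_loop rV 0 Mx
            (putr rACC (modx (Plus (reg rACC)
               (Times (tapex (reg rI) (get rREP (reg rI)) (reg rJ) (reg rV)) (get rVEC (reg rV)))) (Const 2))))
          Skip)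
        (put rNEW (reg rJ) (reg rACC)))))
     (for_loop rJ 0 Mx (put rVEC (reg rJ) (get rNEW (reg rJ))))"

definition test_zero :: prog where
  "test_zero = Seq (putr rRES (Const 1))
     (for_loop rJ 0 Mx (If (get rVEC (reg rJ)) (putr rRES (Const 0)) Skip))"

text \<open>At level \<open>D\<close> no variable is summed any more, so a table entry is a single
  value of the fully compressed indicator. The compressions are recomputed at each point, at
  polynomial cost.\<close>

definition eval_leaf :: prog where
  "eval_leaf = Seq eval_system (Seq eval_hash (Seq (for_loop rI 0 (Const D) apply_matrix) test_zero))"

text \<open>The subset sum transform over the field with two elements is its own inverse. The first
  pass turns values into coefficients at the points of low weight, zero elsewhere being the
  truncation of the degree; the second pass evaluates the polynomial on all of
  \<open>U\<close>.\<close>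

definition transform :: "nat \<Rightarrow> prog" where
  "transform k = (let low = Minus (Plus (Times (Const (d - 1)) (nnx (Const (Suc k)))) (Const (4 * d + 1))) (get rWT (reg rX));
      addC = put rC (reg rX) (modx (Plus (get rC (reg rX)) (get rC (Minus (reg rX) (get rPOW (reg rI))))) (Const 2)) in
     Seq (each (If low (put rC (reg rX) (get (rOUT (Suc k)) (reg rX))) (put rC (reg rX) (Const 0))))
     (Seq (for_loop rI 0 nx (each (If (Times low (bitx (reg rX) (reg rI))) addC Skip)))
     (for_loop rI 0 nx (each (If (bitx (reg rX) (reg rI)) addC Skip)))))"

text \<open>An entry is a parity over the extensions of its prefix, so it is accumulated by
  toggling, for each extension, the entry of the prefix. The two truncated differences test that the
  point has no variable from \<open>pp (Suc k)\<close> on and that a strict majority voted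
  1.\<close>

definition step :: "nat \<Rightarrow> prog \<Rightarrow> prog" where
  "step k c =
     Seq (each (put (rVOTE k) (reg rX) (Const 0)))
     (Seq (for_loop rREP k Mx (Seq c (Seq (transform k)
        (each (put (rVOTE k) (reg rX) (Plus (get (rVOTE k) (reg rX)) (get rC (reg rX))))))))
     (Seq (each (put (rOUT k) (reg rX) (Const 0)))
     (each (If (Times (Minus (get rPOW (ppx (Const (Suc k)))) (reg rX))
                      (Minus (Times (Const 2) (get (rVOTE k) (reg rX))) Mx))
        (put (rOUT k) (modx (reg rX) (get rPOW (ppx (Const k))))
           (modx (Plus (get (rOUT k) (modx (reg rX) (get rPOW (ppx (Const k))))) (Const 1)) (Const 2)))
        Skip))))"

primrec level :: "nat \<Rightarrow> prog" where
  "level 0 = each (Seq eval_leaf (put (rOUT D) (reg rX) (reg rRES)))"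
| "level (Suc h) = step (D - Suc h) (level h)"

text \<open>A candidate is checked against the original system before it is accepted. The error is
  thus one-sided: wrong parities can hide a solution, but never produce a false one.\<close>

definition try_candidate :: prog where
  "try_candidate = Seq (putr rX2 (Const 0))
     (Seq (for_loop rIOTA 0 nx (Seq (level D)
        (putr rX2 (Plus (reg rX2) (Times (get (rOUT 0) (Const 0)) (get rPOW (reg rIOTA)))))))
     (Seq (putr rX (reg rX2)) (Seq eval_system (Seq test_zero
     (If (reg rRES) (Seq (putr rFOUND (Const 1)) (putr rSOL (reg rX2))) Skip)))))"

text \<open>The suitable number of hash equations depends on the unknown number of solutions, so all
  numbers from 0 to \<open>n + 1\<close> are tried.\<close>

definition search :: prog where
  "search = for_loop rTAU 0 Mx (for_loop rKAP 0 (Plus nx (Const 2)) try_candidate)"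

text \<open>Cell 0 is overwritten last, since the loop bound and the addresses of the registers are
  computed from the \<open>n\<close> stored there.\<close>

definition write_output :: prog where
  "write_output = Seq (for_loop rI 0 nx (Assign (Plus (reg rI) (Const 1)) (bitx (reg rSOL) (reg rI))))
     (Assign (Const 0) (reg rFOUND))"

definition solver :: prog where
  "solver = Seq fill_tape (Seq make_powers (Seq make_list (Seq search write_output)))"

end

locale instance_context = params +
  fixes n :: nat and E :: "anf list"
  assumes d2: "2 \<le> d" and D1: "1 \<le> D" and inst: "E \<in> instances d n"
begin

definition m :: nat where "m = length E"
definition M :: nat where "M = 4 * n + 8 + (n + 1) ^ d"
definition S :: nat where "S = n div D + 1"
definition b0 :: nat where "b0 = (d + 4) * (n + 1) ^ (2 * d)"
definition inp :: memory where "inp = input_memory (encode_system n E)"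
definition N :: nat where "N = Suc D * (M * (M * M))"
text \<open>\<open>B\<close> itself bounds input pointers and tape positions, and
  \<open>2 ^ B\<close> exceeds list indices and the powers of two up to \<open>2 ^ M\<close>. Being
  polynomial in \<open>n\<close>, it may be charged for every cell.\<close>

definition B :: nat where "B = b0 + N + M + 4"

text \<open>The input is a fixed parameter of the context, and in the rules below only the rows
  vary. This fits all deterministic parts of the program except the final output, which overwrites
  the input.\<close>

abbreviation "val \<sigma> e \<equiv> exp_val (conc b0 K inp \<sigma>) e"

definition wp :: "prog \<Rightarrow> (rows \<Rightarrow> bool) \<Rightarrow> nat \<Rightarrow> rows \<Rightarrow> bool" where
  "wp c Q T \<sigma> \<longleftrightarrow> (\<exists>\<sigma>' k. big B c (conc b0 K inp \<sigma>) (conc b0 K inp \<sigma>') k \<and> k \<le> T \<and> Q \<sigma>')"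

lemma b0_gt: "1 < b0"
proof -
  have "1 \<le> (n + 1) ^ (2 * d)" by simp
  then have "(d + 4) * 1 \<le> b0" unfolding b0_def by (intro mult_le_mono) auto
  then show ?thesis by simp
qed

lemma inp_0 [simp]: "inp 0 = n" and inp_1 [simp]: "inp (Suc 0) = m"
  by (simp_all add: inp_def input_memory_def encode_system_def m_def)

lemma val_nx [simp]: "conc b0 K inp \<sigma> 0 = n" and val_mx [simp]: "conc b0 K inp \<sigma> (Suc 0) = m"
  using b0_gt by (auto simp: conc_input)

lemma val_input: "a < b0 \<Longrightarrow> conc b0 K inp \<sigma> a = inp a"
  by (simp add: conc_input)

lemma val_bx [simp]: "val \<sigma> bx = b0"
proof -
  have "val \<sigma> bx = (d + 4) * (n + 1) ^ (2 * d)" by (simp add: bx_def)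
  then show ?thesis by (simp only: b0_def)
qed

lemma val_addr [simp]: "val \<sigma> (addr r i) = b0 + (r + K * val \<sigma> i)"
  by (simp add: addr_def)

lemma val_get [simp]: "r < K \<Longrightarrow> val \<sigma> (get r i) = \<sigma> r (val \<sigma> i)"
  by (simp add: get_def conc_row)

lemma val_Mx [simp]: "val \<sigma> Mx = M"
  by (simp add: Mx_def M_def)

lemma val_Sx [simp]: "val \<sigma> Sx = S"
  by (simp add: Sx_def S_def)

lemma row_less [simp]: "r < 30 \<Longrightarrow> r < K" "k \<le> D \<Longrightarrow> rOUT k < K" "k \<le> D \<Longrightarrow> rVOTE k < K"
  by (auto simp: K_def)

lemma val_reg_fixed [simp]:
  "val \<sigma> (get 0 i) = \<sigma> 0 (val \<sigma> i)" "val \<sigma> (get 1 i) = \<sigma> 1 (val \<sigma> i)"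
  "val \<sigma> (get (Suc 0) i) = \<sigma> (Suc 0) (val \<sigma> i)"
  by simp_all

lemma val_bitx [simp]: "val \<sigma> (bitx x i) = (val \<sigma> x div \<sigma> rPOW (val \<sigma> i)) mod 2"
  by (simp add: bitx_def)

definition idx :: "nat \<Rightarrow> nat \<Rightarrow> nat \<Rightarrow> nat \<Rightarrow> nat" where
  "idx k j i c = ((k * M + j) * M + i) * M + c"

lemma val_tapex [simp]:
  "val \<sigma> (tapex k j i c) = \<sigma> rTAPE (idx (val \<sigma> k) (val \<sigma> j) (val \<sigma> i) (val \<sigma> c))"
  by (simp add: tapex_def idx_def)

text \<open>
  At level \<open>k\<close> of the recursion the last \<open>nn k\<close> variables are summed over and the tables are
  indexed by the first \<open>pp k\<close> variables; truncated subtraction makes \<open>nn D = 0\<close>.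
\<close>

definition nn :: "nat \<Rightarrow> nat" where "nn k = n - k * S"
definition pp :: "nat \<Rightarrow> nat" where "pp k = n - nn k"

lemma val_nnx [simp]: "val \<sigma> (nnx k) = nn (val \<sigma> k)"
  by (simp add: nnx_def nn_def)

lemma val_ppx [simp]: "val \<sigma> (ppx k) = pp (val \<sigma> k)"
  by (simp add: ppx_def pp_def)

subsection \<open>Proof rules\<close>

lemma wp_mono: "wp c Q T \<sigma> \<Longrightarrow> T \<le> T' \<Longrightarrow> (\<And>\<sigma>'. Q \<sigma>' \<Longrightarrow> Q' \<sigma>') \<Longrightarrow> wp c Q' T' \<sigma>"
  unfolding wp_def by (meson le_trans)

lemma wp_time: "wp c Q T \<sigma> \<Longrightarrow> T \<le> T' \<Longrightarrow> wp c Q T' \<sigma>"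
  by (rule wp_mono[of c Q T])

lemma wp_conseq: "wp c Q T \<sigma> \<Longrightarrow> (\<And>\<sigma>'. Q \<sigma>' \<Longrightarrow> Q' \<sigma>') \<Longrightarrow> wp c Q' T \<sigma>"
  by (rule wp_mono[of c Q T \<sigma>]) auto

lemma wp_Skip: "Q \<sigma> \<Longrightarrow> wp Skip Q 1 \<sigma>"
  unfolding wp_def using big_Skip by blast

lemma wp_put:
  assumes "r < K" "val \<sigma> e < 2 ^ B" "Q (upd \<sigma> r (val \<sigma> i) (val \<sigma> e))"
  shows "wp (put r i e) Q 1 \<sigma>"
proof -
  have "big B (put r i e) (conc b0 K inp \<sigma>) (conc b0 K inp (upd \<sigma> r (val \<sigma> i) (val \<sigma> e))) 1"
    using big_Assign[OF assms(2), of "addr r i"] assms(1) by (simp add: put_def conc_upd)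
  then show ?thesis unfolding wp_def using assms(3) by blast
qed

lemma wp_Seq: "wp a (wp b Q T2) T1 \<sigma> \<Longrightarrow> wp (Seq a b) Q (T1 + T2) \<sigma>"
  unfolding wp_def by (meson add_le_mono big_Seq)

lemma wp_put_Seq:
  assumes "r < K" "val \<sigma> e < 2 ^ B" "wp b Q T (upd \<sigma> r (val \<sigma> i) (val \<sigma> e))"
  shows "wp (Seq (put r i e) b) Q (1 + T) \<sigma>"
  by (intro wp_Seq wp_put assms)

lemma wp_If:
  assumes "val \<sigma> e \<noteq> 0 \<Longrightarrow> wp p Q T1 \<sigma>" "val \<sigma> e = 0 \<Longrightarrow> wp q Q T2 \<sigma>"
  shows "wp (If e p q) Q (1 + T1 + T2) \<sigma>"
proof (cases "val \<sigma> e = 0")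
  case True
  then obtain \<sigma>' k where "big B q (conc b0 K inp \<sigma>) (conc b0 K inp \<sigma>') k" "k \<le> T2" "Q \<sigma>'"
    using assms(2) unfolding wp_def by blast
  then show ?thesis unfolding wp_def using True
    by (intro exI[of _ \<sigma>'] exI[of _ "Suc k"]) (auto intro: big_If_False)
next
  case False
  then obtain \<sigma>' k where "big B p (conc b0 K inp \<sigma>) (conc b0 K inp \<sigma>') k" "k \<le> T1" "Q \<sigma>'"
    using assms(1) unfolding wp_def by blast
  then show ?thesis unfolding wp_def using False
    by (intro exI[of _ \<sigma>'] exI[of _ "Suc k"]) (auto intro: big_If_True)
qed

text \<open>In each round the test and the increment add 2 to the body; initialisation and the final
  test add another 2. The loop bound is an expression evaluated afresh in every round, so the
  invariant has to keep its value at \<open>R\<close>.\<close>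

lemma wp_for:
  assumes r: "r < K" and R: "R < 2 ^ B"
    and init: "I 0 (upd \<sigma> r i 0)"
    and bound: "\<And>j \<sigma>. j \<le> R \<Longrightarrow> I j \<sigma> \<Longrightarrow> val \<sigma> e = R"
    and step: "\<And>j \<sigma>. j < R \<Longrightarrow> I j \<sigma> \<Longrightarrow> \<sigma> r i = j \<Longrightarrow>
      wp c (\<lambda>\<sigma>'. \<sigma>' r i = j \<and> I (Suc j) (upd \<sigma>' r i (Suc j))) T \<sigma>"
    and final: "\<And>\<sigma>. I R \<sigma> \<Longrightarrow> \<sigma> r i = R \<Longrightarrow> Q \<sigma>"
  shows "wp (for_loop r i e c) Q (R * (T + 2) + 2) \<sigma>"
proof -
  let ?w = "While (Minus e (get r (Const i)))
         (Seq c (put r (Const i) (Plus (get r (Const i)) (Const 1))))"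
  have loop: "wp ?w Q ((R - j) * (T + 2) + 1) \<sigma>" if "j \<le> R" "I j \<sigma>" "\<sigma> r i = j" for j \<sigma>
    using that
  proof (induction "R - j" arbitrary: j \<sigma>)
    case 0
    then have [simp]: "j = R" by simp
    have "val \<sigma> (Minus e (get r (Const i))) = 0" using bound[OF 0(2,3)] 0(4) r by simp
    then have "big B ?w (conc b0 K inp \<sigma>) (conc b0 K inp \<sigma>) 1" by (rule big_While_False)
    then show ?case unfolding wp_def using final[of \<sigma>] 0
      by (intro exI[of _ \<sigma>] exI[of _ 1]) auto
  next
    case (Suc x)
    then have j: "j < R" by simp
    have nz: "val \<sigma> (Minus e (get r (Const i))) \<noteq> 0" using bound[OF Suc(3,4)] Suc(5) r j by simp
    have "wp (Seq c (put r (Const i) (Plus (get r (Const i)) (Const 1))))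
       (\<lambda>\<sigma>'. \<sigma>' r i = Suc j \<and> I (Suc j) \<sigma>') (T + 1) \<sigma>"
      by (intro wp_Seq wp_conseq[OF step[OF j Suc(4,5)]] wp_put) (use r R j in auto)
    then obtain \<sigma>1 k1 where 1: "big B (Seq c (put r (Const i) (Plus (get r (Const i)) (Const 1))))
       (conc b0 K inp \<sigma>) (conc b0 K inp \<sigma>1) k1" "k1 \<le> T + 1" "\<sigma>1 r i = Suc j" "I (Suc j) \<sigma>1"
      unfolding wp_def by blast
    have "wp ?w Q ((R - Suc j) * (T + 2) + 1) \<sigma>1" using Suc(1)[of "Suc j" \<sigma>1] Suc(2) j 1 by simp
    then obtain \<sigma>2 k2 where 2: "big B ?w (conc b0 K inp \<sigma>1) (conc b0 K inp \<sigma>2) k2"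
       "k2 \<le> (R - Suc j) * (T + 2) + 1" "Q \<sigma>2"
      unfolding wp_def by blast
    have "R - j = Suc (R - Suc j)" using j by simp
    then have "Suc (k1 + k2) \<le> (R - j) * (T + 2) + 1" using 1(2) 2(2) by simp
    then show ?case unfolding wp_def using big_While_True[OF nz 1(1) 2(1)] 2(3) by blast
  qed
  have "wp (for_loop r i e c) Q (1 + ((R - 0) * (T + 2) + 1)) \<sigma>"
    unfolding for_loop_def
    by (intro wp_put_Seq loop) (use init r in auto)
  then show ?thesis by simp
qed

lemma less_power_B: "x \<le> B \<Longrightarrow> x < 2 ^ B"
  using less_exp[of B] by (meson le_less_trans)

lemma power_less_B: "x < 2 ^ (M + 1) \<Longrightarrow> x < 2 ^ B" for x :: nat
proof -
  have "(2::nat) ^ (M + 1) \<le> 2 ^ B" by (intro power_increasing) (auto simp: B_def)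
  then show "x < 2 ^ (M + 1) \<Longrightarrow> x < 2 ^ B" by linarith
qed

end

section \<open>Polynomial functions on the Boolean cube\<close>

lemma mem_set_decode_iff: "i \<in> set_decode x \<longleftrightarrow> odd (x div 2 ^ i)"
  by (simp add: set_decode_def)

text \<open>Points are numbers, identified with the sets of their one bits. Variable 0 is the lowest
  bit, so that passing to the prefix of length \<open>p\<close> is reduction modulo
  \<open>2 ^ p\<close>.\<close>

lemma set_decode_mod_power: "set_decode (x mod 2 ^ p) = set_decode x \<inter> {..<p}"
  by (auto simp: set_decode_def simp flip: bit_iff_odd take_bit_eq_mod) (auto simp: bit_take_bit_iff)

lemma set_decode_eq_iff: "set_decode x = set_decode y \<longleftrightarrow> x = y"
  by (metis set_decode_inverse)

lemma less_power_iff_set_decode: "x < 2 ^ p \<longleftrightarrow> set_decode x \<subseteq> {..<p}"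
proof -
  have "x < 2 ^ p \<longleftrightarrow> x mod 2 ^ p = x"
    by (metis mod_less mod_less_divisor zero_less_numeral zero_less_power)
  also have "\<dots> \<longleftrightarrow> set_decode x \<inter> {..<p} = set_decode x"
    by (metis set_decode_mod_power set_decode_eq_iff)
  finally show ?thesis by auto
qed

lemma set_decode_diff_power:
  assumes "i \<in> set_decode x"
  shows "2 ^ i \<le> x" "set_decode (x - 2 ^ i) = set_decode x - {i}"
proof -
  have x: "x = 2 ^ i + set_encode (set_decode x - {i})"
    using assms by (metis Diff_iff finite_Diff finite_set_decode insertCI insert_Diff set_decode_inverse set_encode_insert)
  then show "2 ^ i \<le> x" by linarith
  have "x - 2 ^ i = set_encode (set_decode x - {i})" using x by linarith
  then show "set_decode (x - 2 ^ i) = set_decode x - {i}" by simp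
qed

lemma set_decode_add_power: "u < 2 ^ i \<Longrightarrow> set_decode (u + 2 ^ i) = insert i (set_decode u)"
  by (subst add.commute, rule set_decode_plus_power_2) (auto simp: less_power_iff_set_decode)

lemma bij_betw_set_decode: "bij_betw set_decode {..<2 ^ n} (Pow {..<n})"
  by (rule bij_betw_byWitness[where f' = set_encode])
    (auto simp: less_power_iff_set_decode finite_subset[of _ "{..<n}"])

lemma bit_add_self [simp]: "x + x = (0::bit)"
  by (cases x) auto

lemma sum_Pow_insert:
  assumes "finite A" "b \<notin> A"
  shows "(\<Sum>V\<in>Pow (insert b A). f V) = (\<Sum>V\<in>Pow A. f V + f (insert b V))"
proof -
  have "(\<Sum>V\<in>Pow (insert b A). f V) = (\<Sum>V\<in>Pow A. f V) + (\<Sum>V\<in>insert b ` Pow A. f V)"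
    unfolding Pow_insert using assms by (intro sum.union_disjoint) auto
  also have "(\<Sum>V\<in>insert b ` Pow A. f V) = (\<Sum>V\<in>Pow A. f (insert b V))"
    using assms by (subst sum.reindex) (auto simp: inj_on_def insert_ident dest: in_mono)
  finally show ?thesis by (simp add: sum.distrib)
qed

text \<open>A list instead of a set: repeated monomials cancel when summed in \<open>bit\<close>, so
  sums and products of polynomials need no normalisation.\<close>

definition monomials_sum :: "nat set list \<Rightarrow> nat set \<Rightarrow> bit" where
  "monomials_sum Us X = (\<Sum>U\<leftarrow>Us. of_bool (U \<subseteq> X))"

definition deg_le :: "nat \<Rightarrow> (nat set \<Rightarrow> bit) \<Rightarrow> bool" where
  "deg_le D f \<longleftrightarrow> (\<exists>Us. (\<forall>U\<in>set Us. finite U \<and> card U \<le> D) \<and> f = monomials_sum Us)"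

lemma deg_le_monomial: "finite U \<Longrightarrow> card U \<le> D \<Longrightarrow> deg_le D (\<lambda>X. of_bool (U \<subseteq> X))"
  unfolding deg_le_def by (intro exI[of _ "[U]"]) (auto simp: monomials_sum_def fun_eq_iff)

lemma deg_le_zero: "deg_le D (\<lambda>X. 0)"
  unfolding deg_le_def by (intro exI[of _ "[]"]) (auto simp: monomials_sum_def fun_eq_iff)

lemma deg_le_one: "deg_le D (\<lambda>X. 1)"
  using deg_le_monomial[of "{}" D] by simp

lemma deg_le_add: "deg_le D f \<Longrightarrow> deg_le D g \<Longrightarrow> deg_le D (\<lambda>X. f X + g X)"
  unfolding deg_le_def
proof (elim exE conjE)
  fix Us Vs assume "\<forall>U\<in>set Us. finite U \<and> card U \<le> D" "f = monomials_sum Us"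
    "\<forall>U\<in>set Vs. finite U \<and> card U \<le> D" "g = monomials_sum Vs"
  then show "\<exists>Us. (\<forall>U\<in>set Us. finite U \<and> card U \<le> D) \<and> (\<lambda>X. f X + g X) = monomials_sum Us"
    by (intro exI[of _ "Us @ Vs"]) (auto simp: monomials_sum_def fun_eq_iff)
qed

lemma deg_le_sum_list: "(\<And>i. i \<in> set I \<Longrightarrow> deg_le D (f i)) \<Longrightarrow> deg_le D (\<lambda>X. \<Sum>i\<leftarrow>I. f i X)"
  by (induction I) (auto intro: deg_le_zero deg_le_add)

lemma deg_le_const: "deg_le D (\<lambda>X. c)"
  by (cases c) (auto intro: deg_le_zero deg_le_one)

lemma deg_le_monomial_mult:
  assumes "finite U" "card U \<le> a" "deg_le b g"
  shows "deg_le (a + b) (\<lambda>X. of_bool (U \<subseteq> X) * g X)"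
proof -
  obtain Vs where Vs: "\<forall>V\<in>set Vs. finite V \<and> card V \<le> b" "g = monomials_sum Vs"
    using assms(3) by (auto simp: deg_le_def)
  have "(\<lambda>X. of_bool (U \<subseteq> X) * g X) = (\<lambda>X. \<Sum>V\<leftarrow>Vs. of_bool (U \<union> V \<subseteq> X))"
    unfolding Vs(2) monomials_sum_def
    by (auto simp: fun_eq_iff sum_list_const_mult[symmetric])
  moreover have "deg_le (a + b) (\<lambda>X. \<Sum>V\<leftarrow>Vs. of_bool (U \<union> V \<subseteq> X))"
  proof (intro deg_le_sum_list deg_le_monomial)
    fix V assume V: "V \<in> set Vs"
    then show "finite (U \<union> V)" using Vs assms by auto
    show "card (U \<union> V) \<le> a + b" using card_Un_le[of U V] V Vs assms by force
  qed
  ultimately show ?thesis by simp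
qed

lemma deg_le_mult:
  assumes "deg_le a f" "deg_le b g"
  shows "deg_le (a + b) (\<lambda>X. f X * g X)"
proof -
  obtain Us where Us: "\<forall>U\<in>set Us. finite U \<and> card U \<le> a" "f = monomials_sum Us"
    using assms(1) by (auto simp: deg_le_def)
  have "(\<lambda>X. f X * g X) = (\<lambda>X. \<Sum>U\<leftarrow>Us. of_bool (U \<subseteq> X) * g X)"
    unfolding Us(2) monomials_sum_def by (auto simp: fun_eq_iff sum_list_mult_const)
  then show ?thesis
    using Us(1) assms(2) by (simp add: deg_le_sum_list deg_le_monomial_mult)
qed

text \<open>A discrete derivative: monomials without \<open>b\<close> occur twice and cancel, the
  others lose \<open>b\<close>.\<close>

lemma deg_le_sum_variable:
  assumes "deg_le D f"
  shows "\<exists>g. deg_le (D - 1) g \<and> (\<forall>Y. b \<notin> Y \<longrightarrow> g Y = f Y + f (insert b Y))"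
proof -
  obtain Us where Us: "\<forall>U\<in>set Us. finite U \<and> card U \<le> D" "f = monomials_sum Us"
    using assms by (auto simp: deg_le_def)
  let ?Vs = "map (\<lambda>U. U - {b}) (filter (\<lambda>U. b \<in> U) Us)"
  have "monomials_sum ?Vs Y = f Y + f (insert b Y)" if "b \<notin> Y" for Y
  proof -
    have "f Y + f (insert b Y) = (\<Sum>U\<leftarrow>Us. of_bool (U \<subseteq> Y) + of_bool (U \<subseteq> insert b Y))"
      by (simp add: Us(2) monomials_sum_def sum_list_addf)
    also have "\<dots> = (\<Sum>U\<leftarrow>Us. if b \<in> U then of_bool (U - {b} \<subseteq> Y) else 0)"
    proof (intro arg_cong[where f = sum_list] map_cong refl)
      fix U
      show "of_bool (U \<subseteq> Y) + of_bool (U \<subseteq> insert b Y) = (if b \<in> U then of_bool (U - {b} \<subseteq> Y) else (0::bit))"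
        using that by (auto simp: subset_insert_iff)
    qed
    also have "\<dots> = monomials_sum ?Vs Y"
      by (simp add: monomials_sum_def sum_list_map_filter' o_def)
    finally show ?thesis by simp
  qed
  moreover have "deg_le (D - 1) (monomials_sum ?Vs)"
    unfolding deg_le_def using Us(1) by (intro exI[of _ ?Vs]) auto
  ultimately show ?thesis by blast
qed

lemma deg_le_sum_cube:
  assumes "finite B" "deg_le D f"
  shows "\<exists>g. deg_le (D - card B) g \<and> (\<forall>Y. Y \<inter> B = {} \<longrightarrow> g Y = (\<Sum>V\<in>Pow B. f (Y \<union> V)))"
  using assms
proof (induction B rule: finite_induct)
  case empty
  then show ?case by auto
next
  case (insert b B)
  then obtain g where g: "deg_le (D - card B) g"
    "\<And>Y. Y \<inter> B = {} \<Longrightarrow> g Y = (\<Sum>V\<in>Pow B. f (Y \<union> V))" by blast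
  obtain h where h: "deg_le (D - card B - 1) h" "\<And>Y. b \<notin> Y \<Longrightarrow> h Y = g Y + g (insert b Y)"
    using deg_le_sum_variable[OF g(1)] by blast
  have "h Y = (\<Sum>V\<in>Pow (insert b B). f (Y \<union> V))" if "Y \<inter> insert b B = {}" for Y
  proof -
    have "h Y = g Y + g (insert b Y)" using that h by auto
    also have "\<dots> = (\<Sum>V\<in>Pow B. f (Y \<union> V)) + (\<Sum>V\<in>Pow B. f (insert b Y \<union> V))"
      using that g(2)[of Y] g(2)[of "insert b Y"] insert.hyps by auto
    also have "\<dots> = (\<Sum>V\<in>Pow (insert b B). f (Y \<union> V))"
      using insert.hyps by (simp add: sum_Pow_insert sum.distrib)
    finally show ?thesis .
  qed
  moreover have "D - card B - 1 = D - card (insert b B)" using insert.hyps by simp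
  ultimately show ?case using h(1) by metis
qed

text \<open>A monomial of degree at most \<open>W\<close> misses some \<open>b\<close> in
  \<open>U\<close>. Pairing \<open>V\<close> with \<open>insert b V\<close> then cancels all its
  contributions, because it cannot tell the two apart.\<close>

lemma deg_le_moebius_zero:
  assumes "deg_le W g" "finite U" "W < card U"
  shows "(\<Sum>V\<in>Pow U. g V) = 0"
proof -
  obtain Us where Us: "\<forall>U\<in>set Us. finite U \<and> card U \<le> W" "g = monomials_sum Us"
    using assms(1) by (auto simp: deg_le_def)
  have mono: "(\<Sum>V\<in>Pow U. of_bool (U' \<subseteq> V)) = (0::bit)" if "U' \<in> set Us" for U'
  proof -
    have "\<not> U \<subseteq> U'" using Us that assms card_mono[of U' U] by force
    then obtain b where b: "b \<in> U" "b \<notin> U'" by blast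
    have "U = insert b (U - {b})" using b by blast
    then have "(\<Sum>V\<in>Pow U. of_bool (U' \<subseteq> V)) = (\<Sum>V\<in>Pow (U - {b}). of_bool (U' \<subseteq> V) + of_bool (U' \<subseteq> insert b V) :: bit)"
      using assms sum_Pow_insert[of "U - {b}" b "\<lambda>V. of_bool (U' \<subseteq> V) :: bit"] by simp
    also have "\<dots> = 0" using b by (intro sum.neutral) (auto simp: subset_insert)
    finally show ?thesis .
  qed
  have "(\<Sum>V\<in>Pow U. g V) = (\<Sum>U'\<leftarrow>Us. \<Sum>V\<in>Pow U. of_bool (U' \<subseteq> V))"
    unfolding Us(2) monomials_sum_def by (induction Us) (auto simp: sum.distrib)
  also have "\<dots> = 0" using mono by (induction Us) auto
  finally show ?thesis .
qed

text \<open>The signs of the usual inversion formula disappear in characteristic 2, which makes the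
  subset sum transform an involution; one in-place pass serves both directions.\<close>

lemma moebius_inversion:
  "finite X \<Longrightarrow> (\<Sum>U\<in>Pow X. \<Sum>V\<in>Pow U. g V) = (g X :: bit)"
proof (induction X arbitrary: g rule: finite_induct)
  case empty
  then show ?case by simp
next
  case (insert b X)
  have "(\<Sum>U\<in>Pow (insert b X). \<Sum>V\<in>Pow U. g V)
      = (\<Sum>U\<in>Pow X. (\<Sum>V\<in>Pow U. g V) + (\<Sum>V\<in>Pow (insert b U). g V))"
    using insert.hyps by (simp add: sum_Pow_insert)
  \<comment> \<open>The subsets of \<open>insert b U\<close> include those of \<open>U\<close>,
    whose sum therefore occurs twice and cancels.\<close>
  also have "\<dots> = (\<Sum>U\<in>Pow X. \<Sum>V\<in>Pow U. g (insert b V))"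
  proof (intro sum.cong refl)
    fix U assume "U \<in> Pow X"
    then have "finite U" "b \<notin> U" using insert.hyps finite_subset by auto
    then show "(\<Sum>V\<in>Pow U. g V) + (\<Sum>V\<in>Pow (insert b U). g V) = (\<Sum>V\<in>Pow U. g (insert b V))"
      by (simp add: sum_Pow_insert sum.distrib flip: add.assoc)
  qed
  also have "\<dots> = g (insert b X)" by (rule insert.IH)
  finally show ?case .
qed

text \<open>Coefficients above the degree vanish, so dropping them is harmless; those that remain
  depend only on values at sets of size at most \<open>W\<close>.\<close>

lemma deg_le_interpolate:
  assumes "deg_le W g" "finite X"
  shows "(\<Sum>U\<in>Pow X. if card U \<le> W then \<Sum>V\<in>Pow U. g V else 0) = g X"
proof -
  have "(\<Sum>U\<in>Pow X. if card U \<le> W then \<Sum>V\<in>Pow U. g V else 0) = (\<Sum>U\<in>Pow X. \<Sum>V\<in>Pow U. g V)"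
    using assms by (intro sum.cong refl) (auto simp: deg_le_moebius_zero finite_subset)
  then show ?thesis using assms by (simp add: moebius_inversion)
qed

text \<open>The intermediate state of the in-place subset sum transform after the coordinates below \<open>q\<close>.\<close>

definition partial_sum :: "nat \<Rightarrow> (nat set \<Rightarrow> bit) \<Rightarrow> nat set \<Rightarrow> bit" where
  "partial_sum q f X = (\<Sum>V | V \<subseteq> X \<and> X \<inter> {q..} \<subseteq> V. f V)"

lemma partial_sum_0: "partial_sum 0 f X = f X"
proof -
  have "{V. V \<subseteq> X \<and> X \<inter> {0..} \<subseteq> V} = {X}" by auto
  then show ?thesis by (simp add: partial_sum_def)
qed

lemma partial_sum_Suc:
  assumes "finite X"
  shows "partial_sum (Suc q) f X = (if q \<in> X then partial_sum q f X + partial_sum q f (X - {q}) else partial_sum q f X)"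
proof (cases "q \<in> X")
  case True
  have q: "X \<inter> {q..} = insert q (X \<inter> {Suc q..})" "(X - {q}) \<inter> {q..} = X \<inter> {Suc q..}"
    using True by (auto simp: Suc_le_eq le_less)
  have "{V. V \<subseteq> X \<and> X \<inter> {Suc q..} \<subseteq> V} =
     {V. V \<subseteq> X \<and> X \<inter> {q..} \<subseteq> V} \<union> {V. V \<subseteq> X - {q} \<and> (X - {q}) \<inter> {q..} \<subseteq> V}" (is "?A = ?B \<union> ?C")
    unfolding q by blast
  moreover have "?B \<inter> ?C = {}" using True by auto
  moreover have "finite ?B" "finite ?C" using assms by (auto intro: finite_subset[of _ "Pow X"])
  ultimately show ?thesis using True by (simp add: partial_sum_def sum.union_disjoint)
next
  case False
  have "X \<inter> {Suc q..} = X \<inter> {q..}" using False by (auto simp: Suc_le_eq le_less)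
  then show ?thesis using False by (simp add: partial_sum_def)
qed

lemma partial_sum_all: "X \<subseteq> {..<n} \<Longrightarrow> partial_sum n f X = (\<Sum>V\<in>Pow X. f V)"
proof -
  assume "X \<subseteq> {..<n}"
  then have "X \<inter> {n..} = {}" by auto
  then show ?thesis by (simp add: partial_sum_def Pow_def)
qed

section \<open>Verification of the program\<close>

abbreviation wt :: "nat \<Rightarrow> nat" where "wt x \<equiv> card (set_decode x)"

definition same :: "nat set \<Rightarrow> rows \<Rightarrow> rows \<Rightarrow> bool" where
  "same R \<sigma> \<sigma>' \<longleftrightarrow> (\<forall>r. r \<notin> R \<longrightarrow> \<sigma>' r = \<sigma> r)"

lemma same_refl [simp]: "same R \<sigma> \<sigma>"
  by (simp add: same_def)

lemma same_upd: "same R \<sigma> \<sigma>' \<Longrightarrow> r \<in> R \<Longrightarrow> same R \<sigma> (upd \<sigma>' r i v)"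
  by (auto simp: same_def upd_def)

lemma same_trans: "same R \<sigma> \<sigma>' \<Longrightarrow> same R' \<sigma>' \<sigma>'' \<Longrightarrow> R' \<subseteq> R \<Longrightarrow> same R \<sigma> \<sigma>''"
  by (auto simp: same_def)

lemma sameD: "same R \<sigma> \<sigma>' \<Longrightarrow> r \<notin> R \<Longrightarrow> \<sigma>' r = \<sigma> r"
  by (simp add: same_def)

section \<open>The set of table points and its enumeration\<close>

context instance_context
begin

text \<open>
  A set of points closed under submasks that serves the tables of all levels: with \<open>p = pp k\<close> it
  contains every point of weight at most \<open>d * (nn k + 4) - nn k\<close> on the first \<open>pp k\<close>
  coordinates, continued arbitrarily up to coordinate \<open>pp (Suc k)\<close>.
\<close>

definition U :: "nat set" where
  "U = {x. x < 2 ^ n \<and> (\<exists>p\<le>n. x < 2 ^ (p + S) \<and> wt (x mod 2 ^ p) \<le> (d - 1) * (n - p) + 4 * d)}"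

lemma U_less: "x \<in> U \<Longrightarrow> x < 2 ^ n"
  by (simp add: U_def)

lemma finite_U [simp]: "finite U"
  by (rule finite_subset[of _ "{..<2 ^ n}"]) (auto simp: U_def)

lemma wp_put_val:
  assumes "r < K" "val \<sigma> i = j" "val \<sigma> e = v" "v < 2 ^ B" "Q (upd \<sigma> r j v)"
  shows "wp (put r i e) Q 1 \<sigma>"
  using assms by (intro wp_put) auto

lemma wp_put_Seq_val:
  assumes "r < K" "val \<sigma> i = j" "val \<sigma> e = v" "v < 2 ^ B" "wp b Q T (upd \<sigma> r j v)"
  shows "wp (Seq (put r i e) b) Q (1 + T) \<sigma>"
  using assms by (intro wp_put_Seq) auto

lemma card_U: "card U \<le> 2 ^ n"
  using card_mono[of "{..<2 ^ n}" U] U_less by auto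

lemma zero_in_U: "0 \<in> U"
  by (auto simp: U_def intro!: exI[of _ 0])

lemma S_pos: "1 \<le> S" "S \<le> n + 1"
  by (auto simp: S_def)

lemma n_M: "4 * n + 8 \<le> M"
  by (simp add: M_def)

text \<open>Size and prefix weight can only shrink, so the same \<open>p\<close> remains a witness.
  This closure lets the enumeration, the transforms and the passage to prefixes stay inside
  \<open>U\<close>.\<close>

lemma U_subset:
  assumes "x \<in> U" "set_decode y \<subseteq> set_decode x"
  shows "y \<in> U"
proof -
  have le: "y \<le> x" by (rule subset_decode_imp_le) fact
  obtain p where p: "p \<le> n" "x < 2 ^ (p + S)" "wt (x mod 2 ^ p) \<le> (d - 1) * (n - p) + 4 * d"
    using assms(1) by (auto simp: U_def)
  have "wt (y mod 2 ^ p) \<le> wt (x mod 2 ^ p)"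
    using assms(2) by (intro card_mono) (auto simp: set_decode_mod_power)
  then show ?thesis using le p U_less[OF assms(1)] unfolding U_def by fastforce
qed

definition powok :: "rows \<Rightarrow> bool" where "powok \<sigma> \<longleftrightarrow> (\<forall>i\<le>M. \<sigma> rPOW i = 2 ^ i)"

lemma powokD: "powok \<sigma> \<Longrightarrow> i \<le> M \<Longrightarrow> \<sigma> 0 i = 2 ^ i"
  by (simp add: powok_def)

lemma B_less: "x \<le> M + 4 \<Longrightarrow> x < 2 ^ B"
  by (rule less_power_B) (simp add: B_def)

lemma exp_n_less: "x \<le> 2 ^ n \<Longrightarrow> x < 2 ^ B" for x :: nat
proof (rule power_less_B)
  assume "x \<le> 2 ^ n"
  also have "(2::nat) ^ n < 2 ^ (M + 1)" using n_M by (intro power_strict_increasing) auto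
  finally show "x < 2 ^ (M + 1)" .
qed

lemma make_powers_spec:
  "wp make_powers (\<lambda>\<sigma>'. same {rPOW, rI} \<sigma> \<sigma>' \<and> powok \<sigma>') (M * 3 + 3) \<sigma>"
proof -
  let ?I = "\<lambda>j \<sigma>'. same {rPOW, rI} \<sigma> \<sigma>' \<and> (\<forall>i\<le>j. \<sigma>' rPOW i = 2 ^ i)"
  have "wp make_powers (\<lambda>\<sigma>'. same {rPOW, rI} \<sigma> \<sigma>' \<and> powok \<sigma>') (1 + (M * (1 + 2) + 2)) \<sigma>"
    unfolding make_powers_def
  proof (rule wp_put_Seq, simp, simp add: B_less, rule wp_for[where I = ?I])
    fix j \<sigma>' assume j: "j < M" and I: "?I j \<sigma>'" and c: "\<sigma>' rI 0 = j"
    have "(2::nat) ^ Suc j < 2 ^ B"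
      by (intro power_strict_increasing) (use j in \<open>auto simp: B_def\<close>)
    then show "wp (put rPOW (Plus (reg rI) (Const 1)) (Times (Const 2) (get rPOW (reg rI))))
      (\<lambda>\<sigma>'. \<sigma>' rI 0 = j \<and> ?I (Suc j) (upd \<sigma>' rI 0 (Suc j))) 1 \<sigma>'"
      using I c by (intro wp_put) (auto intro!: same_upd simp: le_Suc_eq)
  qed (auto simp: powok_def same_upd B_less)
  then show ?thesis by (rule wp_time) simp
qed

lemma test_member_spec:
  assumes "powok \<sigma>" "\<sigma> rX 0 = x" "x < 2 ^ n" "\<And>p. p \<le> n \<Longrightarrow> \<sigma> rWT (x mod 2 ^ p) = wt (x mod 2 ^ p)"
  shows "wp test_member (\<lambda>\<sigma>'. same {rOK, rA} \<sigma> \<sigma>' \<and> \<sigma>' rOK 0 = of_bool (x \<in> U)) (5 * n + 8) \<sigma>"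
proof -
  let ?P = "\<lambda>p. x < 2 ^ (p + S) \<and> wt (x mod 2 ^ p) \<le> (d - 1) * (n - p) + 4 * d"
  let ?I = "\<lambda>j \<sigma>'. same {rOK, rA} \<sigma> \<sigma>' \<and> \<sigma>' rOK 0 = of_bool (\<exists>p<j. ?P p)"
  have "wp test_member (\<lambda>\<sigma>'. same {rOK, rA} \<sigma> \<sigma>' \<and> \<sigma>' rOK 0 = of_bool (x \<in> U)) (1 + ((n + 1) * ((1 + 1 + 1) + 2) + 2)) \<sigma>"
    unfolding test_member_def
  proof (rule wp_put_Seq, simp, simp add: B_less, rule wp_for[where I = ?I])
    fix j \<sigma>' assume j: "j < n + 1" and I: "?I j \<sigma>'" and c: "\<sigma>' rA 0 = j"
    have le: "j + S \<le> M" "j \<le> M" using j S_pos n_M by auto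
    have rows: "\<sigma>' rPOW = \<sigma> rPOW" "\<sigma>' rX = \<sigma> rX" "\<sigma>' rWT = \<sigma> rWT"
      using I by (simp_all add: same_def)
    have ex: "(\<exists>p<Suc j. ?P p) \<longleftrightarrow> ?P j \<or> (\<exists>p<j. ?P p)" by (auto simp: less_Suc_eq)
    have val: "val \<sigma>' (Times (Minus (get rPOW (Plus (reg rA) Sx)) (reg rX))
                  (Minus (Plus (Times (Const (d - 1)) (Minus nx (reg rA))) (Const (4 * d + 1)))
                         (get rWT (modx (reg rX) (get rPOW (reg rA)))))) \<noteq> 0 \<longleftrightarrow> ?P j"
      using rows le c assms(1,2) j assms(4)[of j] by (auto simp: powokD less_Suc_eq_le not_le)
    show "wp (If (Times (Minus (get rPOW (Plus (reg rA) Sx)) (reg rX))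
                  (Minus (Plus (Times (Const (d - 1)) (Minus nx (reg rA))) (Const (4 * d + 1)))
                         (get rWT (modx (reg rX) (get rPOW (reg rA))))))
          (putr rOK (Const 1)) Skip)
      (\<lambda>\<sigma>'. \<sigma>' rA 0 = j \<and> ?I (Suc j) (upd \<sigma>' rA 0 (Suc j))) (1 + 1 + 1) \<sigma>'"
    proof (rule wp_If, goal_cases)
      case 1
      then show ?case unfolding val using I c
        by (intro wp_put) (auto intro!: same_upd simp: ex B_less)
    next
      case 2
      then have "\<not> ?P j" using val by blast
      then show ?case using I c by (intro wp_Skip) (auto intro!: same_upd simp: less_Suc_eq)
    qed
  next
    fix \<sigma>' assume "?I (n + 1) \<sigma>'"
    then show "same {rOK, rA} \<sigma> \<sigma>' \<and> \<sigma>' rOK 0 = of_bool (x \<in> U)"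
      using assms(3) by (auto simp: U_def less_Suc_eq_le)
  qed (use n_M in \<open>auto simp: same_upd B_less\<close>)
  then show ?thesis by (rule wp_time) simp
qed

definition listed :: "nat set \<Rightarrow> rows \<Rightarrow> bool" where
  "listed A \<sigma> \<longleftrightarrow> inj_on (\<sigma> rLST) {..<\<sigma> rCNT 0} \<and> \<sigma> rLST ` {..<\<sigma> rCNT 0} = A \<and> (\<forall>u\<in>A. \<sigma> rWT u = wt u)"

lemma listed_card: "listed A \<sigma> \<Longrightarrow> card A = \<sigma> rCNT 0"
  unfolding listed_def using card_image by fastforce

lemma make_list_spec:
  assumes "powok \<sigma>"
  shows "wp make_list (\<lambda>\<sigma>'. same {rLST, rWT, rCNT, rI, rOLD, rJ, rX, rOK, rA} \<sigma> \<sigma>' \<and> listed U \<sigma>')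
    (n * (card U * (5 * n + 16) + 5) + 5) \<sigma>"
proof -
  let ?R = "{rLST, rWT, rCNT, rI, rOLD, rJ, rX, rOK, rA}"
  define A where "A i = {u \<in> U. u < 2 ^ i}" for i
  let ?I = "\<lambda>i \<sigma>'. same ?R \<sigma> \<sigma>' \<and> listed (A i) \<sigma>'"
  let ?T = "(card U * ((1 + (1 + ((5 * n + 8) + (1 + (1 + 1) + 1)))) + 2) + 2)"
  have pow: "\<sigma>' 0 i = 2 ^ i" if "same ?R \<sigma> \<sigma>'" "i \<le> M" for \<sigma>' i
    using that assms sameD[of ?R \<sigma> \<sigma>' rPOW] by (simp add: powokD)
  have "wp make_list (\<lambda>\<sigma>'. same ?R \<sigma> \<sigma>' \<and> listed U \<sigma>')
     (1 + (1 + (1 + (n * ((1 + ?T) + 2) + 2)))) \<sigma>"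
    unfolding make_list_def
  proof (rule wp_put_Seq_val[where j = 0 and v = 0], simp, simp, simp, simp,
      rule wp_put_Seq_val[where j = 0 and v = 1], simp, simp, simp, simp add: B_less,
      rule wp_put_Seq_val[where j = 0 and v = 0], simp, simp, simp, simp, rule wp_for[where I = ?I])
    have "A 0 = {0}" using zero_in_U by (auto simp: A_def)
    then show "?I 0 (upd (upd (upd (upd \<sigma> rLST 0 0) rCNT 0 1) rWT 0 0) rI 0 0)"
      by (simp add: listed_def same_upd lessThan_Suc)
  next
    fix i \<sigma>1 assume i: "i < n" and I: "?I i \<sigma>1" and c: "\<sigma>1 rI 0 = i"
    define L where "L = \<sigma>1 rLST"
    define c where "c = \<sigma>1 rCNT 0"
    have cA: "c = card (A i)" using I listed_card[of "A i" \<sigma>1] by (simp add: c_def)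
    have cU: "c \<le> card U" unfolding cA by (intro card_mono) (auto simp: A_def)
    have LA: "L ` {..<c} = A i" "inj_on L {..<c}" using I by (auto simp: L_def c_def listed_def)
    \<comment> \<open>The state of the list in the middle of a round: bit \<open>i\<close> has been
      tried on the first \<open>j\<close> of the old entries.\<close>
    define A' where "A' j = A i \<union> {x \<in> U. \<exists>q<j. x = L q + 2 ^ i}" for j
    \<comment> \<open>The list grows while it is being read, so the invariant pins down its first
      \<open>c\<close> entries and the copy of the old length.\<close>
    let ?J = "\<lambda>j \<sigma>'. same ?R \<sigma> \<sigma>' \<and> \<sigma>' rI 0 = i \<and> \<sigma>' rOLD 0 = c \<and> (\<forall>q<c. \<sigma>' rLST q = L q) \<and>
      c \<le> \<sigma>' rCNT 0 \<and> listed (A' j) \<sigma>'"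
    have A'_Suc: "A' c = A (Suc i)"
    proof -
      have "x \<in> A (Suc i)" if "x \<in> U" "q < c" "x = L q + 2 ^ i" for x q
      proof -
        have "L q < 2 ^ i" using LA(1) that(2) by (auto simp: A_def)
        then show ?thesis using that by (auto simp: A_def)
      qed
      \<comment> \<open>Here closure under submasks enters: a member with top bit \<open>i\<close>
        stays a member when this bit is removed, hence it has been listed.\<close>
      moreover have "\<exists>q<c. x = L q + 2 ^ i" if "x \<in> U" "x < 2 ^ Suc i" "\<not> x < 2 ^ i" for x
      proof -
        have "x - 2 ^ i = x mod 2 ^ i" using that(2,3) by (simp add: le_mod_geq)
        moreover have "x mod 2 ^ i \<in> A i"
          using that(1) U_subset[of x "x mod 2 ^ i"] by (auto simp: A_def set_decode_mod_power)
        ultimately have "x - 2 ^ i \<in> L ` {..<c}" using LA by simp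
        then show ?thesis using that(3) by auto
      qed
      ultimately show ?thesis by (auto simp: A'_def A_def less_Suc_eq)
    qed
    have A'U: "A' j \<subseteq> U" for j by (auto simp: A'_def A_def)
    have "wp (Seq (putr rOLD (reg rCNT))
        (for_loop rJ 0 (reg rOLD)
          (Seq (putr rX (Plus (get rLST (reg rJ)) (get rPOW (reg rI))))
          (Seq (put rWT (reg rX) (Plus (get rWT (get rLST (reg rJ))) (Const 1)))
          (Seq test_member
            (If (reg rOK)
               (Seq (put rLST (reg rCNT) (reg rX)) (putr rCNT (Plus (reg rCNT) (Const 1))))
               Skip))))))
        (\<lambda>\<sigma>'. \<sigma>' rI 0 = i \<and> ?I (Suc i) (upd \<sigma>' rI 0 (Suc i))) 
        (1 + (c * ((1 + (1 + ((5 * n + 8) + (1 + (1 + 1) + 1)))) + 2) + 2)) \<sigma>1"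
    proof (rule wp_put_Seq_val[where j = 0 and v = c], simp, simp, simp add: c_def, goal_cases)
      case 1
      show ?case using exp_n_less card_U cU by (meson le_trans)
    next
      case 2
      show ?case
      proof (rule wp_for[where I = ?J])
      show "c < 2 ^ B" using exp_n_less card_U cU by (meson le_trans)
    next
      fix j \<sigma>2 assume j: "j < c" and J: "?J j \<sigma>2" and c2: "\<sigma>2 rJ 0 = j"
      let ?x = "L j + 2 ^ i"
      have Lj: "L j \<in> A i" using LA(1) j by blast
      then have Lj': "L j < 2 ^ i" "L j \<in> U" by (auto simp: A_def)
      have x: "?x < 2 ^ Suc i" using Lj' by simp
      have xn: "?x < 2 ^ n"
      proof -
        have "(2::nat) ^ Suc i \<le> 2 ^ n" using i by (intro power_increasing) auto
        then show ?thesis using x by linarith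
      qed
      have wtx: "wt ?x = Suc (wt (L j))"
        using Lj' by (simp add: set_decode_add_power card_insert_if) (auto simp: less_power_iff_set_decode)
      have P: "\<sigma>2 0 i = 2 ^ i" "powok \<sigma>2" using J pow i n_M by (auto simp: powok_def)
      have W: "\<sigma>2 rWT u = wt u" if "u \<in> A i" for u using J that by (auto simp: listed_def A'_def)
      have xA: "?x \<notin> A' j"
      proof
        assume "?x \<in> A' j"
        then obtain q where "q < j" "L q = L j" using Lj' by (auto simp: A'_def A_def)
        then show False using LA(2) j by (auto simp: inj_on_def)
      qed
      have A'S: "A' (Suc j) = (if ?x \<in> U then insert ?x (A' j) else A' j)"
        by (auto simp: A'_def less_Suc_eq)
      define \<sigma>3 where "\<sigma>3 = upd (upd \<sigma>2 rX 0 ?x) rWT ?x (Suc (wt (L j)))"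
      \<comment> \<open>Every prefix looked up by the membership test is either the new point, whose
        weight was stored just before, or a point listed in an earlier round.\<close>
      have xm: "?x mod 2 ^ p = ?x \<or> ?x mod 2 ^ p \<in> A i" for p
      proof (cases "p \<le> i")
        case True
        then have "?x mod 2 ^ p = L j mod 2 ^ p"
          by (metis mod_add_right_eq add.right_neutral dvd_imp_mod_0 le_imp_power_dvd)
        moreover have "L j mod 2 ^ p \<in> A i"
          using Lj' U_subset[of "L j" "L j mod 2 ^ p"] by (auto simp: A_def set_decode_mod_power intro: le_less_trans[OF mod_less_eq_dividend])
        ultimately show ?thesis by simp
      next
        case False
        then have "(2::nat) ^ Suc i \<le> 2 ^ p" by (intro power_increasing) auto
        then show ?thesis using x by simp
      qed
      have tm: "wp test_member (\<lambda>\<sigma>'. same {rOK, rA} \<sigma>3 \<sigma>' \<and> \<sigma>' rOK 0 = of_bool (?x \<in> U)) (5 * n + 8) \<sigma>3"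
      proof (rule test_member_spec)
        show "powok \<sigma>3" using P by (simp add: \<sigma>3_def powok_def)
        fix p show "\<sigma>3 rWT (?x mod 2 ^ p) = wt (?x mod 2 ^ p)"
          using xm[of p] W wtx by (auto simp: \<sigma>3_def)
      qed (use xn in \<open>auto simp: \<sigma>3_def\<close>)
      have s3: "same ?R \<sigma> \<sigma>3" using J by (auto simp: \<sigma>3_def intro!: same_upd)
      have L3: "listed (A' j) \<sigma>3" using J xA by (auto simp: listed_def \<sigma>3_def)
      have rows3: "\<sigma>3 rI 0 = i" "\<sigma>3 rOLD 0 = c" "\<forall>q<c. \<sigma>3 rLST q = L q" "c \<le> \<sigma>3 rCNT 0" "\<sigma>3 rJ 0 = j" "\<sigma>3 rX 0 = ?x"
         "\<sigma>3 rWT ?x = wt ?x"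
        using J c2 wtx by (auto simp: \<sigma>3_def)
      have cnt: "\<sigma>3 rCNT 0 \<le> 2 ^ n"
        using listed_card[OF L3] card_mono[OF finite_U A'U[of j]] card_U by simp
      show "wp (Seq (putr rX (Plus (get rLST (reg rJ)) (get rPOW (reg rI))))
          (Seq (put rWT (reg rX) (Plus (get rWT (get rLST (reg rJ))) (Const 1)))
          (Seq test_member
            (If (reg rOK)
               (Seq (put rLST (reg rCNT) (reg rX)) (putr rCNT (Plus (reg rCNT) (Const 1))))
               Skip))))
         (\<lambda>\<sigma>'. \<sigma>' rJ 0 = j \<and> ?J (Suc j) (upd \<sigma>' rJ 0 (Suc j))) (1 + (1 + ((5 * n + 8) + (1 + (1 + 1) + 1)))) \<sigma>2"
      proof (rule wp_put_Seq_val[where j = 0 and v = ?x], simp, simp, goal_cases)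
        case 1
        show ?case using J c2 j P by simp
      next
        case 2
        show ?case using xn by (simp add: exp_n_less)
      next
        case 3
        have v: "val (upd \<sigma>2 rX 0 ?x) (Plus (get rWT (get rLST (reg rJ))) (Const 1)) = Suc (wt (L j))"
          using J c2 j W[OF Lj] by simp
        have "Suc (wt (L j)) \<le> Suc n"
          using Lj' U_less card_mono[of "{..<n}" "set_decode (L j)"] by (simp add: less_power_iff_set_decode)
        then have le: "Suc (wt (L j)) < 2 ^ B" using n_M by (intro B_less) auto
        show ?case
        proof (rule wp_put_Seq_val[where j = ?x and v = "Suc (wt (L j))"], simp, simp, rule v, rule le, goal_cases)
          case 1
          show ?case
            unfolding \<sigma>3_def[symmetric]
          proof (rule wp_Seq, rule wp_conseq[OF tm])
            fix \<sigma>4 assume 4: "same {rOK, rA} \<sigma>3 \<sigma>4 \<and> \<sigma>4 rOK 0 = of_bool (?x \<in> U)"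
            have s4: "same ?R \<sigma> \<sigma>4" using 4 s3 by (auto intro: same_trans[of ?R \<sigma> \<sigma>3 "{rOK, rA}"])
            have r4: "\<sigma>4 r = \<sigma>3 r" if "r \<notin> {rOK, rA}" for r using 4 that by (auto simp: same_def)
            have L4: "listed (A' j) \<sigma>4" using L3 by (simp add: listed_def r4)
            show "wp (If (reg rOK)
               (Seq (put rLST (reg rCNT) (reg rX)) (putr rCNT (Plus (reg rCNT) (Const 1))))
               Skip) (\<lambda>\<sigma>'. \<sigma>' rJ 0 = j \<and> ?J (Suc j) (upd \<sigma>' rJ 0 (Suc j))) (1 + (1 + 1) + 1) \<sigma>4"
            proof (rule wp_If, goal_cases)
              case 1
              then have xU: "?x \<in> U" using 4 by (simp split: if_splits)
              have "card (insert ?x (A' j)) \<le> card U" using A'U[of j] xU by (intro card_mono) auto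
              then have cs: "Suc (\<sigma>3 rCNT 0) \<le> 2 ^ n"
                using listed_card[OF L3] xA finite_subset[OF A'U finite_U] card_U by simp
              have "listed (insert ?x (A' j)) (upd (upd \<sigma>4 rLST (\<sigma>3 rCNT 0) ?x) rCNT 0 (Suc (\<sigma>3 rCNT 0)))"
              proof -
                have eq: "(\<sigma>3 rLST)(\<sigma>3 rCNT 0 := ?x) ` {..<\<sigma>3 rCNT 0} = \<sigma>3 rLST ` {..<\<sigma>3 rCNT 0}"
                  by (intro image_cong) auto
                have ne: "\<sigma>3 rLST q \<noteq> ?x" if "q < \<sigma>3 rCNT 0" for q
                  using L3 xA that unfolding listed_def by (metis imageI lessThan_iff)
                then have ne': "?x \<noteq> \<sigma>3 rLST q" if "q < \<sigma>3 rCNT 0" for q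
                  using that by metis
                show ?thesis using L3 rows3(7) ne ne'
                  by (auto simp: listed_def r4 lessThan_Suc eq inj_on_def)
              qed
              then show ?case using r4 rows3 s4 xU cs xn
                by (intro wp_put_Seq wp_put) (auto simp: A'S exp_n_less intro!: same_upd simp: listed_def)
            next
              case 2
              then have xU: "?x \<notin> U" using 4 by (simp split: if_splits)
              show ?case using r4 rows3 s4 xU L4
                by (intro wp_Skip) (auto simp: A'S intro!: same_upd simp: listed_def)
            qed
          qed
        qed
      qed
    next
      fix \<sigma>' assume "?J c \<sigma>'"
      then show "\<sigma>' rI 0 = i \<and> ?I (Suc i) (upd \<sigma>' rI 0 (Suc i))"
        unfolding A'_Suc by (auto simp: listed_def intro!: same_upd)
      qed (use I c in \<open>auto simp: L_def c_def A'_def listed_def intro!: same_upd\<close>)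
    qed
    then show "wp (Seq (putr rOLD (reg rCNT))
        (for_loop rJ 0 (reg rOLD)
          (Seq (putr rX (Plus (get rLST (reg rJ)) (get rPOW (reg rI))))
          (Seq (put rWT (reg rX) (Plus (get rWT (get rLST (reg rJ))) (Const 1)))
          (Seq test_member
            (If (reg rOK)
               (Seq (put rLST (reg rCNT) (reg rX)) (putr rCNT (Plus (reg rCNT) (Const 1))))
               Skip))))))
        (\<lambda>\<sigma>'. \<sigma>' rI 0 = i \<and> ?I (Suc i) (upd \<sigma>' rI 0 (Suc i))) (1 + ?T) \<sigma>1"
      by (rule wp_time) (use cU in \<open>auto intro!: mult_le_mono1\<close>)
  next
    fix \<sigma>' assume "?I n \<sigma>'"
    moreover have "A n = U" by (auto simp: A_def U_def)
    ultimately show "same ?R \<sigma> \<sigma>' \<and> listed U \<sigma>'" by simp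
  qed (use n_M in \<open>auto simp: B_less\<close>)
  then show ?thesis by (rule wp_time) (simp add: algebra_simps)
qed

end

section \<open>Reading the encoding and evaluating the system\<close>

definition b2n :: "bit \<Rightarrow> nat" where "b2n b = (if b = 1 then 1 else 0)"

lemma b2n_simps [simp]: "b2n 0 = 0" "b2n 1 = 1"
  by (simp_all add: b2n_def)

lemma b2n_le: "b2n b \<le> 1"
  by (simp add: b2n_def)

lemma b2n_add: "(b2n a + b2n b) mod 2 = b2n (a + b)"
  by (cases a; cases b) auto

lemma b2n_mult: "b2n a * b2n b = b2n (a * b)"
  by (cases a; cases b) auto

lemma b2n_of_bool [simp]: "b2n (of_bool p) = of_bool p"
  by simp

lemma b2n_eq_0_iff [simp]: "b2n a = 0 \<longleftrightarrow> a = 0"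
  by (cases a) auto

definition bt :: "nat \<Rightarrow> nat \<Rightarrow> bit" where "bt x i = of_bool (i \<in> set_decode x)"

lemma b2n_bt: "(x div 2 ^ i) mod 2 = b2n (bt x i)"
  by (auto simp: bt_def mem_set_decode_iff mod_2_eq_odd)

lemma sum_binomial_le: "(\<Sum>i\<le>d. n ^ i) \<le> (n + 1 :: nat) ^ d"
proof (induction d)
  case (Suc d)
  have "n ^ Suc d \<le> n * (n + 1) ^ d"
    unfolding power_Suc by (intro mult_le_mono power_mono) auto
  moreover have "(n + 1) ^ Suc d = (n + 1) ^ d + n * (n + 1) ^ d" by simp
  moreover have "(\<Sum>i\<le>Suc d. n ^ i) = (\<Sum>i\<le>d. n ^ i) + n ^ Suc d" by simp
  ultimately show ?case using Suc by linarith
qed simp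

text \<open>Distinct monomials are distinct lists of at most \<open>d\<close> variables, and such
  lists are counted without regard to order.\<close>

lemma length_anf_le:
  assumes "is_anf n P" "degree_at_most d P"
  shows "length P \<le> (n + 1) ^ d"
proof -
  have "length P = card (set P)" using assms by (simp add: is_anf_def distinct_card)
  also have "\<dots> \<le> card {xs. set xs \<subseteq> {..<n} \<and> length xs \<le> d}"
    using assms by (intro card_mono) (auto simp: is_anf_def degree_at_most_def finite_lists_length_le)
  also have "\<dots> = (\<Sum>i\<le>d. n ^ i)" by (subst card_lists_length_le) auto
  also have "\<dots> \<le> (n + 1) ^ d" by (rule sum_binomial_le)
  finally show ?thesis .
qed

lemma sum_choose_le: "(\<Sum>i\<le>d. n choose i) \<le> (n + 1) ^ d"
proof -
  have "n choose i \<le> n ^ i" for i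
    by (cases "i \<le> n") (auto simp: binomial_le_pow binomial_eq_0)
  then have "(\<Sum>i\<le>d. n choose i) \<le> (\<Sum>i\<le>d. n ^ i)" by (rule sum_mono)
  then show ?thesis using sum_binomial_le le_trans by blast
qed

context instance_context
begin

lemma in_E:
  assumes "P \<in> set E"
  shows "is_anf n P" "degree_at_most d P" "length P \<le> (n + 1) ^ d"
  using assms inst length_anf_le by (auto simp: instances_def is_system_def)

lemma in_anf:
  assumes "P \<in> set E" "u \<in> set P"
  shows "set u \<subseteq> {..<n}" "length u \<le> d" "length u \<le> n" "distinct u"
proof -
  have "sorted_wrt (<) u" and *: "set u \<subseteq> {..<n}" "length u \<le> d"
    using in_E[OF assms(1)] assms(2) by (auto simp: is_anf_def degree_at_most_def)
  then have d: "distinct u" using strict_sorted_iff by blast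
  then have "length u \<le> n" using * card_mono[of "{..<n}" "set u"] by (simp add: distinct_card)
  then show "set u \<subseteq> {..<n}" "length u \<le> d" "length u \<le> n" "distinct u" using * d by auto
qed

lemma m_le: "m \<le> (n + 1) ^ d"
  using inst sum_choose_le[of n d] by (simp add: instances_def m_def)

lemma m_M: "4 * n + 8 + m \<le> M"
  using m_le by (simp add: M_def)

text \<open>With \<open>X = (n + 1) ^ d\<close> there are at most \<open>X\<close> equations of at
  most \<open>X\<close> monomials, each taking at most \<open>d + 1\<close> cells. The constant
  \<open>d + 4\<close> in \<open>b0\<close> absorbs the length fields as well.\<close>

lemma length_encoding: "length (encode_system n E) \<le> b0"
proof -
  let ?X = "(n + 1) ^ d"
  have anf: "length (encode_anf P) \<le> 1 + ?X * (d + 1)" if "P \<in> set E" for P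
  proof -
    have "(\<Sum>u\<leftarrow>P. length (encode_monomial u)) \<le> (\<Sum>u\<leftarrow>P. d + 1)"
      using in_anf[OF that] by (intro sum_list_mono) (auto simp: encode_monomial_def)
    also have "\<dots> = length P * (d + 1)" by (simp add: sum_list_triv)
    also have "\<dots> \<le> ?X * (d + 1)" using in_E[OF that] by (intro mult_le_mono) auto
    finally show ?thesis by (simp add: encode_anf_def length_concat comp_def)
  qed
  have "(\<Sum>P\<leftarrow>E. length (encode_anf P)) \<le> (\<Sum>P\<leftarrow>E. 1 + ?X * (d + 1))"
    using anf by (intro sum_list_mono) auto
  also have "\<dots> = m * (1 + ?X * (d + 1))" by (simp add: sum_list_triv m_def)
  also have "\<dots> \<le> ?X * (1 + ?X * (d + 1))" using m_le by (intro mult_le_mono) auto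
  finally have 1: "length (encode_system n E) \<le> 2 + (?X + ?X * ?X * (d + 1))"
    by (simp add: encode_system_def length_concat comp_def algebra_simps)
  have "2 + (X + X * X * (d + 1)) \<le> (d + 4) * (X * X)" if "1 \<le> X" for X
  proof -
    have "1 \<le> X * X" "X \<le> X * X" using that mult_le_mono[of 1 X 1 X] by auto
    moreover have "(d + 4) * (X * X) = X * X * (d + 1) + 3 * (X * X)" by (simp add: algebra_simps)
    ultimately show ?thesis by linarith
  qed
  then have "2 + (?X + ?X * ?X * (d + 1)) \<le> (d + 4) * (?X * ?X)" by simp
  also have "\<dots> = b0" by (simp add: b0_def power_mult power2_eq_square flip: power_add mult_2)
  finally show ?thesis using 1 by linarith
qed

definition reads :: "nat \<Rightarrow> nat list \<Rightarrow> bool" where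
  "reads p xs \<longleftrightarrow> (\<forall>k<length xs. p + k < b0 \<and> inp (p + k) = xs ! k)"

lemma reads_Cons: "reads p (x # xs) \<longleftrightarrow> p < b0 \<and> inp p = x \<and> reads (Suc p) xs"
  by (auto simp: reads_def less_Suc_eq_0_disj all_conj_distrib)

lemma reads_append: "reads p (xs @ ys) \<Longrightarrow> reads p xs \<and> reads (p + length xs) ys"
proof -
  assume *: "reads p (xs @ ys)"
  have "p + length xs + k < b0 \<and> inp (p + length xs + k) = ys ! k" if "k < length ys" for k
    using *[unfolded reads_def, rule_format, of "length xs + k"] that by (simp add: nth_append add.assoc)
  moreover have "p + k < b0 \<and> inp (p + k) = xs ! k" if "k < length xs" for k
    using *[unfolded reads_def, rule_format, of k] that by (simp add: nth_append)
  ultimately show ?thesis by (auto simp: reads_def)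
qed

lemma reads_concat:
  assumes "reads p (concat (map f xs))" "j < length xs"
  shows "reads (p + length (concat (map f (take j xs)))) (f (xs ! j))"
proof -
  have "concat (map f xs) = concat (map f (take j xs)) @ f (xs ! j) @ concat (map f (drop (Suc j) xs))"
    using assms(2) by (metis append_take_drop_id concat.simps(2) concat_append list.map(2) map_append Cons_nth_drop_Suc)
  then show ?thesis using assms(1) reads_append by metis
qed

lemma reads_encoding: "reads 0 (encode_system n E)"
  using length_encoding by (auto simp: reads_def inp_def input_memory_def)

lemma b0_less_B: "x \<le> b0 + M + 4 \<Longrightarrow> x < 2 ^ B"
  by (rule less_power_B) (simp add: B_def)

lemma le_1_less_B: "x \<le> 1 \<Longrightarrow> x < 2 ^ B" for x :: nat
  by (rule less_power_B) (simp add: B_def)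

lemma b2n_less_B [simp]: "b2n b < 2 ^ B"
  using b2n_le by (rule le_1_less_B)

definition sysval :: "nat \<Rightarrow> nat \<Rightarrow> bit" where
  "sysval j x = (\<Sum>u\<leftarrow>E ! j. \<Prod>i\<leftarrow>u. bt x i)"

text \<open>The pointer ends exactly behind the monomial, where the next one starts; the encoding
  can thus be scanned without a table of offsets.\<close>

lemma eval_monomial_spec:
  assumes "powok \<sigma>" "\<sigma> rX 0 = x" "\<sigma> rPTR 0 = p" "reads p (encode_monomial u)" "set u \<subseteq> {..<n}" "length u \<le> n"
  shows "wp eval_monomial (\<lambda>\<sigma>'. same {rPROD, rN2, rPTR, rV} \<sigma> \<sigma>' \<and>
    \<sigma>' rPROD 0 = b2n (\<Prod>i\<leftarrow>u. bt x i) \<and> \<sigma>' rPTR 0 = p + length (encode_monomial u)) (4 * n + 5) \<sigma>"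
proof -
  let ?R = "{rPROD, rN2, rPTR, rV}"
  let ?I = "\<lambda>j \<sigma>'. same ?R \<sigma> \<sigma>' \<and> \<sigma>' rN2 0 = length u \<and>
    \<sigma>' rPROD 0 = b2n (\<Prod>i\<leftarrow>take j u. bt x i) \<and> \<sigma>' rPTR 0 = Suc p + j"
  have p: "p < b0" "inp p = length u" "reads (Suc p) u"
    using assms(4) by (auto simp: encode_monomial_def reads_Cons)
  have "wp eval_monomial (\<lambda>\<sigma>'. same ?R \<sigma> \<sigma>' \<and> \<sigma>' rPROD 0 = b2n (\<Prod>i\<leftarrow>u. bt x i) \<and>
     \<sigma>' rPTR 0 = p + length (encode_monomial u)) (1 + (1 + (1 + (length u * ((1 + 1) + 2) + 2)))) \<sigma>"
    unfolding eval_monomial_def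
  proof (rule wp_put_Seq_val[where j = 0 and v = 1], simp, simp, simp, simp add: B_less,
      rule wp_put_Seq_val[where j = 0 and v = "length u"], simp, simp, goal_cases)
    case 1 show ?case using p assms by (simp add: val_input)
  next
    case 2 show ?case using n_M assms by (intro B_less) auto
  next
    case 3
    show ?case
    proof (rule wp_put_Seq_val[where j = 0 and v = "Suc p"], simp, simp, use assms in simp, use p in \<open>simp add: b0_less_B\<close>,
       rule wp_for[where I = ?I])
      fix j \<sigma>1 assume j: "j < length u" and I: "?I j \<sigma>1" and c: "\<sigma>1 rV 0 = j"
      have r: "Suc p + j < b0" "inp (Suc p + j) = u ! j" using p(3) j by (auto simp: reads_def)
      have uj: "u ! j < n" using assms(5) j nth_mem by blast
      have rows: "\<sigma>1 rX 0 = x" "\<sigma>1 0 (u ! j) = 2 ^ (u ! j)"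
        using I assms powokD[OF assms(1)] n_M uj by (auto simp: same_def)
      have v: "\<sigma>1 rPROD 0 * ((x div 2 ^ (u ! j)) mod 2) = b2n (\<Prod>i\<leftarrow>take (Suc j) u. bt x i)"
        using I j by (simp add: b2n_bt b2n_mult take_Suc_conv_app_nth)
      show "wp (Seq (putr rPROD (Times (reg rPROD) (bitx (reg rX) (Load (reg rPTR)))))
            (putr rPTR (Plus (reg rPTR) (Const 1))))
         (\<lambda>\<sigma>'. \<sigma>' rV 0 = j \<and> ?I (Suc j) (upd \<sigma>' rV 0 (Suc j))) (1 + 1) \<sigma>1"
      proof (rule wp_put_Seq_val[where j = 0 and v = "b2n (\<Prod>i\<leftarrow>take (Suc j) u. bt x i)"], simp, simp, goal_cases)
        case 1 show ?case using I r rows v by (simp add: val_input)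
      next
        case 3
        show ?case
          by (rule wp_put_val[where j = 0 and v = "Suc p + Suc j"])
            (use I c r in \<open>auto intro!: same_upd b0_less_B\<close>)
      qed simp
    qed (use assms(6) n_M in \<open>auto intro!: same_upd simp: encode_monomial_def B_less\<close>)
  qed
  then show ?thesis by (rule wp_time) (use assms in auto)
qed

lemma eval_anf_spec:
  assumes "powok \<sigma>" "\<sigma> rX 0 = x" "\<sigma> rPTR 0 = p" "reads p (encode_anf P)" "P \<in> set E"
  shows "wp eval_anf (\<lambda>\<sigma>'. same {rPROD, rN2, rPTR, rV, rACC, rN1, rA} \<sigma> \<sigma>' \<and>
    \<sigma>' rACC 0 = b2n (\<Sum>u\<leftarrow>P. \<Prod>i\<leftarrow>u. bt x i) \<and> \<sigma>' rPTR 0 = p + length (encode_anf P)) (M * (4 * n + 8) + 5) \<sigma>"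
proof -
  let ?R = "{rPROD, rN2, rPTR, rV, rACC, rN1, rA}"
  let ?len = "\<lambda>j. length (concat (map encode_monomial (take j P)))"
  let ?I = "\<lambda>j \<sigma>'. same ?R \<sigma> \<sigma>' \<and> \<sigma>' rN1 0 = length P \<and>
    \<sigma>' rACC 0 = b2n (\<Sum>u\<leftarrow>take j P. \<Prod>i\<leftarrow>u. bt x i) \<and> \<sigma>' rPTR 0 = Suc p + ?len j"
  have p: "p < b0" "inp p = length P" "reads (Suc p) (concat (map encode_monomial P))"
    using assms(4) by (auto simp: encode_anf_def reads_Cons)
  have PM: "length P \<le> M" using in_E[OF assms(5)] by (simp add: M_def)
  have "wp eval_anf (\<lambda>\<sigma>'. same ?R \<sigma> \<sigma>' \<and> \<sigma>' rACC 0 = b2n (\<Sum>u\<leftarrow>P. \<Prod>i\<leftarrow>u. bt x i) \<and>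
    \<sigma>' rPTR 0 = p + length (encode_anf P)) (1 + (1 + (1 + (length P * (((4 * n + 5) + 1) + 2) + 2)))) \<sigma>"
    unfolding eval_anf_def
  proof (rule wp_put_Seq_val[where j = 0 and v = 0], simp, simp, simp, simp,
      rule wp_put_Seq_val[where j = 0 and v = "length P"], simp, simp, goal_cases)
    case 1 show ?case using p assms by (simp add: val_input)
  next
    case 2 show ?case using PM by (intro B_less) auto
  next
    case 3
    show ?case
    proof (rule wp_put_Seq_val[where j = 0 and v = "Suc p"], simp, simp, use assms in simp, use p in \<open>simp add: b0_less_B\<close>,
       rule wp_for[where I = ?I])
      fix j \<sigma>1 assume j: "j < length P" and I: "?I j \<sigma>1" and c: "\<sigma>1 rA 0 = j"
      have u: "set (P ! j) \<subseteq> {..<n}" "length (P ! j) \<le> n"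
        using in_anf[OF assms(5)] j by auto
      have "reads (Suc p + ?len j) (encode_monomial (P ! j))" using reads_concat[OF p(3) j] .
      then have m: "wp eval_monomial (\<lambda>\<sigma>'. same {rPROD, rN2, rPTR, rV} \<sigma>1 \<sigma>' \<and>
        \<sigma>' rPROD 0 = b2n (\<Prod>i\<leftarrow>P ! j. bt x i) \<and>
        \<sigma>' rPTR 0 = Suc p + ?len j + length (encode_monomial (P ! j))) (4 * n + 5) \<sigma>1"
        using I assms u by (intro eval_monomial_spec) (auto simp: same_def powok_def)
      show "wp (Seq eval_monomial (putr rACC (modx (Plus (reg rACC) (reg rPROD)) (Const 2))))
         (\<lambda>\<sigma>'. \<sigma>' rA 0 = j \<and> ?I (Suc j) (upd \<sigma>' rA 0 (Suc j))) ((4 * n + 5) + 1) \<sigma>1"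
      proof (rule wp_Seq, rule wp_conseq[OF m])
        fix \<sigma>2 assume 2: "same {rPROD, rN2, rPTR, rV} \<sigma>1 \<sigma>2 \<and> \<sigma>2 rPROD 0 = b2n (\<Prod>i\<leftarrow>P ! j. bt x i) \<and>
          \<sigma>2 rPTR 0 = Suc p + ?len j + length (encode_monomial (P ! j))"
        then have s: "same ?R \<sigma> \<sigma>2" using I by (auto intro: same_trans[of ?R \<sigma> \<sigma>1])
        have rows: "\<sigma>2 rACC = \<sigma>1 rACC" "\<sigma>2 rN1 = \<sigma>1 rN1" "\<sigma>2 rA = \<sigma>1 rA"
          using 2 by (auto simp: same_def)
        show "wp (putr rACC (modx (Plus (reg rACC) (reg rPROD)) (Const 2)))
          (\<lambda>\<sigma>'. \<sigma>' rA 0 = j \<and> ?I (Suc j) (upd \<sigma>' rA 0 (Suc j))) 1 \<sigma>2"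
        proof (rule wp_put_val[where j = 0 and v = "b2n (\<Sum>u\<leftarrow>take (Suc j) P. \<Prod>i\<leftarrow>u. bt x i)"], simp, simp, goal_cases)
          case 1
          show ?case using 2 I rows j by (simp add: b2n_add take_Suc_conv_app_nth)
        next
          case 3
          show ?case using 2 I rows j c s by (auto simp: take_Suc_conv_app_nth intro!: same_upd)
        qed simp
      qed
    qed (use PM in \<open>auto intro!: same_upd simp: encode_anf_def B_less\<close>)
  qed
  then show ?thesis
  proof (rule wp_time)
    have "length P * (4 * n + 8) \<le> M * (4 * n + 8)" using PM by (intro mult_le_mono) auto
    then show "1 + (1 + (1 + (length P * (((4 * n + 5) + 1) + 2) + 2))) \<le> M * (4 * n + 8) + 5"
      by (simp add: algebra_simps)
  qed
qed

abbreviation "rEVAL \<equiv> {rPROD, rN2, rPTR, rV, rACC, rN1, rA, rVEC, rJ}"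

lemma eval_system_spec:
  assumes "powok \<sigma>" "\<sigma> rX 0 = x"
  shows "wp eval_system (\<lambda>\<sigma>'. same rEVAL \<sigma> \<sigma>' \<and>
    (\<forall>i<M. \<sigma>' rVEC i = b2n (if i < m then sysval i x else 0))) (M * (M * (4 * n + 8) + 11) + 5) \<sigma>"
proof -
  let ?R = "rEVAL"
  let ?len = "\<lambda>j. length (concat (map encode_anf (take j E)))"
  let ?Z = "\<lambda>j \<sigma>'. same ?R \<sigma> \<sigma>' \<and> (\<forall>i<j. \<sigma>' rVEC i = 0)"
  let ?I = "\<lambda>j \<sigma>'. same ?R \<sigma> \<sigma>' \<and> (\<forall>i<M. \<sigma>' rVEC i = b2n (if i < j then sysval i x else 0)) \<and> \<sigma>' rPTR 0 = 2 + ?len j"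
  have rd: "reads 2 (concat (map encode_anf E))"
    using reads_encoding by (simp add: encode_system_def reads_Cons eval_nat_numeral)
  have "wp eval_system (\<lambda>\<sigma>'. same ?R \<sigma> \<sigma>' \<and> (\<forall>i<M. \<sigma>' rVEC i = b2n (if i < m then sysval i x else 0)))
     ((M * (1 + 2) + 2) + (1 + (m * (((M * (4 * n + 8) + 5) + 1) + 2) + 2))) \<sigma>"
    unfolding eval_system_def
  proof (rule wp_Seq, rule wp_for[where I = ?Z])
    fix j \<sigma>1 assume j: "j < M" and I: "?Z j \<sigma>1" and c: "\<sigma>1 rJ 0 = j"
    show "wp (put rVEC (reg rJ) (Const 0)) (\<lambda>\<sigma>'. \<sigma>' rJ 0 = j \<and> ?Z (Suc j) (upd \<sigma>' rJ 0 (Suc j))) 1 \<sigma>1"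
      by (rule wp_put_val[where j = j and v = 0]) (use I c in \<open>auto intro!: same_upd simp: less_Suc_eq\<close>)
  next
    fix \<sigma>1 assume I: "?Z M \<sigma>1"
    show "wp (Seq (putr rPTR (Const 2)) (for_loop rJ 0 mx (Seq eval_anf (put rVEC (reg rJ) (reg rACC)))))
      (\<lambda>\<sigma>'. same ?R \<sigma> \<sigma>' \<and> (\<forall>i<M. \<sigma>' rVEC i = b2n (if i < m then sysval i x else 0)))
      (1 + (m * (((M * (4 * n + 8) + 5) + 1) + 2) + 2)) \<sigma>1"
    proof (rule wp_put_Seq_val[where j = 0 and v = 2], simp, simp, simp, simp add: B_less, rule wp_for[where I = ?I])
      fix j \<sigma>2 assume j: "j < m" and I: "?I j \<sigma>2" and c: "\<sigma>2 rJ 0 = j"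
      have "reads (2 + ?len j) (encode_anf (E ! j))" using reads_concat[OF rd] j by (simp add: m_def)
      then have a: "wp eval_anf (\<lambda>\<sigma>'. same {rPROD, rN2, rPTR, rV, rACC, rN1, rA} \<sigma>2 \<sigma>' \<and>
        \<sigma>' rACC 0 = b2n (\<Sum>u\<leftarrow>E ! j. \<Prod>i\<leftarrow>u. bt x i) \<and> \<sigma>' rPTR 0 = 2 + ?len j + length (encode_anf (E ! j)))
        (M * (4 * n + 8) + 5) \<sigma>2"
        using I assms j by (intro eval_anf_spec) (auto simp: same_def powok_def m_def)
      show "wp (Seq eval_anf (put rVEC (reg rJ) (reg rACC))) 
        (\<lambda>\<sigma>'. \<sigma>' rJ 0 = j \<and> ?I (Suc j) (upd \<sigma>' rJ 0 (Suc j))) ((M * (4 * n + 8) + 5) + 1) \<sigma>2"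
      proof (rule wp_Seq, rule wp_conseq[OF a])
        fix \<sigma>3 assume 3: "same {rPROD, rN2, rPTR, rV, rACC, rN1, rA} \<sigma>2 \<sigma>3 \<and>
          \<sigma>3 rACC 0 = b2n (\<Sum>u\<leftarrow>E ! j. \<Prod>i\<leftarrow>u. bt x i) \<and> \<sigma>3 rPTR 0 = 2 + ?len j + length (encode_anf (E ! j))"
        then have s: "same ?R \<sigma> \<sigma>3" using I by (auto intro: same_trans[of ?R \<sigma> \<sigma>2])
        have rows: "\<sigma>3 rVEC = \<sigma>2 rVEC" "\<sigma>3 rJ = \<sigma>2 rJ" using 3 by (auto simp: same_def)
        show "wp (put rVEC (reg rJ) (reg rACC)) (\<lambda>\<sigma>'. \<sigma>' rJ 0 = j \<and> ?I (Suc j) (upd \<sigma>' rJ 0 (Suc j))) 1 \<sigma>3"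
          by (rule wp_put_val[where j = j and v = "b2n (sysval j x)"])
            (use 3 s rows c I j in \<open>auto simp: sysval_def take_Suc_conv_app_nth m_def less_Suc_eq intro!: same_upd\<close>)
      qed
    qed (use I m_M in \<open>auto intro!: same_upd simp: B_less\<close>)
  qed (use n_M in \<open>auto intro!: same_upd simp: B_less\<close>)
  then show ?thesis
  proof (rule wp_time)
    have "m * (M * (4 * n + 8) + 8) \<le> M * (M * (4 * n + 8) + 8)" using m_M by (intro mult_le_mono) auto
    then show "M * (1 + 2) + 2 + (1 + (m * (M * (4 * n + 8) + 5 + 1 + 2) + 2)) \<le> M * (M * (4 * n + 8) + 11) + 5"
      by (simp add: algebra_simps)
  qed
qed

end

section \<open>Hash equations, random combinations and leaf values\<close>

context instance_context
begin

definition tp :: "(nat \<Rightarrow> bool) \<Rightarrow> nat \<Rightarrow> nat \<Rightarrow> nat \<Rightarrow> nat \<Rightarrow> bit" where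
  "tp \<omega> k j i c = of_bool (\<omega> (idx k j i c))"

definition tapeok :: "(nat \<Rightarrow> bool) \<Rightarrow> rows \<Rightarrow> bool" where
  "tapeok \<omega> \<sigma> \<longleftrightarrow> \<sigma> rTAPE = (\<lambda>i. of_bool (\<omega> i))"

lemma tapeok_tp: "tapeok \<omega> \<sigma> \<Longrightarrow> \<sigma> rTAPE (idx k j i c) = b2n (tp \<omega> k j i c)"
  by (simp add: tapeok_def tp_def)

text \<open>A random affine form whose constant term is stored in column \<open>n\<close>, behind
  the coefficients. Constant term and coefficients together make its values at two distinct points
  independent.\<close>

definition hash :: "(nat \<Rightarrow> bool) \<Rightarrow> nat \<Rightarrow> nat \<Rightarrow> nat \<Rightarrow> bit" where
  "hash \<omega> \<tau> q x = tp \<omega> D \<tau> q n + (\<Sum>v<n. tp \<omega> D \<tau> q v * bt x v)"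

text \<open>
  The equations to be satisfied simultaneously: the given system, the first \<open>\<kappa>\<close> hash equations of
  trial \<open>\<tau>\<close>, and \<open>x\<^sub>\<iota> = 1\<close>.
\<close>

definition vec0 :: "(nat \<Rightarrow> bool) \<Rightarrow> nat \<times> nat \<times> nat \<Rightarrow> nat \<Rightarrow> nat \<Rightarrow> bit" where
  "vec0 \<omega> = (\<lambda>(\<tau>, \<kappa>, \<iota>) x i. if i < m then sysval i x else
     if i < m + n + 1 then (if i < m + \<kappa> then hash \<omega> \<tau> (i - m) x else 0) else
     if i = m + n + 1 then 1 + bt x \<iota> else 0)"

text \<open>
  Random linear combinations of the equations of level \<open>k\<close>; four more of them than summed
  variables make a sum over the latter wrong with probability at most 1/16.
\<close>

definition apply_tape :: "(nat \<Rightarrow> bool) \<Rightarrow> nat \<Rightarrow> nat \<Rightarrow> (nat \<Rightarrow> bit) \<Rightarrow> nat \<Rightarrow> bit" where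
  "apply_tape \<omega> k j v i = (if i < nn (Suc k) + 4 then \<Sum>c<M. tp \<omega> k j i c * v c else 0)"

text \<open>Each level compresses the vector of the level before; \<open>rep k\<close> selects which
  of the \<open>M\<close> independent matrices of level \<open>k\<close> is used.\<close>

primrec vec :: "(nat \<Rightarrow> bool) \<Rightarrow> nat \<times> nat \<times> nat \<Rightarrow> nat \<Rightarrow> (nat \<Rightarrow> nat) \<Rightarrow> nat \<Rightarrow> nat \<Rightarrow> bit" where
  "vec \<omega> t 0 rep x = vec0 \<omega> t x"
| "vec \<omega> t (Suc k) rep x = apply_tape \<omega> k (rep k) (vec \<omega> t k rep x)"

text \<open>At level 0 this is the exact indicator. Compression maps zero vectors to zero vectors,
  so higher levels can only turn values 0 into 1.\<close>

definition F :: "(nat \<Rightarrow> bool) \<Rightarrow> nat \<times> nat \<times> nat \<Rightarrow> nat \<Rightarrow> (nat \<Rightarrow> nat) \<Rightarrow> nat \<Rightarrow> bit" where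
  "F \<omega> t k rep x = of_bool (\<forall>i<M. vec \<omega> t k rep x i = 0)"

lemma eval_hash_spec:
  assumes "powok \<sigma>" "tapeok \<omega> \<sigma>" "\<sigma> rX 0 = x" "\<sigma> rTAU 0 = \<tau>" "\<sigma> rKAP 0 = \<kappa>" "\<sigma> rIOTA 0 = \<iota>"
    "\<kappa> \<le> n + 1" "\<iota> < n" "\<forall>i<M. \<sigma> rVEC i = b2n (if i < m then sysval i x else 0)"
  shows "wp eval_hash (\<lambda>\<sigma>'. same rEVAL \<sigma> \<sigma>' \<and>
    (\<forall>i<M. \<sigma>' rVEC i = b2n (vec0 \<omega> (\<tau>, \<kappa>, \<iota>) x i))) ((n + 1) * (3 * n + 6) + 3) \<sigma>"
proof -
  let ?I = "\<lambda>j \<sigma>'. same rEVAL \<sigma> \<sigma>' \<and> (\<forall>i<M. \<sigma>' rVEC i = b2n (if i < m then sysval i x else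
     if i < m + j then hash \<omega> \<tau> (i - m) x else 0))"
  have rows: "\<sigma>' 0 = \<sigma> 0" "\<sigma>' 1 = \<sigma> 1" "\<sigma>' rX 0 = x" "\<sigma>' rTAU 0 = \<tau>" "\<sigma>' rKAP 0 = \<kappa>" "\<sigma>' rIOTA 0 = \<iota>"
    "\<sigma>' 1 (idx a b i e) = b2n (tp \<omega> a b i e)"
    if "same rEVAL \<sigma> \<sigma>'" for \<sigma>' a b i e
    using that assms tapeok_tp[of \<omega> \<sigma>] by (simp_all add: same_def)
  have "wp eval_hash (\<lambda>\<sigma>'. same rEVAL \<sigma> \<sigma>' \<and> (\<forall>i<M. \<sigma>' rVEC i = b2n (vec0 \<omega> (\<tau>, \<kappa>, \<iota>) x i)))
     ((\<kappa> * ((1 + ((n * (1 + 2) + 2) + 1)) + 2) + 2) + 1) \<sigma>"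
    unfolding eval_hash_def
  proof (rule wp_Seq, rule wp_for[where I = ?I])
    fix j \<sigma>1 assume j: "j < \<kappa>" and I: "?I j \<sigma>1" and c: "\<sigma>1 rJ 0 = j"
    let ?J = "\<lambda>v \<sigma>'. same rEVAL \<sigma> \<sigma>' \<and> \<sigma>' rVEC = \<sigma>1 rVEC \<and> \<sigma>' rJ 0 = j \<and>
       \<sigma>' rACC 0 = b2n (tp \<omega> D \<tau> j n + (\<Sum>v<v. tp \<omega> D \<tau> j v * bt x v))"
    note r1 = rows[OF I[THEN conjunct1]]
    show "wp (Seq (putr rACC (tapex (Const D) (reg rTAU) (reg rJ) nx))
       (Seq (for_loop rV 0 nx
          (putr rACC (modx (Plus (reg rACC)
             (Times (tapex (Const D) (reg rTAU) (reg rJ) (reg rV)) (bitx (reg rX) (reg rV)))) (Const 2))))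
        (put rVEC (Plus mx (reg rJ)) (reg rACC))))
      (\<lambda>\<sigma>'. \<sigma>' rJ 0 = j \<and> ?I (Suc j) (upd \<sigma>' rJ 0 (Suc j))) (1 + ((n * (1 + 2) + 2) + 1)) \<sigma>1"
    proof (rule wp_put_Seq_val[where j = 0 and v = "b2n (tp \<omega> D \<tau> j n)"], simp, simp, use c r1 in simp, simp,
        rule wp_Seq, rule wp_for[where I = ?J])
      fix v \<sigma>2 assume v: "v < n" and J: "?J v \<sigma>2" and c2: "\<sigma>2 rV 0 = v"
      note r2 = rows[OF J[THEN conjunct1]]
      have p: "\<sigma>2 0 v = 2 ^ v" using r2 assms(1) v n_M by (simp add: powok_def)
      show "wp (putr rACC (modx (Plus (reg rACC)
             (Times (tapex (Const D) (reg rTAU) (reg rJ) (reg rV)) (bitx (reg rX) (reg rV)))) (Const 2)))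
         (\<lambda>\<sigma>'. \<sigma>' rV 0 = v \<and> ?J (Suc v) (upd \<sigma>' rV 0 (Suc v))) 1 \<sigma>2"
      proof (rule wp_put_val[where j = 0 and v = "b2n (tp \<omega> D \<tau> j n + (\<Sum>v<Suc v. tp \<omega> D \<tau> j v * bt x v))"], simp, simp, goal_cases)
        case 1
        show ?case using r2 J c2 p
          by (simp add: b2n_bt b2n_mult b2n_add add.assoc del: One_nat_def)
      next
        case 3
        show ?case using J c2 by (auto intro!: same_upd)
      qed (rule b2n_less_B)
    next
      fix \<sigma>2 assume J: "?J n \<sigma>2"
      show "wp (put rVEC (Plus mx (reg rJ)) (reg rACC))
        (\<lambda>\<sigma>'. \<sigma>' rJ 0 = j \<and> ?I (Suc j) (upd \<sigma>' rJ 0 (Suc j))) 1 \<sigma>2"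
      proof (rule wp_put_val[where j = "m + j" and v = "b2n (hash \<omega> \<tau> j x)"], simp, goal_cases)
        case 1 show ?case using J by simp
      next
        case 2 show ?case using J by (simp add: hash_def)
      next
        case 4
        show ?case using I J by (auto intro!: same_upd simp: less_Suc_eq)
      qed simp
    qed (use I c n_M in \<open>auto intro!: same_upd simp: B_less\<close>)
  next
    fix \<sigma>1 assume I: "?I \<kappa> \<sigma>1"
    note r1 = rows[OF I[THEN conjunct1]]
    have p: "\<sigma>1 0 \<iota> = 2 ^ \<iota>" using r1 assms n_M by (simp add: powok_def)
    show "wp (put rVEC (Plus mx (Plus nx (Const 1))) (Minus (Const 1) (bitx (reg rX) (reg rIOTA))))
       (\<lambda>\<sigma>'. same rEVAL \<sigma> \<sigma>' \<and> (\<forall>i<M. \<sigma>' rVEC i = b2n (vec0 \<omega> (\<tau>, \<kappa>, \<iota>) x i))) 1 \<sigma>1"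
    proof (rule wp_put_val[where j = "m + n + 1" and v = "b2n (1 + bt x \<iota>)"], simp, goal_cases)
      case 2 show ?case using r1 p by (cases "bt x \<iota>") (simp_all add: b2n_bt)
    next
      case 4
      show ?case using I assms(7) by (auto intro!: same_upd simp: vec0_def)
    qed (simp_all add: B_less)
  next
    show "\<kappa> < 2 ^ B" using assms(7) n_M by (intro B_less) auto
  next
    fix j \<sigma>' assume I: "?I j \<sigma>'"
    show "val \<sigma>' (reg rKAP) = \<kappa>" using rows(5)[OF I[THEN conjunct1]] by simp
  qed (use assms(9) in \<open>auto intro!: same_upd\<close>)
  then show ?thesis
  proof (rule wp_time)
    have "\<kappa> * (3 * n + 6) \<le> (n + 1) * (3 * n + 6)" using assms(7) by (intro mult_le_mono) auto
    then show "\<kappa> * (1 + (n * (1 + 2) + 2 + 1) + 2) + 2 + 1 \<le> (n + 1) * (3 * n + 6) + 3"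
      by (simp add: algebra_simps)
  qed
qed

abbreviation "rMAT \<equiv> {rACC, rV, rJ, rVEC, rNEW}"

lemma apply_matrix_spec:
  assumes "tapeok \<omega> \<sigma>" "\<sigma> rI 0 = k" "\<forall>i<M. \<sigma> rVEC i = b2n (v i)"
  shows "wp apply_matrix (\<lambda>\<sigma>'. same rMAT \<sigma> \<sigma>' \<and>
    (\<forall>i<M. \<sigma>' rVEC i = b2n (apply_tape \<omega> k (\<sigma> rREP k) v i))) (M * (3 * M + 12) + 4) \<sigma>"
proof -
  let ?I = "\<lambda>j \<sigma>'. same (rMAT - {rVEC}) \<sigma> \<sigma>' \<and> (\<forall>i<j. \<sigma>' rNEW i = b2n (apply_tape \<omega> k (\<sigma> rREP k) v i))"
  let ?J = "\<lambda>j \<sigma>'. same rMAT \<sigma> \<sigma>' \<and> (\<forall>i<M. \<sigma>' rNEW i = b2n (apply_tape \<omega> k (\<sigma> rREP k) v i)) \<and>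
     (\<forall>i<j. \<sigma>' rVEC i = b2n (apply_tape \<omega> k (\<sigma> rREP k) v i))"
  have rows: "\<sigma>' rI 0 = k" "\<sigma>' rREP k = \<sigma> rREP k" "\<sigma>' rVEC = \<sigma> rVEC"
    "\<sigma>' 1 (idx a b i e) = b2n (tp \<omega> a b i e)"
    if "same (rMAT - {rVEC}) \<sigma> \<sigma>'" for \<sigma>' a b i e
    using that assms tapeok_tp[of \<omega> \<sigma>] by (simp_all add: same_def)
  have "wp apply_matrix (\<lambda>\<sigma>'. same rMAT \<sigma> \<sigma>' \<and> (\<forall>i<M. \<sigma>' rVEC i = b2n (apply_tape \<omega> k (\<sigma> rREP k) v i)))
     ((M * ((1 + ((1 + (M * (1 + 2) + 2) + 1) + 1)) + 2) + 2) + (M * (1 + 2) + 2)) \<sigma>"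
    unfolding apply_matrix_def
  proof (rule wp_Seq, rule wp_for[where I = ?I])
    fix j \<sigma>1 assume j: "j < M" and I: "?I j \<sigma>1" and c: "\<sigma>1 rJ 0 = j"
    let ?a = "apply_tape \<omega> k (\<sigma> rREP k) v j"
    let ?P = "\<lambda>\<sigma>'. same (rMAT - {rVEC}) \<sigma> \<sigma>' \<and> \<sigma>' rJ 0 = j \<and> \<sigma>' rNEW = \<sigma>1 rNEW \<and> \<sigma>' rACC 0 = b2n ?a"
    let ?L = "\<lambda>e \<sigma>'. same (rMAT - {rVEC}) \<sigma> \<sigma>' \<and> \<sigma>' rJ 0 = j \<and> \<sigma>' rNEW = \<sigma>1 rNEW \<and>
       \<sigma>' rACC 0 = b2n (\<Sum>c<e. tp \<omega> k (\<sigma> rREP k) j c * v c)"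
    note r1 = rows[OF I[THEN conjunct1]]
    show "wp (Seq (putr rACC (Const 0))
       (Seq (If (Minus (Plus (nnx (Plus (reg rI) (Const 1))) (Const 4)) (reg rJ))
          (for_loop rV 0 Mx
            (putr rACC (modx (Plus (reg rACC)
               (Times (tapex (reg rI) (get rREP (reg rI)) (reg rJ) (reg rV)) (get rVEC (reg rV)))) (Const 2))))
          Skip)
        (put rNEW (reg rJ) (reg rACC))))
      (\<lambda>\<sigma>'. \<sigma>' rJ 0 = j \<and> ?I (Suc j) (upd \<sigma>' rJ 0 (Suc j))) (1 + ((1 + (M * (1 + 2) + 2) + 1) + 1)) \<sigma>1"
    proof (rule wp_put_Seq_val[where j = 0 and v = 0], simp, simp, simp, simp,
        rule wp_Seq[OF wp_conseq[where Q = ?P]], rule wp_If, goal_cases)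
      case 1
      then have lt: "j < nn (Suc k) + 4" using r1 c by simp
      show ?case
      proof (rule wp_for[where I = ?L])
        fix e \<sigma>2 assume e: "e < M" and J: "?L e \<sigma>2" and c2: "\<sigma>2 rV 0 = e"
        note r2 = rows[OF J[THEN conjunct1]]
        show "wp (putr rACC (modx (Plus (reg rACC)
               (Times (tapex (reg rI) (get rREP (reg rI)) (reg rJ) (reg rV)) (get rVEC (reg rV)))) (Const 2)))
           (\<lambda>\<sigma>'. \<sigma>' rV 0 = e \<and> ?L (Suc e) (upd \<sigma>' rV 0 (Suc e))) 1 \<sigma>2"
        proof (rule wp_put_val[where j = 0 and v = "b2n (\<Sum>c<Suc e. tp \<omega> k (\<sigma> rREP k) j c * v c)"], simp, simp, goal_cases)
          case 1
          show ?case using r2 J c2 e assms(3)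
            by (simp add: b2n_mult b2n_add del: One_nat_def)
        next
          case 3
          show ?case using J c2 by (auto intro!: same_upd)
        qed (rule b2n_less_B)
      qed (use I c lt in \<open>auto intro!: same_upd simp: B_less apply_tape_def\<close>)
    next
      case 2
      then have "\<not> j < nn (Suc k) + 4" using r1 c by simp
      then show ?case using I c by (intro wp_Skip) (auto intro!: same_upd simp: apply_tape_def)
    next
      case (3 \<sigma>2)
      then show ?case
        using I by (intro wp_put_val[where j = j and v = "b2n ?a"]) (auto intro!: same_upd simp: less_Suc_eq)
    qed
  next
    fix \<sigma>1 assume I: "?I M \<sigma>1"
    then have J0: "?J 0 \<sigma>1" by (auto simp: same_def)
    show "wp (for_loop rJ 0 Mx (put rVEC (reg rJ) (get rNEW (reg rJ))))
       (\<lambda>\<sigma>'. same rMAT \<sigma> \<sigma>' \<and> (\<forall>i<M. \<sigma>' rVEC i = b2n (apply_tape \<omega> k (\<sigma> rREP k) v i))) (M * (1 + 2) + 2) \<sigma>1"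
    proof (rule wp_for[where I = ?J])
      fix j \<sigma>2 assume j: "j < M" and J: "?J j \<sigma>2" and c: "\<sigma>2 rJ 0 = j"
      show "wp (put rVEC (reg rJ) (get rNEW (reg rJ))) (\<lambda>\<sigma>'. \<sigma>' rJ 0 = j \<and> ?J (Suc j) (upd \<sigma>' rJ 0 (Suc j))) 1 \<sigma>2"
        by (rule wp_put_val[where j = j and v = "b2n (apply_tape \<omega> k (\<sigma> rREP k) v j)"])
          (use J c j in \<open>auto intro!: same_upd simp: less_Suc_eq\<close>)
    qed (use J0 in \<open>auto intro!: same_upd simp: B_less\<close>)
  qed (auto intro!: same_upd simp: B_less)
  then show ?thesis by (rule wp_time) (simp add: algebra_simps)
qed

lemma test_zero_spec:
  assumes "\<forall>i<M. \<sigma> rVEC i = b2n (v i)"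
  shows "wp test_zero (\<lambda>\<sigma>'. same {rRES, rJ} \<sigma> \<sigma>' \<and> \<sigma>' rRES 0 = of_bool (\<forall>i<M. v i = 0)) (M * 5 + 3) \<sigma>"
proof -
  let ?I = "\<lambda>j \<sigma>'. same {rRES, rJ} \<sigma> \<sigma>' \<and> \<sigma>' rRES 0 = of_bool (\<forall>i<j. v i = 0)"
  have "wp test_zero (\<lambda>\<sigma>'. same {rRES, rJ} \<sigma> \<sigma>' \<and> \<sigma>' rRES 0 = of_bool (\<forall>i<M. v i = 0))
    (1 + (M * ((1 + 1 + 1) + 2) + 2)) \<sigma>"
    unfolding test_zero_def
  proof (rule wp_put_Seq_val[where j = 0 and v = 1], simp, simp, simp, simp add: B_less, rule wp_for[where I = ?I])
    fix j \<sigma>1 assume j: "j < M" and I: "?I j \<sigma>1" and c: "\<sigma>1 rJ 0 = j"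
    have V: "\<sigma>1 rVEC j = b2n (v j)" using I assms j by (simp add: same_def)
    show "wp (If (get rVEC (reg rJ)) (putr rRES (Const 0)) Skip)
      (\<lambda>\<sigma>'. \<sigma>' rJ 0 = j \<and> ?I (Suc j) (upd \<sigma>' rJ 0 (Suc j))) (1 + 1 + 1) \<sigma>1"
    proof (rule wp_If, goal_cases)
      case 1
      then show ?case using I c V
        by (intro wp_put_val[where j = 0 and v = 0]) (auto intro!: same_upd simp: less_Suc_eq)
    next
      case 2
      then show ?case using I c V by (intro wp_Skip) (auto intro!: same_upd simp: less_Suc_eq)
    qed
  qed (auto intro!: same_upd simp: B_less)
  then show ?thesis by (rule wp_time) simp
qed

abbreviation "rLEAF \<equiv> {rPROD, rN2, rPTR, rV, rACC, rN1, rA, rVEC, rJ, rNEW, rI, rRES}"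

definition T_leaf :: nat where
  "T_leaf = (M * (M * (4 * n + 8) + 11) + 5) + ((n + 1) * (3 * n + 6) + 3)
     + (D * (M * (3 * M + 12) + 6) + 2) + (M * 5 + 3)"

lemma eval_leaf_spec:
  assumes "powok \<sigma>" "tapeok \<omega> \<sigma>" "\<sigma> rX 0 = x" "\<sigma> rTAU 0 = \<tau>" "\<sigma> rKAP 0 = \<kappa>" "\<sigma> rIOTA 0 = \<iota>"
    "\<kappa> \<le> n + 1" "\<iota> < n"
  shows "wp eval_leaf (\<lambda>\<sigma>'. same rLEAF \<sigma> \<sigma>' \<and> \<sigma>' rRES 0 = b2n (F \<omega> (\<tau>, \<kappa>, \<iota>) D (\<sigma> rREP) x)) T_leaf \<sigma>"
proof -
  let ?t = "(\<tau>, \<kappa>, \<iota>)"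
  let ?I = "\<lambda>k \<sigma>'. same (rLEAF - {rRES}) \<sigma> \<sigma>' \<and> (\<forall>i<M. \<sigma>' rVEC i = b2n (vec \<omega> ?t k (\<sigma> rREP) x i))"
  have "wp eval_leaf (\<lambda>\<sigma>'. same rLEAF \<sigma> \<sigma>' \<and> \<sigma>' rRES 0 = b2n (F \<omega> ?t D (\<sigma> rREP) x))
    ((M * (M * (4 * n + 8) + 11) + 5) + (((n + 1) * (3 * n + 6) + 3)
     + ((D * ((M * (3 * M + 12) + 4) + 2) + 2) + (M * 5 + 3)))) \<sigma>"
    unfolding eval_leaf_def
  proof (rule wp_Seq, rule wp_conseq[OF eval_system_spec[OF assms(1,3)]], goal_cases)
    case (1 \<sigma>1)
    then have s1: "same rEVAL \<sigma> \<sigma>1" by simp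
    have "wp eval_hash (\<lambda>\<sigma>'. same rEVAL \<sigma>1 \<sigma>' \<and> (\<forall>i<M. \<sigma>' rVEC i = b2n (vec0 \<omega> ?t x i))) ((n + 1) * (3 * n + 6) + 3) \<sigma>1"
      using assms 1 by (intro eval_hash_spec) (auto simp: same_def powok_def tapeok_def)
    then show ?case
    proof (intro wp_Seq, elim wp_conseq, goal_cases)
      case (1 \<sigma>2)
      then have s2: "same (rLEAF - {rRES}) \<sigma> \<sigma>2" using s1 by (auto simp: same_def)
      show ?case
      proof (rule wp_Seq, rule wp_for[where I = ?I])
        fix k \<sigma>3 assume k: "k < D" and I: "?I k \<sigma>3" and c: "\<sigma>3 rI 0 = k"
        have R: "\<sigma>3 rREP = \<sigma> rREP" using I by (simp add: same_def)
        have "wp apply_matrix (\<lambda>\<sigma>'. same rMAT \<sigma>3 \<sigma>' \<and>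
           (\<forall>i<M. \<sigma>' rVEC i = b2n (apply_tape \<omega> k (\<sigma>3 rREP k) (vec \<omega> ?t k (\<sigma> rREP) x) i))) (M * (3 * M + 12) + 4) \<sigma>3"
          using I c assms(2) by (intro apply_matrix_spec) (auto simp: same_def tapeok_def)
        then show "wp apply_matrix (\<lambda>\<sigma>'. \<sigma>' rI 0 = k \<and> ?I (Suc k) (upd \<sigma>' rI 0 (Suc k))) (M * (3 * M + 12) + 4) \<sigma>3"
        proof (elim wp_conseq, goal_cases)
          case (1 \<sigma>4)
          then have "same (rLEAF - {rRES}) \<sigma> \<sigma>4" "\<sigma>4 rI = \<sigma>3 rI" using I by (auto simp: same_def)
          then show ?case using 1 c R by (auto intro!: same_upd)
        qed
      next
        fix \<sigma>3 assume I: "?I D \<sigma>3"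
        have "wp test_zero (\<lambda>\<sigma>'. same {rRES, rJ} \<sigma>3 \<sigma>' \<and> \<sigma>' rRES 0 = of_bool (\<forall>i<M. vec \<omega> ?t D (\<sigma> rREP) x i = 0)) (M * 5 + 3) \<sigma>3"
          using I by (intro test_zero_spec) auto
        then show "wp test_zero (\<lambda>\<sigma>'. same rLEAF \<sigma> \<sigma>' \<and> \<sigma>' rRES 0 = b2n (F \<omega> ?t D (\<sigma> rREP) x)) (M * 5 + 3) \<sigma>3"
          by (rule wp_conseq) (use I in \<open>auto simp: same_def F_def\<close>)
      next
        show "D < 2 ^ B" 
        proof (rule less_power_B)
          have "D * 1 \<le> Suc D * (M * (M * M))" using n_M by (intro mult_le_mono) auto
          then show "D \<le> B" by (simp add: B_def N_def)
        qed
      qed (use s2 1 in \<open>auto intro!: same_upd\<close>)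
    qed
  qed
  then show ?thesis by (rule wp_time) (simp add: T_leaf_def algebra_simps)
qed

end

section \<open>Interpolation and the recursion over levels\<close>

context instance_context
begin

text \<open>The invariant is indexed by the set of points already visited instead of a position in
  the list, which keeps the enumeration order out of all later arguments.\<close>

lemma wp_each:
  assumes L: "listed U \<sigma>" and J0: "J {} \<sigma>"
    and stable: "\<And>A \<sigma>' i v. J A \<sigma>' \<Longrightarrow> J A (upd \<sigma>' rQ i v)" "\<And>A \<sigma>' i v. J A \<sigma>' \<Longrightarrow> J A (upd \<sigma>' rX i v)"
    and keep: "\<And>A \<sigma>'. J A \<sigma>' \<Longrightarrow> \<sigma>' rLST = \<sigma> rLST \<and> \<sigma>' rCNT = \<sigma> rCNT"
    and step: "\<And>A x \<sigma>'. A \<subseteq> U \<Longrightarrow> x \<in> U \<Longrightarrow> x \<notin> A \<Longrightarrow> J A \<sigma>' \<Longrightarrow> \<sigma>' rX 0 = x \<Longrightarrow>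
       wp c (\<lambda>\<sigma>''. \<sigma>'' rQ 0 = \<sigma>' rQ 0 \<and> J (insert x A) \<sigma>'') T \<sigma>'"
    and final: "\<And>\<sigma>'. J U \<sigma>' \<Longrightarrow> Q \<sigma>'"
  shows "wp (each c) Q (card U * (T + 3) + 2) \<sigma>"
proof -
  let ?L = "\<sigma> rLST"
  let ?I = "\<lambda>q \<sigma>'. J (?L ` {..<q}) \<sigma>'"
  have cnt: "\<sigma> rCNT 0 = card U" using listed_card[OF L] by simp
  have LU: "?L ` {..<card U} = U" "inj_on ?L {..<card U}" using L by (simp_all add: listed_def cnt)
  have "wp (each c) Q (card U * ((1 + T) + 2) + 2) \<sigma>"
    unfolding each_def
  proof (rule wp_for[where I = ?I])
    fix q \<sigma>1 assume q: "q < card U" and I: "?I q \<sigma>1" and c: "\<sigma>1 rQ 0 = q"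
    have x: "?L q \<in> U" "?L q \<notin> ?L ` {..<q}" "?L ` {..<q} \<subseteq> U"
      using LU q by (force, auto simp: inj_on_def, metis lessThan_iff less_trans less_irrefl)
    have xl: "?L q < 2 ^ B" using U_less[OF x(1)] by (simp add: exp_n_less)
    show "wp (Seq (putr rX (get rLST (reg rQ))) c) (\<lambda>\<sigma>'. \<sigma>' rQ 0 = q \<and> ?I (Suc q) (upd \<sigma>' rQ 0 (Suc q))) (1 + T) \<sigma>1"
    proof (rule wp_put_Seq_val[where j = 0 and v = "?L q"], simp, simp, use keep[OF I] c in simp, rule xl, goal_cases)
      case 1
      have "wp c (\<lambda>\<sigma>''. \<sigma>'' rQ 0 = upd \<sigma>1 rX 0 (?L q) rQ 0 \<and> J (insert (?L q) (?L ` {..<q})) \<sigma>'') T (upd \<sigma>1 rX 0 (?L q))"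
        using x stable(2)[OF I] by (intro step) auto
      then show ?case
        by (rule wp_conseq) (use c stable(1) in \<open>auto simp: lessThan_Suc\<close>)
    qed
  next
    show "card U < 2 ^ B" using exp_n_less card_U by blast
  next
    fix j \<sigma>' assume "?I j \<sigma>'"
    then show "val \<sigma>' (reg rCNT) = card U" using keep cnt by simp
  next
    fix \<sigma>' assume "?I (card U) \<sigma>'"
    then show "Q \<sigma>'" using LU final by simp
  qed (use J0 stable in auto)
  then show ?thesis by (rule wp_time) (simp add: algebra_simps)
qed

lemma upd_idem [simp]: "upd \<sigma> r i (\<sigma> r i) = \<sigma>"
  by (simp add: upd_def)

text \<open>The body may read the row while it is being rewritten, so the step is told which entries
  already have their new values.\<close>

lemma wp_each_row:
  assumes L: "listed U \<sigma>" and r: "r \<notin> {rLST, rCNT, rX, rQ}"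
    and step: "\<And>A x \<sigma>'. A \<subseteq> U \<Longrightarrow> x \<in> U \<Longrightarrow> x \<notin> A \<Longrightarrow> same {rX, rQ, r} \<sigma> \<sigma>' \<Longrightarrow> \<sigma>' rX 0 = x \<Longrightarrow>
       (\<forall>y. \<sigma>' r y = (if y \<in> A then g y else \<sigma> r y)) \<Longrightarrow> wp c (\<lambda>\<sigma>''. \<sigma>'' = upd \<sigma>' r x (g x)) T \<sigma>'"
  shows "wp (each c) (\<lambda>\<sigma>'. same {rX, rQ, r} \<sigma> \<sigma>' \<and> (\<forall>y. \<sigma>' r y = (if y \<in> U then g y else \<sigma> r y))) (card U * (T + 3) + 2) \<sigma>"
proof (rule wp_each[OF L, where J = "\<lambda>A \<sigma>'. same {rX, rQ, r} \<sigma> \<sigma>' \<and> (\<forall>y. \<sigma>' r y = (if y \<in> A then g y else \<sigma> r y))"])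
  fix A x \<sigma>' assume "A \<subseteq> U" "x \<in> U" "x \<notin> A" "\<sigma>' rX 0 = x"
    and J: "same {rX, rQ, r} \<sigma> \<sigma>' \<and> (\<forall>y. \<sigma>' r y = (if y \<in> A then g y else \<sigma> r y))"
  then have "wp c (\<lambda>\<sigma>''. \<sigma>'' = upd \<sigma>' r x (g x)) T \<sigma>'" by (intro step) auto
  then show "wp c (\<lambda>\<sigma>''. \<sigma>'' rQ 0 = \<sigma>' rQ 0 \<and> (same {rX, rQ, r} \<sigma> \<sigma>'' \<and>
     (\<forall>y. \<sigma>'' r y = (if y \<in> insert x A then g y else \<sigma> r y)))) T \<sigma>'"
    by (rule wp_conseq) (use J r in \<open>auto intro!: same_upd\<close>)
qed (use r in \<open>auto intro!: same_upd simp: same_def\<close>)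

text \<open>\<open>w k\<close> is \<open>d * (nn k + 4) - nn k\<close>, the degree of the parities of level \<open>k\<close>.\<close>

definition w :: "nat \<Rightarrow> nat" where "w k = (d - 1) * nn k + 4 * d"

text \<open>The coefficient at \<open>X\<close> of the polynomial of degree at most \<open>W\<close>
  that agrees with \<open>f\<close> at all points of weight at most \<open>W\<close>.\<close>

definition low_moebius :: "nat \<Rightarrow> (nat \<Rightarrow> bit) \<Rightarrow> nat set \<Rightarrow> bit" where
  "low_moebius W f X = (if card X \<le> W then \<Sum>V\<in>Pow X. f (set_encode V) else 0)"

definition extend :: "nat \<Rightarrow> (nat \<Rightarrow> bit) \<Rightarrow> nat \<Rightarrow> bit" where
  "extend W f x = (\<Sum>X\<in>Pow (set_decode x). low_moebius W f X)"

definition T_trans :: nat where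
  "T_trans = (card U * 6 + 2) + 2 * (n * (card U * 6 + 4) + 2)"

lemma transform_spec:
  assumes "powok \<sigma>" "listed U \<sigma>" "Suc k \<le> D" "\<forall>x\<in>U. \<sigma> (rOUT (Suc k)) x = b2n (f x)"
  shows "wp (transform k) (\<lambda>\<sigma>'. same {rX, rQ, rI, rC} \<sigma> \<sigma>' \<and>
    (\<forall>x\<in>U. \<sigma>' rC x = b2n (extend (w (Suc k)) f x))) T_trans \<sigma>"
proof -
  let ?R = "{rX, rQ, rI, rC}"
  let ?W = "w (Suc k)"
  let ?low = "Minus (Plus (Times (Const (d - 1)) (nnx (Const (Suc k)))) (Const (4 * d + 1))) (get rWT (reg rX))"
  let ?addC = "put rC (reg rX) (modx (Plus (get rC (reg rX)) (get rC (Minus (reg rX) (get rPOW (reg rI))))) (Const 2))"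
  let ?g = "\<lambda>i X. if card X \<le> ?W then partial_sum i (f \<circ> set_encode) X else 0"
  let ?h = "\<lambda>i. partial_sum i (low_moebius ?W f)"
  let ?P = "\<lambda>g \<sigma>'. same ?R \<sigma> \<sigma>' \<and> (\<forall>x\<in>U. \<sigma>' rC x = b2n (g (set_decode x)))"
  have Un: "set_decode x \<subseteq> {..<n}" if "x \<in> U" for x
    using U_less[OF that] by (simp add: less_power_iff_set_decode)
  have low: "val \<sigma>' ?low \<noteq> 0 \<longleftrightarrow> wt x \<le> ?W" if "same ?R \<sigma> \<sigma>'" "\<sigma>' rX 0 = x" "x \<in> U" for \<sigma>' x
    using that assms(2) by (auto simp: same_def listed_def w_def less_Suc_eq_le)
  have lst: "listed U \<sigma>'" if "same ?R \<sigma> \<sigma>'" for \<sigma>'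
    using that assms(2) by (auto simp: same_def listed_def)
  \<comment> \<open>One coordinate of the in-place transform; the predicate \<open>c\<close> selects
    the points that take part, which covers both the truncated and the full pass.\<close>
  have pass: "wp (each (If e ?addC Skip)) (\<lambda>\<sigma>'. \<sigma>' rI 0 = i \<and> ?P g' (upd \<sigma>' rI 0 (Suc i))) (card U * 6 + 2) \<sigma>1"
    if P: "?P g \<sigma>1" and i: "i < n" "\<sigma>1 rI 0 = i"
      and e: "\<And>x \<sigma>'. x \<in> U \<Longrightarrow> \<sigma>' rX 0 = x \<Longrightarrow> same ?R \<sigma> \<sigma>' \<Longrightarrow> \<sigma>' rI 0 = i \<Longrightarrow> val \<sigma>' e \<noteq> 0 \<longleftrightarrow> c x \<and> i \<in> set_decode x"
      and g': "\<And>x. x \<in> U \<Longrightarrow> g' (set_decode x) = (if c x \<and> i \<in> set_decode x then g (set_decode x) + g (set_decode x - {i}) else g (set_decode x))"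
    for e g g' c i \<sigma>1
  proof -
    have "wp (each (If e ?addC Skip)) (\<lambda>\<sigma>'. same {rX, rQ, rC} \<sigma>1 \<sigma>' \<and> (\<forall>y. \<sigma>' rC y = (if y \<in> U then b2n (g' (set_decode y)) else \<sigma>1 rC y)))
      (card U * ((1 + 1 + 1) + 3) + 2) \<sigma>1"
    proof (rule wp_each_row)
      fix A x \<sigma>2 assume A: "A \<subseteq> U" "x \<in> U" "x \<notin> A" and s: "same {rX, rQ, rC} \<sigma>1 \<sigma>2" and x: "\<sigma>2 rX 0 = x"
        and C: "\<forall>y. \<sigma>2 rC y = (if y \<in> A then b2n (g' (set_decode y)) else \<sigma>1 rC y)"
      have s2: "same ?R \<sigma> \<sigma>2" "\<sigma>2 rI 0 = i" using s P i by (auto simp: same_def)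
      have p: "\<sigma>2 0 i = 2 ^ i" using s2 assms(1) i n_M by (simp add: same_def powok_def)
      show "wp (If e ?addC Skip) (\<lambda>\<sigma>''. \<sigma>'' = upd \<sigma>2 rC x (b2n (g' (set_decode x)))) (1 + 1 + 1) \<sigma>2"
      proof (rule wp_If, goal_cases)
        case 1
        then have c: "c x" "i \<in> set_decode x" using e[OF A(2) x s2] by auto
        have y: "x - 2 ^ i \<in> U" "set_decode (x - 2 ^ i) = set_decode x - {i}"
          using set_decode_diff_power[OF c(2)] U_subset[OF A(2), of "x - 2 ^ i"] by auto
        \<comment> \<open>The neighbour without bit \<open>i\<close> keeps its value during this
          coordinate, so it does not matter whether it has been visited before
          \<open>x\<close>.\<close>
        have "g' (set_decode (x - 2 ^ i)) = g (set_decode (x - 2 ^ i))" using g'[OF y(1)] y(2) by simp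
        then have "\<sigma>2 rC (x - 2 ^ i) = b2n (g (set_decode x - {i}))" using C P y by simp
        moreover have "\<sigma>2 rC x = b2n (g (set_decode x))" using C P A by simp
        ultimately show ?case using x s2(2) p g'[OF A(2)] c
          by (intro wp_put_val[where j = x and v = "b2n (g' (set_decode x))"]) (simp_all add: b2n_add)
      next
        case 2
        then have "\<not> (c x \<and> i \<in> set_decode x)" using e[OF A(2) x s2] by auto
        then have "\<sigma>2 rC x = b2n (g' (set_decode x))" using g'[OF A(2)] C P A by auto
        then show ?case by (intro wp_Skip) (metis upd_idem)
      qed
    qed (use P lst in auto)
    then show ?thesis
      by (rule wp_mono) (use P i in \<open>auto simp: same_def upd_def\<close>)
  qed
  have bit: "val \<sigma>' (bitx (reg rX) (reg rI)) \<noteq> 0 \<longleftrightarrow> i \<in> set_decode x"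
    if "same ?R \<sigma> \<sigma>'" "\<sigma>' rX 0 = x" "\<sigma>' rI 0 = i" "i < n" for \<sigma>' x i
  proof -
    have "\<sigma>' 0 i = 2 ^ i" using that assms(1) n_M by (simp add: same_def powok_def)
    then show ?thesis using that by (simp add: b2n_bt) (simp add: bt_def)
  qed
  have "wp (transform k) (?P (?h n)) ((card U * ((1 + 1 + 1) + 3) + 2) + ((n * ((card U * 6 + 2) + 2) + 2) + (n * ((card U * 6 + 2) + 2) + 2))) \<sigma>"
    unfolding transform_def Let_def
  proof (rule wp_Seq, rule wp_conseq[where Q = "?P (?g 0)"], goal_cases)
    case 1
    have "wp (each (If ?low (put rC (reg rX) (get (rOUT (Suc k)) (reg rX))) (put rC (reg rX) (Const 0))))
      (\<lambda>\<sigma>'. same {rX, rQ, rC} \<sigma> \<sigma>' \<and> (\<forall>y. \<sigma>' rC y = (if y \<in> U then b2n (?g 0 (set_decode y)) else \<sigma> rC y)))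
      (card U * ((1 + 1 + 1) + 3) + 2) \<sigma>"
    proof (rule wp_each_row)
      fix A x \<sigma>2 assume A: "A \<subseteq> U" "x \<in> U" "x \<notin> A" and s: "same {rX, rQ, rC} \<sigma> \<sigma>2" and x: "\<sigma>2 rX 0 = x"
      have s2: "same ?R \<sigma> \<sigma>2" using s by (auto simp: same_def)
      have O: "\<sigma>2 (rOUT (Suc k)) x = b2n (f x)" using s assms(4) A by (auto simp: same_def)
      note K = row_less(2)[OF assms(3)]
      show "wp (If ?low (put rC (reg rX) (get (rOUT (Suc k)) (reg rX))) (put rC (reg rX) (Const 0)))
        (\<lambda>\<sigma>''. \<sigma>'' = upd \<sigma>2 rC x (b2n (?g 0 (set_decode x)))) (1 + 1 + 1) \<sigma>2"
      proof (rule wp_If, goal_cases)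
        case 1
        then have "wt x \<le> ?W" using low[OF s2 x A(2)] by blast
        then show ?case using O x K
          by (intro wp_put_val[where j = x and v = "b2n (f x)"]) (simp_all add: partial_sum_0)
      next
        case 2
        then have "\<not> wt x \<le> ?W" using low[OF s2 x A(2)] by blast
        then show ?case using x
          by (intro wp_put_val[where j = x and v = 0]) simp_all
      qed
    qed (use assms in auto)
    then show ?case by (rule wp_conseq) (auto simp: same_def)
  next
    case (2 \<sigma>1)
    show ?case
    proof (rule wp_Seq, rule wp_for[where I = "\<lambda>i. ?P (?g i)"])
      fix i \<sigma>2 assume i: "i < n" and I: "?P (?g i) \<sigma>2" and c: "\<sigma>2 rI 0 = i"
      show "wp (each (If (Times ?low (bitx (reg rX) (reg rI))) ?addC Skip))
        (\<lambda>\<sigma>'. \<sigma>' rI 0 = i \<and> ?P (?g (Suc i)) (upd \<sigma>' rI 0 (Suc i))) (card U * 6 + 2) \<sigma>2"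
      proof (rule pass[OF I i c, where c = "\<lambda>x. wt x \<le> ?W"])
        fix x \<sigma>' assume "x \<in> U" "\<sigma>' rX 0 = x" "same ?R \<sigma> \<sigma>'" "\<sigma>' rI 0 = i"
        then show "val \<sigma>' (Times ?low (bitx (reg rX) (reg rI))) \<noteq> 0 \<longleftrightarrow> wt x \<le> ?W \<and> i \<in> set_decode x"
          using low[of \<sigma>' x] bit[of \<sigma>' x i] i by (simp only: exp_val.simps mult_eq_0_iff de_Morgan_disj)
      next
        fix x
        \<comment> \<open>Removing a bit keeps the weight low, so the truncated pass never reads a
          point outside its domain.\<close>
        have "card (set_decode x - {i}) \<le> wt x" by (intro card_mono) auto
        then show "?g (Suc i) (set_decode x) = (if wt x \<le> ?W \<and> i \<in> set_decode x
           then ?g i (set_decode x) + ?g i (set_decode x - {i}) else ?g i (set_decode x))"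
          by (auto simp: partial_sum_Suc)
      qed
    next
      fix \<sigma>2 assume I: "?P (?g n) \<sigma>2"
      \<comment> \<open>The end of the first pass is the start of the second one: the row now holds
        the truncated coefficients.\<close>
      have I0: "?P (?h 0) \<sigma>2" using I Un by (auto simp: partial_sum_0 partial_sum_all low_moebius_def)
      show "wp (for_loop rI 0 nx (each (If (bitx (reg rX) (reg rI)) ?addC Skip))) (?P (?h n)) (n * ((card U * 6 + 2) + 2) + 2) \<sigma>2"
      proof (rule wp_for[where I = "\<lambda>i. ?P (?h i)"])
        fix i \<sigma>3 assume i: "i < n" and I: "?P (?h i) \<sigma>3" and c: "\<sigma>3 rI 0 = i"
        show "wp (each (If (bitx (reg rX) (reg rI)) ?addC Skip))
          (\<lambda>\<sigma>'. \<sigma>' rI 0 = i \<and> ?P (?h (Suc i)) (upd \<sigma>' rI 0 (Suc i))) (card U * 6 + 2) \<sigma>3"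
        proof (rule pass[OF I i c, where c = "\<lambda>x. True"])
          fix x \<sigma>' assume "x \<in> U" "\<sigma>' rX 0 = x" "same ?R \<sigma> \<sigma>'" "\<sigma>' rI 0 = i"
          then show "val \<sigma>' (bitx (reg rX) (reg rI)) \<noteq> 0 \<longleftrightarrow> True \<and> i \<in> set_decode x"
            using bit[of \<sigma>' x i] i by simp
        qed (simp add: partial_sum_Suc)
      qed (use I0 n_M in \<open>auto intro!: same_upd simp: B_less\<close>)
    qed (use 2 n_M in \<open>auto intro!: same_upd simp: B_less\<close>)
  qed
  then show ?thesis
    by (rule wp_mono) (use Un in \<open>auto simp: T_trans_def partial_sum_all extend_def algebra_simps\<close>)
qed


lemma vec_cong: "(\<And>j. j < k \<Longrightarrow> rep j = rep' j) \<Longrightarrow> vec \<omega> t k rep x = vec \<omega> t k rep' x"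
  by (induction k) auto

text \<open>
  \<open>tab \<omega> t h\<close> is the table of level \<open>D - h\<close>: each repetition \<open>j\<close> interpolates the table of the
  next level, and the majority of the results is summed over the newly fixed variables.
\<close>

primrec tab :: "(nat \<Rightarrow> bool) \<Rightarrow> nat \<times> nat \<times> nat \<Rightarrow> nat \<Rightarrow> (nat \<Rightarrow> nat) \<Rightarrow> nat \<Rightarrow> bit" where
  "tab \<omega> t 0 rep x = F \<omega> t D rep x"
| "tab \<omega> t (Suc h) rep y = (let k = D - Suc h in
     \<Sum>x | x \<in> U \<and> x < 2 ^ pp (Suc k) \<and> x mod 2 ^ pp k = y.
       of_bool (M < 2 * card {j. j < M \<and> extend (w (Suc k)) (tab \<omega> t h (rep(k := j))) x = 1}))"

text \<open>Inner loops leave arbitrary numbers in the later cells of the row of repetitions; the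
  table does not depend on them.\<close>

lemma tab_cong:
  "(\<And>j. j < D - h \<Longrightarrow> rep j = rep' j) \<Longrightarrow> h \<le> D \<Longrightarrow> tab \<omega> t h rep = tab \<omega> t h rep'"
proof (induction h arbitrary: rep rep')
  case 0
  then show ?case by (auto simp: fun_eq_iff F_def cong: vec_cong[of D rep rep'])
next
  case (Suc h)
  have eq: "tab \<omega> t h (rep(D - Suc h := j)) = tab \<omega> t h (rep'(D - Suc h := j))" for j
    using Suc.prems by (intro Suc.IH) auto
  show ?case by (rule ext) (simp only: tab.simps Let_def eq)
qed

text \<open>Level \<open>k\<close> may use the output and vote rows of its own and all deeper
  levels, and the repetition counters from \<open>k\<close> on. Shallower levels find their data
  intact after a recursive call.\<close>

definition frame :: "nat \<Rightarrow> rows \<Rightarrow> rows \<Rightarrow> bool" where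
  "frame k \<sigma> \<sigma>' \<longleftrightarrow> same (rLEAF \<union> {rX, rQ, rC, rREP} \<union> {r. rOUT k \<le> r}) \<sigma> \<sigma>' \<and> (\<forall>j<k. \<sigma>' rREP j = \<sigma> rREP j)"

definition ready :: "(nat \<Rightarrow> bool) \<Rightarrow> nat \<times> nat \<times> nat \<Rightarrow> rows \<Rightarrow> bool" where
  "ready \<omega> t \<sigma> \<longleftrightarrow> powok \<sigma> \<and> tapeok \<omega> \<sigma> \<and> listed U \<sigma> \<and>
     (\<sigma> rTAU 0, \<sigma> rKAP 0, \<sigma> rIOTA 0) = t \<and> \<sigma> rKAP 0 \<le> n + 1 \<and> \<sigma> rIOTA 0 < n"

lemma frame_refl [simp]: "frame k \<sigma> \<sigma>"
  by (simp add: frame_def)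

lemma frame_trans: "frame k \<sigma> \<sigma>' \<Longrightarrow> frame k' \<sigma>' \<sigma>'' \<Longrightarrow> k \<le> k' \<Longrightarrow> frame k \<sigma> \<sigma>''"
  by (auto simp: frame_def same_def)

lemma frame_same: "same R \<sigma> \<sigma>' \<Longrightarrow> R \<subseteq> rLEAF \<union> {rX, rQ, rC} \<union> {r. rOUT k \<le> r} \<Longrightarrow> frame k \<sigma> \<sigma>'"
proof -
  assume s: "same R \<sigma> \<sigma>'" and R: "R \<subseteq> rLEAF \<union> {rX, rQ, rC} \<union> {r. rOUT k \<le> r}"
  have "rREP \<notin> rLEAF \<union> {rX, rQ, rC} \<union> {r. rOUT k \<le> r}" by simp
  then have "rREP \<notin> R" using R by blast
  moreover have "r \<notin> R" if "r \<notin> rLEAF \<union> {rX, rQ, rC, rREP} \<union> {r. rOUT k \<le> r}" for r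
    using R that by blast
  ultimately show ?thesis using s by (auto simp: frame_def same_def)
qed

lemma frame_ready: "frame k \<sigma> \<sigma>' \<Longrightarrow> ready \<omega> t \<sigma> \<Longrightarrow> ready \<omega> t \<sigma>'"
  by (simp add: frame_def same_def ready_def powok_def tapeok_def listed_def)

primrec T_level :: "nat \<Rightarrow> nat" where
  "T_level 0 = card U * (T_leaf + 4) + 2"
| "T_level (Suc h) = (card U * 4 + 2) + (M * (T_level h + (T_trans + (card U * 4 + 2)) + 2) + 2)
     + (card U * 4 + 2) + (card U * 6 + 2)"

lemma step_spec:
  assumes h: "Suc h \<le> D" "k = D - Suc h" and r: "ready \<omega> t \<sigma>" 
    and c: "\<And>\<sigma>. ready \<omega> t \<sigma> \<Longrightarrow> wp c (\<lambda>\<sigma>'. frame (Suc k) \<sigma> \<sigma>' \<and>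
        (\<forall>x\<in>U. \<sigma>' (rOUT (Suc k)) x = b2n (tab \<omega> t h (\<sigma> rREP) x))) (T_level h) \<sigma>"
  shows "wp (step k c) (\<lambda>\<sigma>'. frame k \<sigma> \<sigma>' \<and> (\<forall>x\<in>U. \<sigma>' (rOUT k) x = b2n (tab \<omega> t (Suc h) (\<sigma> rREP) x))) (T_level (Suc h)) \<sigma>"
proof -
  have k: "k < D" "D - h = Suc k" using h by auto
  note K = row_less(2)[OF less_imp_le[OF k(1)]] row_less(3)[OF less_imp_le[OF k(1)]]
  define \<rho> where "\<rho> = \<sigma> rREP"
  define e where "e j x = extend (w (Suc k)) (tab \<omega> t h (\<rho>(k := j))) x" for j x
  define maj where "maj x \<longleftrightarrow> M < 2 * card {j. j < M \<and> e j x = 1}" for x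
  let ?I = "\<lambda>j \<sigma>'. frame k \<sigma> \<sigma>' \<and> (\<forall>x\<in>U. \<sigma>' (rVOTE k) x = card {i. i < j \<and> e i x = 1})"
  define A where "A y = {x. x \<in> U \<and> x < 2 ^ pp (Suc k) \<and> x mod 2 ^ pp k = y}" for y
  have cle: "card {i. i < j \<and> P i} \<le> j" for j P
    using card_mono[of "{..<j}" "{i. i < j \<and> P i}"] by auto
  have lst: "listed U \<sigma>'" if "frame k \<sigma> \<sigma>'" for \<sigma>'
    using frame_ready[OF that r] by (simp add: ready_def)
  have zero: "wp (each (put r (reg rX) (Const 0))) (\<lambda>\<sigma>'. same {rX, rQ, r} \<sigma>1 \<sigma>' \<and> (\<forall>y\<in>U. \<sigma>' r y = 0)) (card U * 4 + 2) \<sigma>1"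
    if "frame k \<sigma> \<sigma>1" "r < K" "30 \<le> r" for r \<sigma>1
  proof -
    have "wp (each (put r (reg rX) (Const 0))) (\<lambda>\<sigma>'. same {rX, rQ, r} \<sigma>1 \<sigma>' \<and> (\<forall>y. \<sigma>' r y = (if y \<in> U then 0 else \<sigma>1 r y))) (card U * (1 + 3) + 2) \<sigma>1"
    proof (rule wp_each_row[OF lst[OF that(1)]])
      fix A x \<sigma>' assume "same {rX, rQ, r} \<sigma>1 \<sigma>'" "\<sigma>' rX 0 = x"
      then show "wp (put r (reg rX) (Const 0)) (\<lambda>\<sigma>''. \<sigma>'' = upd \<sigma>' r x 0) 1 \<sigma>'"
        using that by (intro wp_put_val[where j = x and v = 0]) auto
    qed (use that in auto)
    then show ?thesis by (rule wp_mono) auto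
  qed
  have "wp (step k c) (\<lambda>\<sigma>'. frame k \<sigma> \<sigma>' \<and> (\<forall>x\<in>U. \<sigma>' (rOUT k) x = b2n (tab \<omega> t (Suc h) \<rho> x)))
    ((card U * 4 + 2) + ((M * ((T_level h + (T_trans + (card U * (1 + 3) + 2))) + 2) + 2)
     + ((card U * 4 + 2) + (card U * ((1 + 1 + 1) + 3) + 2)))) \<sigma>"
    unfolding step_def
  proof (rule wp_Seq, rule wp_conseq[OF zero], simp, rule K, simp, goal_cases)
    case (1 \<sigma>1)
    then have s1: "frame k \<sigma> \<sigma>1" by (auto intro!: frame_same)
    show ?case
    proof (rule wp_Seq, rule wp_for[where I = ?I])
      show "?I 0 (upd \<sigma>1 rREP k 0)" using s1 1 by (auto simp: frame_def intro!: same_upd)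
    next
      fix j \<sigma>2 assume j: "j < M" and I: "?I j \<sigma>2" and cj: "\<sigma>2 rREP k = j"
      have r2: "ready \<omega> t \<sigma>2" using I r frame_ready by blast
      \<comment> \<open>The actual counters may differ from \<open>\<rho>(k := j)\<close> beyond
        position \<open>k\<close>, because of earlier recursive calls.\<close>
      have t2: "tab \<omega> t h (\<sigma>2 rREP) = tab \<omega> t h (\<rho>(k := j))"
        using I cj k h(1) by (intro tab_cong) (auto simp: frame_def \<rho>_def less_Suc_eq)
      show "wp (Seq c (Seq (transform k)
        (each (put (rVOTE k) (reg rX) (Plus (get (rVOTE k) (reg rX)) (get rC (reg rX)))))))
        (\<lambda>\<sigma>'. \<sigma>' rREP k = j \<and> ?I (Suc j) (upd \<sigma>' rREP k (Suc j))) (T_level h + (T_trans + (card U * (1 + 3) + 2))) \<sigma>2"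
      proof (rule wp_Seq, rule wp_conseq[OF c[OF r2]], goal_cases)
        case (1 \<sigma>3)
        then have s3: "frame (Suc k) \<sigma>2 \<sigma>3" by simp
        have r3: "ready \<omega> t \<sigma>3" using frame_ready[OF s3 r2] .
        have "wp (transform k) (\<lambda>\<sigma>'. same {rX, rQ, rI, rC} \<sigma>3 \<sigma>' \<and>
            (\<forall>x\<in>U. \<sigma>' rC x = b2n (extend (w (Suc k)) (tab \<omega> t h (\<rho>(k := j))) x))) T_trans \<sigma>3"
          using 1 r3 k t2 by (intro transform_spec) (auto simp: ready_def)
        then show ?case
        proof (intro wp_Seq, elim wp_conseq, goal_cases)
          case (1 \<sigma>4)
          then have s4: "frame (Suc k) \<sigma>2 \<sigma>4"
            by (intro frame_trans[OF s3]) (auto intro!: frame_same)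
          have r4: "ready \<omega> t \<sigma>4" using frame_ready[OF s4 r2] .
          have V4: "\<sigma>4 (rVOTE k) = \<sigma>2 (rVOTE k)" using s4 by (simp add: frame_def same_def)
          have "wp (each (put (rVOTE k) (reg rX) (Plus (get (rVOTE k) (reg rX)) (get rC (reg rX)))))
            (\<lambda>\<sigma>'. same {rX, rQ, rVOTE k} \<sigma>4 \<sigma>' \<and>
               (\<forall>y. \<sigma>' (rVOTE k) y = (if y \<in> U then card {i. i < Suc j \<and> e i y = 1} else \<sigma>4 (rVOTE k) y)))
            (card U * (1 + 3) + 2) \<sigma>4"
          proof (rule wp_each_row)
            fix A x \<sigma>5 assume A: "A \<subseteq> U" "x \<in> U" "x \<notin> A" and s5: "same {rX, rQ, rVOTE k} \<sigma>4 \<sigma>5" and x: "\<sigma>5 rX 0 = x"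
              and V: "\<forall>y. \<sigma>5 (rVOTE k) y = (if y \<in> A then card {i. i < Suc j \<and> e i y = 1} else \<sigma>4 (rVOTE k) y)"
            have C: "\<sigma>5 rC x = b2n (e j x)" using 1 s5 A by (auto simp: same_def e_def)
            have V5: "\<sigma>5 (rVOTE k) x = card {i. i < j \<and> e i x = 1}" using V V4 A I by simp
            have "{i. i < Suc j \<and> e i x = 1} = (if e j x = 1 then insert j else id) {i. i < j \<and> e i x = 1}"
              by (auto simp: less_Suc_eq)
            then have sum: "card {i. i < Suc j \<and> e i x = 1} = card {i. i < j \<and> e i x = 1} + b2n (e j x)"
              by (simp add: b2n_def)
            have "card {i. i < Suc j \<and> e i x = 1} < 2 ^ B" using cle[of "Suc j"] j by (intro B_less) (meson le_trans Suc_leI trans_le_add1)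
            then show "wp (put (rVOTE k) (reg rX) (Plus (get (rVOTE k) (reg rX)) (get rC (reg rX))))
              (\<lambda>\<sigma>''. \<sigma>'' = upd \<sigma>5 (rVOTE k) x (card {i. i < Suc j \<and> e i x = 1})) 1 \<sigma>5"
              using K x V5 C sum by (intro wp_put_val[where j = x and v = "card {i. i < Suc j \<and> e i x = 1}"]) simp_all
          qed (use r4 in \<open>auto simp: ready_def\<close>)
          then show ?case
          proof (rule wp_conseq, goal_cases)
            case (1 \<sigma>5)
            have "frame k \<sigma>2 \<sigma>4" using s4 by (auto simp: frame_def same_def)
            moreover have "frame k \<sigma>4 \<sigma>5" using 1 by (auto intro!: frame_same)
            ultimately have f5: "frame k \<sigma> \<sigma>5" using I frame_trans by (meson order_refl)
            have "\<sigma>5 rREP k = j" using 1 s4 cj by (auto simp: frame_def same_def)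
            then show ?case using f5 1 by (auto simp: frame_def intro!: same_upd)
          qed
        qed
      qed
    next
      fix \<sigma>2 assume I: "?I M \<sigma>2"
      show "wp (Seq (each (put (rOUT k) (reg rX) (Const 0)))
        (each (If (Times (Minus (get rPOW (ppx (Const (Suc k)))) (reg rX))
                      (Minus (Times (Const 2) (get (rVOTE k) (reg rX))) Mx))
        (put (rOUT k) (modx (reg rX) (get rPOW (ppx (Const k))))
           (modx (Plus (get (rOUT k) (modx (reg rX) (get rPOW (ppx (Const k))))) (Const 1)) (Const 2)))
        Skip))) (\<lambda>\<sigma>'. frame k \<sigma> \<sigma>' \<and> (\<forall>x\<in>U. \<sigma>' (rOUT k) x = b2n (tab \<omega> t (Suc h) \<rho> x)))
        ((card U * 4 + 2) + (card U * ((1 + 1 + 1) + 3) + 2)) \<sigma>2"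
      proof (rule wp_Seq, rule wp_conseq[OF zero], use I in simp, rule K, simp, goal_cases)
        case (1 \<sigma>3)
        then have "frame k \<sigma>2 \<sigma>3" by (auto intro!: frame_same)
        then have s3: "frame k \<sigma> \<sigma>3" using I frame_trans by blast
        have V3: "\<sigma>3 (rVOTE k) x = card {i. i < M \<and> e i x = 1}" if "x \<in> U" for x
          using I 1 that by (simp add: same_def)
        \<comment> \<open>Entry \<open>y\<close> holds the parity of the majorities over those
          extensions of \<open>y\<close> that have been visited.\<close>
        let ?J = "\<lambda>B \<sigma>'. same {rX, rQ, rOUT k} \<sigma>3 \<sigma>' \<and> (\<forall>y\<in>U. \<sigma>' (rOUT k) y = b2n (\<Sum>x\<in>A y \<inter> B. of_bool (maj x)))"
        show ?case
        proof (rule wp_each[where J = ?J, OF lst[OF s3]])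
          fix B x \<sigma>4 assume B: "B \<subseteq> U" "x \<in> U" "x \<notin> B" and J: "?J B \<sigma>4" and x: "\<sigma>4 rX 0 = x"
          have fB: "finite B" by (rule finite_subset[OF B(1) finite_U])
          have "frame k \<sigma> \<sigma>4" using J by (intro frame_trans[OF s3]) (auto intro!: frame_same)
          then have "powok \<sigma>4" using frame_ready r ready_def by blast
          moreover have "pp k \<le> M" "pp (Suc k) \<le> M" using n_M by (auto simp: pp_def)
          ultimately have P: "\<sigma>4 0 (pp k) = 2 ^ pp k" "\<sigma>4 0 (pp (Suc k)) = 2 ^ pp (Suc k)" by (simp_all add: powokD)
          have V: "\<sigma>4 (rVOTE k) x = card {i. i < M \<and> e i x = 1}" using J V3[OF B(2)] by (simp add: same_def)
          let ?y = "x mod 2 ^ pp k"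
          have y: "?y \<in> U" using U_subset[OF B(2), of ?y] by (simp add: set_decode_mod_power)
          \<comment> \<open>A visited point contributes to the entry of its own prefix and to no
            other, so a single toggle restores the invariant.\<close>
          have S: "(\<Sum>x\<in>A y \<inter> insert x B. of_bool (maj x)) =
            (if x < 2 ^ pp (Suc k) \<and> maj x \<and> y = ?y then 1 else 0) + (\<Sum>x\<in>A y \<inter> B. of_bool (maj x) :: bit)" for y
          proof (cases "x \<in> A y")
            case True
            then have "A y \<inter> insert x B = insert x (A y \<inter> B)" by blast
            then show ?thesis using True fB B(3) by (simp add: A_def)
          next
            case False
            then have "A y \<inter> insert x B = A y \<inter> B" by blast
            then show ?thesis using False B(2) by (auto simp: A_def)
          qed
          let ?e = "Times (Minus (get rPOW (ppx (Const (Suc k)))) (reg rX)) (Minus (Times (Const 2) (get (rVOTE k) (reg rX))) Mx)"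
          have e: "val \<sigma>4 ?e \<noteq> 0 \<longleftrightarrow> x < 2 ^ pp (Suc k) \<and> maj x"
            using K x P V by (simp add: maj_def not_le)
          show "wp (If ?e (put (rOUT k) (modx (reg rX) (get rPOW (ppx (Const k))))
             (modx (Plus (get (rOUT k) (modx (reg rX) (get rPOW (ppx (Const k))))) (Const 1)) (Const 2))) Skip)
            (\<lambda>\<sigma>''. \<sigma>'' rQ 0 = \<sigma>4 rQ 0 \<and> ?J (insert x B) \<sigma>'') (1 + 1 + 1) \<sigma>4"
          proof (rule wp_If, goal_cases)
            case 1
            then have m: "x < 2 ^ pp (Suc k)" "maj x" using e by auto
            let ?v = "b2n (\<Sum>x\<in>A ?y \<inter> insert x B. of_bool (maj x))"
            have v: "(\<sigma>4 (rOUT k) ?y + 1) mod 2 = ?v"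
              using J y m b2n_add[of "\<Sum>x\<in>A ?y \<inter> B. of_bool (maj x)" 1] unfolding S by (simp add: add.commute)
            show ?case
            proof (rule wp_put_val[where j = ?y and v = ?v])
              show "upd \<sigma>4 (rOUT k) ?y ?v rQ 0 = \<sigma>4 rQ 0 \<and> ?J (insert x B) (upd \<sigma>4 (rOUT k) ?y ?v)"
                using J by (auto intro!: same_upd simp: S)
            qed (use K x P v in simp_all)
          next
            case 2
            then have m: "\<not> (x < 2 ^ pp (Suc k) \<and> maj x)" using e by blast
            then have "(\<Sum>x\<in>A y \<inter> insert x B. of_bool (maj x)) = (\<Sum>x\<in>A y \<inter> B. of_bool (maj x) :: bit)" for y
              unfolding S by auto
            then show ?case using J by (intro wp_Skip) simp
          qed
        next
          fix \<sigma>' assume J: "?J U \<sigma>'"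
          have "A y \<inter> U = A y" for y by (auto simp: A_def)
          moreover have "(\<Sum>x\<in>A y. of_bool (maj x)) = tab \<omega> t (Suc h) \<rho> y" for y
            by (simp add: Let_def A_def maj_def e_def flip: h(2))
          moreover have "frame k \<sigma>3 \<sigma>'" using J by (auto intro!: frame_same)
          then have "frame k \<sigma> \<sigma>'" using frame_trans[OF s3] by blast
          ultimately show "frame k \<sigma> \<sigma>' \<and> (\<forall>x\<in>U. \<sigma>' (rOUT k) x = b2n (tab \<omega> t (Suc h) \<rho> x))"
            using J by (simp del: tab.simps)
        qed (use 1 in \<open>auto intro!: same_upd simp: same_def[of _ _ "upd _ _ _ _"] same_def\<close>)
      qed
    qed (auto simp: B_less)
  qed
  then show ?thesis by (rule wp_mono) (auto simp: \<rho>_def)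
qed

lemma level_spec:
  "h \<le> D \<Longrightarrow> ready \<omega> t \<sigma> \<Longrightarrow> wp (level h) (\<lambda>\<sigma>'. frame (D - h) \<sigma> \<sigma>' \<and>
     (\<forall>x\<in>U. \<sigma>' (rOUT (D - h)) x = b2n (tab \<omega> t h (\<sigma> rREP) x))) (T_level h) \<sigma>"
proof (induction h arbitrary: \<sigma>)
  case 0
  let ?J = "\<lambda>A \<sigma>'. same (rLEAF \<union> {rX, rQ, rOUT D}) \<sigma> \<sigma>' \<and> (\<forall>x\<in>A. \<sigma>' (rOUT D) x = b2n (F \<omega> t D (\<sigma> rREP) x))"
  note K = row_less(2)[of D, simplified]
  have "wp (each (Seq eval_leaf (put (rOUT D) (reg rX) (reg rRES)))) (\<lambda>\<sigma>'. frame D \<sigma> \<sigma>' \<and>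
     (\<forall>x\<in>U. \<sigma>' (rOUT D) x = b2n (F \<omega> t D (\<sigma> rREP) x))) (card U * ((T_leaf + 1) + 3) + 2) \<sigma>"
  proof (rule wp_each[where J = ?J])
    fix A x \<sigma>1 assume A: "A \<subseteq> U" "x \<in> U" "x \<notin> A" and J: "?J A \<sigma>1" and x: "\<sigma>1 rX 0 = x"
    have f1: "frame D \<sigma> \<sigma>1" using J by (auto intro!: frame_same)
    have r1: "ready \<omega> t \<sigma>1" using frame_ready[OF f1 0(2)] .
    have R: "\<sigma>1 rREP = \<sigma> rREP" using J by (simp add: same_def)
    have "wp eval_leaf (\<lambda>\<sigma>'. same rLEAF \<sigma>1 \<sigma>' \<and> \<sigma>' rRES 0 = b2n (F \<omega> (\<sigma>1 rTAU 0, \<sigma>1 rKAP 0, \<sigma>1 rIOTA 0) D (\<sigma>1 rREP) x)) T_leaf \<sigma>1"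
      using r1 x by (intro eval_leaf_spec) (auto simp: ready_def)
    then show "wp (Seq eval_leaf (put (rOUT D) (reg rX) (reg rRES))) (\<lambda>\<sigma>'. \<sigma>' rQ 0 = \<sigma>1 rQ 0 \<and> ?J (insert x A) \<sigma>') (T_leaf + 1) \<sigma>1"
    proof (intro wp_Seq, elim wp_conseq, goal_cases)
      case (1 \<sigma>2)
      have O: "\<sigma>2 (rOUT D) = \<sigma>1 (rOUT D)" "\<sigma>2 rX 0 = x" "\<sigma>2 rQ 0 = \<sigma>1 rQ 0"
        using 1 x by (auto simp: same_def)
      have res: "\<sigma>2 rRES 0 = b2n (F \<omega> t D (\<sigma> rREP) x)"
        using 1 r1 R by (auto simp: ready_def)
      have s: "same (rLEAF \<union> {rX, rQ, rOUT D}) \<sigma> \<sigma>2" using J 1 by (auto simp: same_def)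
      show ?case
        by (rule wp_put_val[where j = x and v = "b2n (F \<omega> t D (\<sigma> rREP) x)"])
          (use O res K J s in \<open>auto intro!: same_upd\<close>)
    qed
  next
    show "listed U \<sigma>" using 0 by (simp add: ready_def)
  qed (auto intro!: same_upd frame_same, auto simp: same_def)
  then show ?case unfolding level.simps by (rule wp_mono) simp_all
next
  case (Suc h)
  have e: "Suc (D - Suc h) = D - h" using Suc.prems by simp
  show ?case unfolding level.simps
    by (rule step_spec) (use Suc e in auto)
qed

end

section \<open>Candidates, search and output\<close>

context instance_context
begin

text \<open>At the top level no repetition has been chosen yet, so the argument
  \<open>\<lambda>_. 0\<close> is an arbitrary choice.\<close>

definition cand :: "(nat \<Rightarrow> bool) \<Rightarrow> nat \<Rightarrow> nat \<Rightarrow> nat" where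
  "cand \<omega> \<tau> \<kappa> = (\<Sum>\<iota><n. b2n (tab \<omega> (\<tau>, \<kappa>, \<iota>) D (\<lambda>_. 0) 0) * 2 ^ \<iota>)"

definition is_sol :: "nat \<Rightarrow> bool" where
  "is_sol x \<longleftrightarrow> x < 2 ^ n \<and> (\<forall>j<m. sysval j x = 0)"

lemma sum_bits_less: "(\<Sum>i<k. b2n (f i) * 2 ^ i) < 2 ^ k"
proof (induction k)
  case (Suc k)
  have "b2n (f k) * 2 ^ k \<le> 2 ^ k" by (cases "f k") auto
  then show ?case using Suc unfolding sum.lessThan_Suc power_Suc by linarith
qed simp

abbreviation "rTRY \<equiv> rLEAF \<union> {rX, rQ, rC, rREP} \<union> {r. 30 \<le> r} \<union> {rIOTA, rX2, rFOUND, rSOL}"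

definition T_try :: nat where
  "T_try = (n * (T_level D + 3) + 2) + ((M * (M * (4 * n + 8) + 11) + 5) + (M * 5 + 3)) + 6"

lemma try_candidate_spec:
  assumes "powok \<sigma>" "tapeok \<omega> \<sigma>" "listed U \<sigma>" "\<sigma> rTAU 0 = \<tau>" "\<sigma> rKAP 0 = \<kappa>" "\<kappa> \<le> n + 1"
  shows "wp try_candidate (\<lambda>\<sigma>'. same rTRY \<sigma> \<sigma>' \<and>
    (if is_sol (cand \<omega> \<tau> \<kappa>) then \<sigma>' rFOUND 0 = 1 \<and> \<sigma>' rSOL 0 = cand \<omega> \<tau> \<kappa>
     else \<sigma>' rFOUND 0 = \<sigma> rFOUND 0 \<and> \<sigma>' rSOL 0 = \<sigma> rSOL 0)) T_try \<sigma>"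
    (is "wp _ ?Q _ _")
proof -
  let ?c = "cand \<omega> \<tau> \<kappa>"
  let ?f = "\<lambda>\<iota>. tab \<omega> (\<tau>, \<kappa>, \<iota>) D (\<lambda>_. 0) 0"
  let ?I = "\<lambda>i \<sigma>'. same (rTRY - {rFOUND, rSOL}) \<sigma> \<sigma>' \<and> \<sigma>' rX2 0 = (\<Sum>\<iota><i. b2n (?f \<iota>) * 2 ^ \<iota>)"
  have cl: "?c < 2 ^ n" unfolding cand_def by (rule sum_bits_less)
  have pw: "powok \<sigma>'" if "same rTRY \<sigma> \<sigma>'" for \<sigma>'
    using that assms(1) by (simp add: same_def powok_def)
  have "wp try_candidate ?Q (1 + ((n * ((T_level D + 1) + 2) + 2) + (1 + ((M * (M * (4 * n + 8) + 11) + 5) + ((M * 5 + 3) + (1 + (1 + 1) + 1)))))) \<sigma>"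
    unfolding try_candidate_def
  proof (rule wp_put_Seq_val[where j = 0 and v = 0], simp, simp, simp, simp, rule wp_Seq, rule wp_for[where I = ?I])
    fix i \<sigma>1 assume i: "i < n" and I: "?I i \<sigma>1" and c: "\<sigma>1 rIOTA 0 = i"
    have r: "ready \<omega> (\<tau>, \<kappa>, i) \<sigma>1"
      using I assms c i by (simp add: ready_def same_def powok_def tapeok_def listed_def)
    show "wp (Seq (level D) (putr rX2 (Plus (reg rX2) (Times (get (rOUT 0) (Const 0)) (get rPOW (reg rIOTA))))))
      (\<lambda>\<sigma>'. \<sigma>' rIOTA 0 = i \<and> ?I (Suc i) (upd \<sigma>' rIOTA 0 (Suc i))) (T_level D + 1) \<sigma>1"
    proof (rule wp_Seq, rule wp_conseq[OF level_spec[OF order_refl r]], goal_cases)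
      case (1 \<sigma>2)
      then have f: "frame 0 \<sigma>1 \<sigma>2" by simp
      have "tab \<omega> (\<tau>, \<kappa>, i) D (\<sigma>1 rREP) = tab \<omega> (\<tau>, \<kappa>, i) D (\<lambda>_. 0)" by (rule tab_cong) auto
      then have O: "\<sigma>2 30 0 = b2n (?f i)" using 1 zero_in_U by simp
      have rows: "\<sigma>2 rX2 = \<sigma>1 rX2" "\<sigma>2 rIOTA = \<sigma>1 rIOTA" using f by (auto simp: frame_def same_def)
      have s: "same (rTRY - {rFOUND, rSOL}) \<sigma> \<sigma>2" using f I by (auto simp: frame_def same_def)
      have p: "\<sigma>2 0 i = 2 ^ i" using pw[of \<sigma>2] s i n_M by (simp add: powok_def same_def)
      have "(\<Sum>\<iota><Suc i. b2n (?f \<iota>) * 2 ^ \<iota>) < 2 ^ Suc i" by (rule sum_bits_less)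
      also have "(2::nat) ^ Suc i \<le> 2 ^ n" using i by (intro power_increasing) auto
      finally have le: "(\<Sum>\<iota><Suc i. b2n (?f \<iota>) * 2 ^ \<iota>) < 2 ^ B" by (simp add: exp_n_less)
      show ?case
        by (rule wp_put_val[where j = 0 and v = "\<Sum>\<iota><Suc i. b2n (?f \<iota>) * 2 ^ \<iota>"])
          (use O rows s p I c le in \<open>auto intro!: same_upd simp: row_less(2)[of 0, simplified]\<close>)
    qed
  next
    fix \<sigma>1 assume I: "?I n \<sigma>1"
    then have x2: "\<sigma>1 rX2 0 = ?c" by (simp add: cand_def)
    let ?V = "\<lambda>i. if i < m then sysval i ?c else 0"
    show "wp (Seq (putr rX (reg rX2)) (Seq eval_system (Seq test_zero
     (If (reg rRES) (Seq (putr rFOUND (Const 1)) (putr rSOL (reg rX2))) Skip)))) ?Q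
      (1 + ((M * (M * (4 * n + 8) + 11) + 5) + ((M * 5 + 3) + (1 + (1 + 1) + 1)))) \<sigma>1"
    proof (rule wp_put_Seq_val[where j = 0 and v = ?c], simp, simp, use x2 in simp, use cl in \<open>simp add: exp_n_less\<close>,
        rule wp_Seq, rule wp_conseq[OF eval_system_spec[where x = ?c]], goal_cases)
      case 1
      show ?case using I by (intro pw) (auto intro!: same_upd simp: same_def)
    next
      case (3 \<sigma>2)
      have t: "wp test_zero (\<lambda>\<sigma>'. same {rRES, rJ} \<sigma>2 \<sigma>' \<and> \<sigma>' rRES 0 = of_bool (\<forall>i<M. ?V i = 0)) (M * 5 + 3) \<sigma>2"
        using 3 by (intro test_zero_spec) auto
      show ?case
      proof (rule wp_Seq, rule wp_conseq[OF t], goal_cases)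
        case (1 \<sigma>3)
        have "(\<forall>i<M. ?V i = 0) \<longleftrightarrow> is_sol ?c" using cl m_M by (auto simp: is_sol_def)
        then have res: "\<sigma>3 rRES 0 = of_bool (is_sol ?c)" using 1 by simp
        have "same (rTRY - {rFOUND, rSOL}) \<sigma> (upd \<sigma>1 rX 0 ?c)" using I by (auto intro!: same_upd)
        then have "same (rTRY - {rFOUND, rSOL}) \<sigma> \<sigma>2" using 3 by (auto simp: same_def)
        then have s3: "same (rTRY - {rFOUND, rSOL}) \<sigma> \<sigma>3" using 1 by (auto simp: same_def)
        then have s3': "same rTRY \<sigma> \<sigma>3" "\<sigma>3 rFOUND = \<sigma> rFOUND" "\<sigma>3 rSOL = \<sigma> rSOL" by (auto simp: same_def)
        have x3: "\<sigma>3 rX2 0 = ?c" using x2 3 1 by (simp add: same_def)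
        show ?case
        proof (rule wp_If, goal_cases)
          case 1
          then have "is_sol ?c" using res by (simp split: if_splits)
          then show ?case using s3' x3 cl
            by (intro wp_put_Seq_val[where j = 0 and v = 1] wp_put_val[where j = 0 and v = ?c])
              (auto intro!: same_upd simp: exp_n_less B_less)
        next
          case 2
          then have "\<not> is_sol ?c" using res by (simp split: if_splits)
          then show ?case using s3' by (intro wp_Skip) auto
        qed
      qed
    qed simp
  qed (use n_M in \<open>auto intro!: same_upd simp: B_less\<close>)
  then show ?thesis by (rule wp_time) (simp add: T_try_def algebra_simps)
qed

definition found_in :: "(nat \<Rightarrow> bool) \<Rightarrow> (nat \<times> nat) set \<Rightarrow> rows \<Rightarrow> bool" where
  "found_in \<omega> P \<sigma> \<longleftrightarrow> (if \<exists>(\<tau>, \<kappa>)\<in>P. is_sol (cand \<omega> \<tau> \<kappa>) then \<sigma> rFOUND 0 = 1 \<and> is_sol (\<sigma> rSOL 0) else \<sigma> rFOUND 0 = 0)"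

definition trials :: "(nat \<times> nat) set" where "trials = {..<M} \<times> {..<n + 2}"

definition T_search :: nat where "T_search = M * ((n + 2) * (T_try + 2) + 4) + 2"

lemma search_spec:
  assumes "powok \<sigma>" "tapeok \<omega> \<sigma>" "listed U \<sigma>" "\<sigma> rFOUND 0 = 0"
  shows "wp search (\<lambda>\<sigma>'. powok \<sigma>' \<and> found_in \<omega> trials \<sigma>') T_search \<sigma>"
proof -
  let ?R = "rTRY \<union> {rTAU, rKAP}"
  let ?P = "\<lambda>\<tau> \<kappa>. ({..<\<tau>} \<times> {..<n + 2}) \<union> ({\<tau>} \<times> {..<\<kappa>})"
  let ?I = "\<lambda>\<tau> \<sigma>'. same ?R \<sigma> \<sigma>' \<and> found_in \<omega> (?P \<tau> 0) \<sigma>'"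
  have "wp search (\<lambda>\<sigma>'. powok \<sigma>' \<and> found_in \<omega> trials \<sigma>') (M * (((n + 2) * (T_try + 2) + 2) + 2) + 2) \<sigma>"
    unfolding search_def
  proof (rule wp_for[where I = ?I])
    fix \<tau> \<sigma>1 assume "\<tau> < M" and I: "?I \<tau> \<sigma>1" and c: "\<sigma>1 rTAU 0 = \<tau>"
    let ?J = "\<lambda>\<kappa> \<sigma>'. same ?R \<sigma> \<sigma>' \<and> \<sigma>' rTAU 0 = \<tau> \<and> found_in \<omega> (?P \<tau> \<kappa>) \<sigma>'"
    show "wp (for_loop rKAP 0 (Plus nx (Const 2)) try_candidate)
      (\<lambda>\<sigma>'. \<sigma>' rTAU 0 = \<tau> \<and> ?I (Suc \<tau>) (upd \<sigma>' rTAU 0 (Suc \<tau>))) ((n + 2) * (T_try + 2) + 2) \<sigma>1"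
    proof (rule wp_for[where I = ?J])
      fix \<kappa> \<sigma>2 assume k: "\<kappa> < n + 2" and J: "?J \<kappa> \<sigma>2" and c2: "\<sigma>2 rKAP 0 = \<kappa>"
      have "wp try_candidate (\<lambda>\<sigma>'. same rTRY \<sigma>2 \<sigma>' \<and>
        (if is_sol (cand \<omega> \<tau> \<kappa>) then \<sigma>' rFOUND 0 = 1 \<and> \<sigma>' rSOL 0 = cand \<omega> \<tau> \<kappa>
         else \<sigma>' rFOUND 0 = \<sigma>2 rFOUND 0 \<and> \<sigma>' rSOL 0 = \<sigma>2 rSOL 0)) T_try \<sigma>2"
        using J c2 k assms
        by (intro try_candidate_spec) (auto simp: same_def powok_def tapeok_def listed_def)
      then show "wp try_candidate (\<lambda>\<sigma>'. \<sigma>' rKAP 0 = \<kappa> \<and> ?J (Suc \<kappa>) (upd \<sigma>' rKAP 0 (Suc \<kappa>))) T_try \<sigma>2"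
      proof (rule wp_conseq, goal_cases)
        case (1 \<sigma>3)
        then have s: "same rTRY \<sigma>2 \<sigma>3" by simp
        have s3: "same ?R \<sigma> \<sigma>3" using J s by (auto simp: same_def)
        have rows: "\<sigma>3 rTAU = \<sigma>2 rTAU" "\<sigma>3 rKAP = \<sigma>2 rKAP" using s by (auto simp: same_def)
        have ex: "(\<exists>(a, b)\<in>?P \<tau> (Suc \<kappa>). is_sol (cand \<omega> a b)) \<longleftrightarrow>
           is_sol (cand \<omega> \<tau> \<kappa>) \<or> (\<exists>(a, b)\<in>?P \<tau> \<kappa>. is_sol (cand \<omega> a b))"
          by (auto simp: lessThan_Suc)
        have "found_in \<omega> (?P \<tau> (Suc \<kappa>)) \<sigma>3"
          using J 1 unfolding found_in_def ex by (auto split: if_splits)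
        then show ?case using s3 rows c2 J by (auto intro!: same_upd simp: found_in_def)
      qed
    next
      fix \<sigma>2 assume J: "?J (n + 2) \<sigma>2"
      have "?P \<tau> (n + 2) = ?P (Suc \<tau>) 0" by auto
      then show "\<sigma>2 rTAU 0 = \<tau> \<and> ?I (Suc \<tau>) (upd \<sigma>2 rTAU 0 (Suc \<tau>))"
        using J by (auto intro!: same_upd simp: found_in_def)
    qed (use I c n_M in \<open>auto intro!: same_upd simp: B_less found_in_def\<close>)
  next
    fix \<sigma>1 assume I: "?I M \<sigma>1"
    have "powok \<sigma>1" using I assms(1) by (simp add: same_def powok_def)
    then show "powok \<sigma>1 \<and> found_in \<omega> trials \<sigma>1" using I by (simp add: trials_def)
  qed (use assms n_M in \<open>auto intro!: same_upd simp: B_less found_in_def\<close>)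
  then show ?thesis by (rule wp_time) (simp add: T_search_def algebra_simps)
qed

definition result :: "(nat \<Rightarrow> bool) \<Rightarrow> memory \<Rightarrow> bool" where
  "result \<omega> s \<longleftrightarrow> (if \<exists>(\<tau>, \<kappa>)\<in>trials. is_sol (cand \<omega> \<tau> \<kappa>)
     then s 0 = 1 \<and> (\<exists>x. is_sol x \<and> (\<forall>i<n. s (Suc i) = b2n (bt x i))) else s 0 = 0)"

text \<open>Since the output replaces the input, the rules for a fixed input do not apply; the loop
  is followed directly, with the input part varying.\<close>

lemma write_output_spec:
  assumes "powok \<sigma>" "\<sigma> rSOL 0 = x" "\<sigma> rFOUND 0 \<le> 1"
  shows "\<exists>s k. big B write_output (conc b0 K inp \<sigma>) s k \<and> k \<le> 3 * n + 3 \<and>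
    s 0 = \<sigma> rFOUND 0 \<and> (\<forall>i<n. s (Suc i) = b2n (bt x i))"
proof -
  define I where "I j = (\<lambda>a. if 1 \<le> a \<and> a \<le> j then b2n (bt x (a - 1)) else inp a)" for j
  define C where "C j = conc b0 K (I j) (upd \<sigma> rI 0 j)" for j
  \<comment> \<open>The output occupies the cells 0 to \<open>n\<close>, which thus lie below the
    registers still needed.\<close>
  have "(n + 1) ^ 1 \<le> (n + 1) ^ (2 * d)" using d2 by (intro power_increasing) auto
  then have "1 * (n + 1) \<le> (d + 4) * (n + 1) ^ (2 * d)" by (intro mult_le_mono) auto
  then have nb: "n + 1 \<le> b0" by (simp add: b0_def)
  have I0: "I j 0 = n" for j by (simp add: I_def)
  have C0: "C j 0 = n" for j using b0_gt by (simp add: C_def conc_def I0)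
  have bx: "exp_val (C j) bx = b0" for j
  proof -
    have "exp_val (C j) bx = (d + 4) * (n + 1) ^ (2 * d)" by (simp add: bx_def C0)
    then show ?thesis by (simp only: b0_def)
  qed
  have g: "exp_val (C j) (get r i) = upd \<sigma> rI 0 j r (exp_val (C j) i)" if "r < 30" for j r i
  proof -
    have "C j (b0 + (r + K * x)) = upd \<sigma> rI 0 j r x" for x using that by (simp add: C_def conc_row)
    then show ?thesis by (simp add: get_def addr_def bx)
  qed
  have rI: "exp_val (C j) (reg rI) = j" for j using g[of rI j "Const 0"] by simp
  have bit: "exp_val (C j) (bitx (reg rSOL) (reg rI)) = b2n (bt x j)" if "j < n" for j
    using that assms(1,2) n_M by (simp add: bitx_def g powok_def b2n_bt)
  let ?c = "Assign (Plus (reg rI) (Const 1)) (bitx (reg rSOL) (reg rI))"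
  let ?p = "put rI (Const 0) (Plus (reg rI) (Const 1))"
  let ?w = "While (Minus nx (reg rI)) (Seq ?c ?p)"
  have put: "big B (put rI (Const 0) e) (conc b0 K J (upd \<sigma> rI 0 j)) (conc b0 K J (upd \<sigma> rI 0 v)) 1"
    if "J 0 = n" "exp_val (conc b0 K J (upd \<sigma> rI 0 j)) e = v" "v < 2 ^ B" for J j e v
  proof -
    have 0: "conc b0 K J (upd \<sigma> rI 0 j) 0 = n" using b0_gt that by (simp add: conc_def)
    have "exp_val (conc b0 K J (upd \<sigma> rI 0 j)) bx = (d + 4) * (n + 1) ^ (2 * d)" by (simp add: bx_def 0)
    then have bx: "exp_val (conc b0 K J (upd \<sigma> rI 0 j)) bx = b0" by (simp only: b0_def)
    have "(conc b0 K J (upd \<sigma> rI 0 j))(b0 + (rI + K * 0) := v) = conc b0 K J (upd \<sigma> rI 0 v)"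
      by (subst conc_upd) (auto simp: upd_def)
    then show ?thesis
      using big_Assign[of "conc b0 K J (upd \<sigma> rI 0 j)" e B "addr rI (Const 0)"] that(2,3)
      by (simp add: put_def addr_def bx)
  qed
  have step: "big B (Seq ?c ?p) (C j) (C (Suc j)) 2" if j: "j < n" for j
  proof -
    have "(I j)(Suc j := b2n (bt x j)) = I (Suc j)" by (auto simp: I_def fun_eq_iff le_Suc_eq)
    then have e: "(C j)(Suc j := b2n (bt x j)) = conc b0 K (I (Suc j)) (upd \<sigma> rI 0 j)"
      using nb j unfolding C_def by (subst conc_upd_input) auto
    have 1: "big B ?c (C j) (conc b0 K (I (Suc j)) (upd \<sigma> rI 0 j)) 1"
      using big_Assign[of "C j" "bitx (reg rSOL) (reg rI)" B "Plus (reg rI) (Const 1)"] bit[OF j] rI e by simp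
    have "exp_val (conc b0 K (I (Suc j)) (upd \<sigma> rI 0 j)) (Plus (reg rI) (Const 1)) = Suc j"
    proof -
      have 0: "conc b0 K (I (Suc j)) (upd \<sigma> rI 0 j) 0 = n" using b0_gt by (simp add: conc_def I0)
      have "exp_val (conc b0 K (I (Suc j)) (upd \<sigma> rI 0 j)) bx = (d + 4) * (n + 1) ^ (2 * d)" by (simp add: bx_def 0)
      then have bx: "exp_val (conc b0 K (I (Suc j)) (upd \<sigma> rI 0 j)) bx = b0" by (simp only: b0_def)
      show ?thesis
        using conc_row[of rI K b0 "I (Suc j)" "upd \<sigma> rI 0 j" 0] by (simp add: get_def addr_def bx)
    qed
    then have 2: "big B ?p (conc b0 K (I (Suc j)) (upd \<sigma> rI 0 j)) (C (Suc j)) 1"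
      unfolding C_def using j n_M by (intro put) (auto simp: I0 B_less)
    show ?thesis using big_Seq[OF 1 2] by (simp add: numeral_2_eq_2)
  qed
  have loop: "\<exists>k. big B ?w (C j) (C n) k \<and> k \<le> 3 * (n - j) + 1" if "j \<le> n" for j
    using that
  proof (induction "n - j" arbitrary: j)
    case 0
    then have "j = n" by simp
    moreover have "exp_val (C n) (Minus nx (reg rI)) = 0" by (simp only: exp_val.simps C0 rI diff_self_eq_0)
    then have "big B ?w (C n) (C n) 1" by (rule big_While_False)
    ultimately show ?case by auto
  next
    case (Suc a)
    then have j: "j < n" by simp
    obtain k where k: "big B ?w (C (Suc j)) (C n) k" "k \<le> 3 * (n - Suc j) + 1"
      using Suc(1)[of "Suc j"] Suc(2) j by (metis Suc_diff_Suc Suc_inject Suc_leI)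
    have "exp_val (C j) (Minus nx (reg rI)) \<noteq> 0" using j by (simp only: exp_val.simps C0 rI)
    then have "big B ?w (C j) (C n) (Suc (2 + k))" using big_While_True[OF _ step[OF j] k(1)] by blast
    then show ?case using k(2) j by (intro exI[of _ "Suc (2 + k)"]) auto
  qed
  obtain k where k: "big B ?w (C 0) (C n) k" "k \<le> 3 * n + 1" using loop[of 0] by auto
  have "I 0 = inp" by (auto simp: I_def)
  then have "big B (put rI (Const 0) (Const 0)) (conc b0 K inp \<sigma>) (C 0) 1"
    using put[of "I 0" "\<sigma> rI 0" "Const 0" 0] by (simp add: C_def I0)
  then have b1: "big B (for_loop rI 0 nx ?c) (conc b0 K inp \<sigma>) (C n) (1 + k)"
    unfolding for_loop_def using k(1) by (rule big_Seq)
  have "big B (Assign (Const 0) (reg rFOUND)) (C n) ((C n)(0 := \<sigma> rFOUND 0)) 1"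
    using big_Assign[of "C n" "reg rFOUND" B "Const 0"] assms(3) g[of rFOUND n "Const 0"] by (simp add: le_1_less_B)
  with b1 have "big B write_output (conc b0 K inp \<sigma>) ((C n)(0 := \<sigma> rFOUND 0)) (1 + k + 1)"
    unfolding write_output_def by (rule big_Seq)
  moreover have "C n (Suc i) = b2n (bt x i)" if "i < n" for i
    using that nb by (simp add: C_def conc_def I_def)
  ultimately show ?thesis using k(2) by fastforce
qed

definition main :: prog where
  "main = Seq make_powers (Seq make_list (Seq search write_output))"

definition T_main :: nat where
  "T_main = (M * 3 + 3) + (n * (card U * (5 * n + 16) + 5) + 5) + T_search + (3 * n + 3)"

lemma main_spec:
  assumes "tapeok \<omega> \<sigma>" "\<sigma> rFOUND 0 = 0"
  shows "\<exists>s k. big B main (conc b0 K inp \<sigma>) s k \<and> k \<le> T_main \<and> result \<omega> s"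
proof -
  have "wp (Seq make_powers (Seq make_list search)) (\<lambda>\<sigma>'. powok \<sigma>' \<and> found_in \<omega> trials \<sigma>')
     ((M * 3 + 3) + ((n * (card U * (5 * n + 16) + 5) + 5) + T_search)) \<sigma>"
  proof (rule wp_Seq, rule wp_conseq[OF make_powers_spec], rule wp_Seq, rule wp_conseq[OF make_list_spec], goal_cases)
    case (2 \<sigma>1 \<sigma>2)
    then show ?case using assms by (intro search_spec) (auto simp: same_def powok_def tapeok_def)
  qed simp
  then obtain \<sigma>3 k3 where 3: "big B (Seq make_powers (Seq make_list search)) (conc b0 K inp \<sigma>) (conc b0 K inp \<sigma>3) k3"
    "k3 \<le> (M * 3 + 3) + ((n * (card U * (5 * n + 16) + 5) + 5) + T_search)" "powok \<sigma>3" "found_in \<omega> trials \<sigma>3"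
    unfolding wp_def by blast
  then have "\<sigma>3 rFOUND 0 \<le> 1" by (auto simp: found_in_def split: if_splits)
  from write_output_spec[OF 3(3) refl this] obtain s k where s: "big B write_output (conc b0 K inp \<sigma>3) s k" "k \<le> 3 * n + 3"
    "s 0 = \<sigma>3 rFOUND 0" "\<forall>i<n. s (Suc i) = b2n (bt (\<sigma>3 rSOL 0) i)" by blast
  have "result \<omega> s" using s 3(4) by (auto simp: result_def found_in_def split: if_splits)
  moreover have "big B main (conc b0 K inp \<sigma>) s (k3 + k)"
  proof -
    from 3(1) obtain s1 s2 k1 k2 l where a: "big B make_powers (conc b0 K inp \<sigma>) s1 k1" "big B make_list s1 s2 k2"
      "big B search s2 (conc b0 K inp \<sigma>3) l" "k3 = k1 + (k2 + l)"
      by (auto elim!: big.cases[of _ "Seq _ _"])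
    have "big B main (conc b0 K inp \<sigma>) s (k1 + (k2 + (l + k)))"
      unfolding main_def using big_Seq[OF a(1) big_Seq[OF a(2) big_Seq[OF a(3) s(1)]]] .
    then show ?thesis using a by (simp add: add.assoc)
  qed
  ultimately show ?thesis using 3(2) s(2) by (intro exI[of _ s] exI[of _ "k3 + k"]) (auto simp: T_main_def)
qed

end

section \<open>Correctness for good tapes\<close>

definition poly_deg :: "nat \<Rightarrow> (nat \<Rightarrow> bit) \<Rightarrow> bool" where
  "poly_deg D g \<longleftrightarrow> (\<exists>f. deg_le D f \<and> (\<forall>x. g x = f (set_decode x)))"

lemma poly_degI: "deg_le D f \<Longrightarrow> (\<And>x. g x = f (set_decode x)) \<Longrightarrow> poly_deg D g"
  by (auto simp: poly_deg_def)

lemma poly_deg_const: "poly_deg D (\<lambda>x. c)"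
  by (rule poly_degI[OF deg_le_const]) simp

lemma poly_deg_add: "poly_deg D f \<Longrightarrow> poly_deg D g \<Longrightarrow> poly_deg D (\<lambda>x. f x + g x)"
proof -
  assume "poly_deg D f" "poly_deg D g"
  then obtain f' g' where *: "deg_le D f'" "\<forall>x. f x = f' (set_decode x)" "deg_le D g'" "\<forall>x. g x = g' (set_decode x)"
    unfolding poly_deg_def by blast
  show ?thesis by (rule poly_degI[OF deg_le_add[OF *(1,3)]]) (simp add: *)
qed

lemma poly_deg_mult: "poly_deg a f \<Longrightarrow> poly_deg b g \<Longrightarrow> poly_deg (a + b) (\<lambda>x. f x * g x)"
proof -
  assume "poly_deg a f" "poly_deg b g"
  then obtain f' g' where *: "deg_le a f'" "\<forall>x. f x = f' (set_decode x)" "deg_le b g'" "\<forall>x. g x = g' (set_decode x)"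
    unfolding poly_deg_def by blast
  show ?thesis by (rule poly_degI[OF deg_le_mult[OF *(1,3)]]) (simp add: *)
qed

lemma poly_deg_cmult: "poly_deg D f \<Longrightarrow> poly_deg D (\<lambda>x. c * f x)"
  using poly_deg_mult[OF poly_deg_const[of 0 c], of D f] by simp

lemma poly_deg_sum: "finite I \<Longrightarrow> (\<And>i. i \<in> I \<Longrightarrow> poly_deg D (f i)) \<Longrightarrow> poly_deg D (\<lambda>x. \<Sum>i\<in>I. f i x)"
  by (induction I rule: finite_induct) (auto intro: poly_deg_const poly_deg_add)

lemma poly_deg_sum_list: "(\<And>i. i \<in> set I \<Longrightarrow> poly_deg D (f i)) \<Longrightarrow> poly_deg D (\<lambda>x. \<Sum>i\<leftarrow>I. f i x)"
  by (induction I) (auto intro: poly_deg_const poly_deg_add)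

lemma poly_deg_prod: "finite I \<Longrightarrow> (\<And>i. i \<in> I \<Longrightarrow> poly_deg D (f i)) \<Longrightarrow> poly_deg (D * card I) (\<lambda>x. \<Prod>i\<in>I. f i x)"
proof (induction I rule: finite_induct)
  case (insert i I)
  then show ?case using poly_deg_mult[of D "f i" "D * card I"] by simp
qed (simp add: poly_deg_const)

lemma prod_list_bt: "(\<Prod>i\<leftarrow>u. bt x i) = of_bool (set u \<subseteq> set_decode x)"
  by (induction u) (auto simp: bt_def)

lemma poly_deg_monomial: "length u \<le> D \<Longrightarrow> poly_deg D (\<lambda>x. \<Prod>i\<leftarrow>u. bt x i)"
  by (rule poly_degI[OF deg_le_monomial[of "set u"]]) (auto simp: prod_list_bt intro: le_trans[OF card_length])

lemma poly_deg_bt: "1 \<le> D \<Longrightarrow> poly_deg D (\<lambda>x. bt x i)"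
  using poly_deg_monomial[of "[i]" D] by simp

text \<open>Over the field with two elements \<open>1 + v\<close> is the indicator of
  \<open>v = 0\<close>; the product turns a system into a single polynomial.\<close>

lemma prod_one_plus_bit: "finite I \<Longrightarrow> (\<Prod>i\<in>I. 1 + v i) = (of_bool (\<forall>i\<in>I. v i = 0) :: bit)"
proof (induction I rule: finite_induct)
  case (insert i I)
  then show ?case by (cases "v i") auto
qed simp

context instance_context
begin

lemma nn_le: "nn k \<le> n" and pp_le: "pp k \<le> n" and pp_nn: "n - pp k = nn k" "pp k + nn k = n"
  by (auto simp: nn_def pp_def)

lemma pp_mono: "pp k \<le> pp (Suc k)" and pp_step: "pp (Suc k) \<le> pp k + S"
  by (auto simp: nn_def pp_def)

lemma pp_0 [simp]: "pp 0 = 0" by (simp add: pp_def nn_def)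

lemma pp_D [simp]: "pp D = n"
proof -
  have "n < D * (n div D + 1)" using D1 by (metis Suc_eq_plus1 dividend_less_times_div less_le_trans mult_Suc_right zero_less_one add.commute)
  then show ?thesis by (simp add: pp_def nn_def S_def)
qed

text \<open>Hash equations and the equation for the inspected variable are affine, and linear
  combinations do not raise the degree.\<close>

lemma vec_deg: "t = (\<tau>, \<kappa>, \<iota>) \<Longrightarrow> poly_deg d (\<lambda>x. vec \<omega> t k rep x i)"
proof (induction k arbitrary: i)
  case 0
  have d1: "1 \<le> d" using d2 by simp
  consider "i < m" | "\<not> i < m" "i < m + \<kappa>" "i < m + n + 1" | "i = m + n + 1" | "\<not> i < m" "\<not> (i < m + \<kappa> \<and> i < m + n + 1)" "i \<noteq> m + n + 1"
    by linarith
  then show ?case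
  proof cases
    case 1
    have "poly_deg d (\<lambda>x. sysval i x)" unfolding sysval_def
      using in_anf[of "E ! i"] 1 by (intro poly_deg_sum_list poly_deg_monomial) (auto simp: m_def)
    then show ?thesis using 0 1 by (simp add: vec0_def)
  next
    case 2
    have "poly_deg d (\<lambda>x. hash \<omega> \<tau> (i - m) x)" unfolding hash_def
      by (intro poly_deg_add poly_deg_const poly_deg_sum poly_deg_cmult poly_deg_bt d1) auto
    then show ?thesis using 0 2 by (simp add: vec0_def)
  next
    case 3
    have "poly_deg d (\<lambda>x. 1 + bt x \<iota>)" by (intro poly_deg_add poly_deg_const poly_deg_bt d1)
    then show ?thesis using 0 3 by (simp add: vec0_def)
  next
    case 4
    then have "vec0 \<omega> (\<tau>, \<kappa>, \<iota>) x i = 0" for x by (auto simp: vec0_def)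
    then show ?thesis using 0 by (simp add: poly_deg_const)
  qed
next
  case (Suc k)
  then show ?case
    by (cases "i < nn (Suc k) + 4")
      (auto simp: apply_tape_def poly_deg_const intro!: poly_deg_sum poly_deg_cmult)
qed

text \<open>All but the first \<open>nn (Suc k) + 4\<close> entries of a compressed vector are
  identically zero, so only that many factors of degree \<open>d\<close> are multiplied.\<close>

lemma F_deg: "poly_deg (d * (nn (Suc k) + 4)) (F \<omega> t (Suc k) rep)"
proof -
  obtain \<tau> \<kappa> \<iota> where t: "t = (\<tau>, \<kappa>, \<iota>)" by (cases t)
  let ?v = "\<lambda>x. vec \<omega> t (Suc k) rep x"
  have "nn (Suc k) + 4 \<le> M" using nn_le[of "Suc k"] n_M by linarith
  then have "(\<forall>i<M. ?v x i = 0) \<longleftrightarrow> (\<forall>i\<in>{..<nn (Suc k) + 4}. ?v x i = 0)" for x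
    by (auto simp: apply_tape_def)
  then have "F \<omega> t (Suc k) rep = (\<lambda>x. \<Prod>i<nn (Suc k) + 4. 1 + ?v x i)"
    by (simp add: fun_eq_iff F_def prod_one_plus_bit del: vec.simps)
  moreover have "poly_deg (d * card {..<nn (Suc k) + 4}) (\<lambda>x. \<Prod>i<nn (Suc k) + 4. 1 + ?v x i)"
    by (intro poly_deg_prod poly_deg_add poly_deg_const vec_deg[OF t]) auto
  ultimately show ?thesis by simp
qed

definition par :: "(nat \<Rightarrow> bool) \<Rightarrow> nat \<times> nat \<times> nat \<Rightarrow> nat \<Rightarrow> (nat \<Rightarrow> nat) \<Rightarrow> nat \<Rightarrow> nat \<Rightarrow> bit" where
  "par \<omega> t k rep p y = (\<Sum>z | z < 2 ^ n \<and> z mod 2 ^ p = y. F \<omega> t k rep z)"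

text \<open>The indicator has degree \<open>d * (nn (Suc k) + 4)\<close>, and each of the
  \<open>nn (Suc k)\<close> summed variables lowers it by one. What remains is
  \<open>w (Suc k)\<close>.\<close>

lemma par_deg: "\<exists>g. deg_le (w (Suc k)) g \<and> (\<forall>y<2 ^ pp (Suc k). par \<omega> t (Suc k) rep (pp (Suc k)) y = g (set_decode y))"
proof -
  let ?p = "pp (Suc k)"
  let ?B = "{?p..<n}"
  obtain f where f: "deg_le (d * (nn (Suc k) + 4)) f" "\<And>x. F \<omega> t (Suc k) rep x = f (set_decode x)"
    using F_deg[of k \<omega> t rep] by (auto simp: poly_deg_def)
  obtain g where g: "deg_le (d * (nn (Suc k) + 4) - card ?B) g"
    "\<And>Y. Y \<inter> ?B = {} \<Longrightarrow> g Y = (\<Sum>V\<in>Pow ?B. f (Y \<union> V))"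
    using deg_le_sum_cube[OF _ f(1), of ?B] by auto
  have "card ?B = nn (Suc k)" by (simp add: pp_nn)
  moreover have "d * (nn (Suc k) + 4) - nn (Suc k) = w (Suc k)"
    using d2 by (simp add: w_def algebra_simps diff_mult_distrib)
  ultimately have "deg_le (w (Suc k)) g" using g(1) by simp
  moreover have "par \<omega> t (Suc k) rep ?p y = g (set_decode y)" if y: "y < 2 ^ ?p" for y
  proof -
    have Y: "set_decode y \<subseteq> {..<?p}" using y by (simp add: less_power_iff_set_decode)
    \<comment> \<open>Completions of a prefix correspond to subsets of the remaining coordinates,
      which turns the sum over numbers into a sum over a cube.\<close>
    have bij: "bij_betw (\<lambda>V. set_encode (set_decode y \<union> V)) (Pow ?B) {z. z < 2 ^ n \<and> z mod 2 ^ ?p = y}"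
    proof (rule bij_betw_byWitness[where f' = "\<lambda>z. set_decode z - {..<?p}"])
      show "\<forall>V\<in>Pow ?B. set_decode (set_encode (set_decode y \<union> V)) - {..<?p} = V"
        using Y by (auto simp: finite_subset[of _ ?B])
      have dec: "set_decode z = set_decode y \<union> (set_decode z - {..<?p})" if "z mod 2 ^ ?p = y" for z
        using set_decode_mod_power[of z ?p] that by auto
      show "\<forall>z\<in>{z. z < 2 ^ n \<and> z mod 2 ^ ?p = y}. set_encode (set_decode y \<union> (set_decode z - {..<?p})) = z"
        using dec by auto
      show "(\<lambda>V. set_encode (set_decode y \<union> V)) ` Pow ?B \<subseteq> {z. z < 2 ^ n \<and> z mod 2 ^ ?p = y}"
      proof clarify
        fix V assume V: "V \<subseteq> ?B"
        then have fin: "finite (set_decode y \<union> V)" using finite_subset by auto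
        have "set_encode (set_decode y \<union> V) < 2 ^ n"
          using V Y fin pp_le[of "Suc k"] by (auto simp: less_power_iff_set_decode)
        moreover have "set_decode (set_encode (set_decode y \<union> V) mod 2 ^ ?p) = set_decode y"
          using V Y fin by (auto simp: set_decode_mod_power)
        ultimately show "set_encode (set_decode y \<union> V) < 2 ^ n \<and> set_encode (set_decode y \<union> V) mod 2 ^ ?p = y"
          by (simp add: set_decode_eq_iff)
      qed
      show "(\<lambda>z. set_decode z - {..<?p}) ` {z. z < 2 ^ n \<and> z mod 2 ^ ?p = y} \<subseteq> Pow ?B"
        by (auto simp: less_power_iff_set_decode)
    qed
    have "g (set_decode y) = (\<Sum>V\<in>Pow ?B. f (set_decode y \<union> V))" using Y by (intro g(2)) auto
    also have "\<dots> = (\<Sum>V\<in>Pow ?B. F \<omega> t (Suc k) rep (set_encode (set_decode y \<union> V)))"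
      by (intro sum.cong refl) (auto simp: f(2) finite_subset[of _ ?B])
    also have "\<dots> = par \<omega> t (Suc k) rep ?p y"
      unfolding par_def by (rule sum.reindex_bij_betw[OF bij])
    finally show ?thesis by simp
  qed
  ultimately show ?thesis by blast
qed

text \<open>This confines the recursion to points of low weight: interpolation reads nothing else of
  its argument.\<close>

lemma extend_cong:
  assumes "\<And>y. set_decode y \<subseteq> set_decode x \<Longrightarrow> wt y \<le> W \<Longrightarrow> f y = g y"
  shows "extend W f x = extend W g x"
  unfolding extend_def low_moebius_def
proof (intro sum.cong refl if_cong)
  fix X V assume X: "X \<in> Pow (set_decode x)" "card X \<le> W" "V \<in> Pow X"
  then have "finite X" "finite V" "card V \<le> card X"
    using finite_subset[of X "set_decode x"] finite_subset[of V X] card_mono[of X V] by auto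
  then show "f (set_encode V) = g (set_encode V)" using X by (intro assms) auto
qed

lemma extend_par:
  assumes "x < 2 ^ pp (Suc k)"
  shows "extend (w (Suc k)) (par \<omega> t (Suc k) rep (pp (Suc k))) x = par \<omega> t (Suc k) rep (pp (Suc k)) x"
proof -
  let ?P = "par \<omega> t (Suc k) rep (pp (Suc k))"
  obtain g where g: "deg_le (w (Suc k)) g" "\<And>y. y < 2 ^ pp (Suc k) \<Longrightarrow> ?P y = g (set_decode y)"
    using par_deg by blast
  have "extend (w (Suc k)) ?P x = (\<Sum>X\<in>Pow (set_decode x). if card X \<le> w (Suc k) then \<Sum>V\<in>Pow X. g V else 0)"
    unfolding extend_def low_moebius_def
  proof (intro sum.cong refl if_cong)
    fix X V assume X: "X \<in> Pow (set_decode x)" "V \<in> Pow X"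
    then have V: "V \<subseteq> set_decode x" by blast
    then have "finite V" by (rule finite_subset) simp
    then show "?P (set_encode V) = g V"
      using V assms by (subst g(2)) (auto simp: less_power_iff_set_decode)
  qed
  also have "\<dots> = ?P x" using deg_le_interpolate[OF g(1)] g(2)[OF assms] by simp
  finally show ?thesis .
qed

definition params :: "(nat \<times> nat \<times> nat) set" where "params = {..<M} \<times> {..<n + 2} \<times> {..<n}"

text \<open>As zero vectors stay zero, the only possible error of copy \<open>j\<close> is a nonzero
  vector that its matrix annihilates, at some completion of \<open>y\<close>.\<close>

definition bad :: "(nat \<Rightarrow> bool) \<Rightarrow> nat \<times> nat \<times> nat \<Rightarrow> nat \<Rightarrow> (nat \<Rightarrow> nat) \<Rightarrow> nat \<Rightarrow> nat \<Rightarrow> bool" where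
  "bad \<omega> t k rep y j \<longleftrightarrow> (\<exists>z<2 ^ n. z mod 2 ^ pp (Suc k) = y \<and> F \<omega> t k rep z = 0 \<and>
     (\<forall>i<nn (Suc k) + 4. apply_tape \<omega> k j (vec \<omega> t k rep z) i = 0))"

definition fails_at :: "(nat \<Rightarrow> bool) \<Rightarrow> nat \<times> nat \<times> nat \<Rightarrow> nat \<Rightarrow> (nat \<Rightarrow> nat) \<Rightarrow> nat \<Rightarrow> bool" where
  "fails_at \<omega> t k rep y \<longleftrightarrow> M \<le> 2 * card {j. j < M \<and> bad \<omega> t k rep y j}"

definition good_tape :: "(nat \<Rightarrow> bool) \<Rightarrow> bool" where
  "good_tape \<omega> \<longleftrightarrow> (\<forall>t\<in>params. \<forall>k<D. \<forall>rep y. (\<forall>i<k. rep i < M) \<longrightarrow> y < 2 ^ pp (Suc k) \<longrightarrow> \<not> fails_at \<omega> t k rep y)"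

lemma F_step:
  assumes "\<not> bad \<omega> t k rep y j" "z < 2 ^ n" "z mod 2 ^ pp (Suc k) = y"
  shows "F \<omega> t (Suc k) (rep(k := j)) z = F \<omega> t k rep z"
proof -
  have v: "vec \<omega> t k (rep(k := j)) z = vec \<omega> t k rep z" by (rule vec_cong) simp
  show ?thesis
  proof (cases "F \<omega> t k rep z = 0")
    case True
    then obtain i where i: "i < nn (Suc k) + 4" "apply_tape \<omega> k j (vec \<omega> t k rep z) i \<noteq> 0"
      using assms unfolding bad_def by blast
    moreover have "i < M" using i nn_le[of "Suc k"] n_M by linarith
    ultimately have "F \<omega> t (Suc k) (rep(k := j)) z = 0" by (auto simp: F_def v)
    then show ?thesis using True by simp
  next
    case False
    then have "\<forall>i<M. vec \<omega> t k rep z i = 0" by (auto simp: F_def)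
    then show ?thesis by (simp add: F_def v apply_tape_def)
  qed
qed

text \<open>Nothing is claimed about prefixes of larger weight: their entries may be wrong, but
  interpolation does not read them.\<close>

lemma tab_correct:
  assumes good: "good_tape \<omega>" and t: "t \<in> params"
  shows "h \<le> D \<Longrightarrow> (\<And>i. i < D - h \<Longrightarrow> rep i < M) \<Longrightarrow> y < 2 ^ pp (D - h) \<Longrightarrow> wt y \<le> w (D - h) \<Longrightarrow>
    tab \<omega> t h rep y = par \<omega> t (D - h) rep (pp (D - h)) y"
proof (induction h arbitrary: rep y)
  case 0
  then have "{z. z < 2 ^ n \<and> z mod 2 ^ n = y} = {y}" by auto
  then show ?case by (simp add: par_def)
next
  case (Suc h)
  define k where "k = D - Suc h"
  have k: "k < D" "D - h = Suc k" using Suc.prems(1) by (auto simp: k_def)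
  have y: "y < 2 ^ pp k" "wt y \<le> w k" using Suc.prems by (simp_all add: k_def)
  define A where "A = {x. x < 2 ^ pp (Suc k) \<and> x mod 2 ^ pp k = y}"
  \<comment> \<open>The weight of \<open>x\<close> is bounded only on its first \<open>pp k\<close>
    coordinates. The definition of \<open>U\<close> leaves the next \<open>S\<close> coordinates
    free precisely to admit these points.\<close>
  have A: "{x. x \<in> U \<and> x < 2 ^ pp (Suc k) \<and> x mod 2 ^ pp k = y} = A"
  proof -
    have "x \<in> U" if "x < 2 ^ pp (Suc k)" "x mod 2 ^ pp k = y" for x
    proof -
      have "x < 2 ^ n" using that(1) by (rule less_le_trans) (simp add: pp_le)
      moreover have "x < 2 ^ (pp k + S)" using that(1) by (rule less_le_trans) (intro power_increasing pp_step; simp)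
      moreover have "wt (x mod 2 ^ pp k) \<le> (d - 1) * (n - pp k) + 4 * d"
        using that(2) y(2) by (simp add: w_def pp_nn)
      ultimately show ?thesis using pp_le[of k] unfolding U_def by blast
    qed
    then show ?thesis by (auto simp: A_def)
  qed
  define e where "e j x = extend (w (Suc k)) (tab \<omega> t h (rep(k := j))) x" for j x
  \<comment> \<open>The target of the vote: parities of the indicator of level \<open>k\<close>, not
    compressed further, but at the longer prefixes of level \<open>Suc k\<close>.\<close>
  let ?q = "par \<omega> t k rep (pp (Suc k))"
  have e: "e j x = ?q x" if j: "j < M" "\<not> bad \<omega> t k rep x j" and x: "x < 2 ^ pp (Suc k)" for j x
  proof -
    have "e j x = extend (w (Suc k)) (par \<omega> t (Suc k) (rep(k := j)) (pp (Suc k))) x"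
      unfolding e_def
    proof (rule extend_cong)
      fix y' assume y': "set_decode y' \<subseteq> set_decode x" "wt y' \<le> w (Suc k)"
      have "y' < 2 ^ pp (Suc k)" using y'(1) x by (auto simp: less_power_iff_set_decode)
      then show "tab \<omega> t h (rep(k := j)) y' = par \<omega> t (Suc k) (rep(k := j)) (pp (Suc k)) y'"
      proof -
        have "(rep(k := j)) i < M" if "i < D - h" for i
          using that j Suc.prems(2)[of i] k by (auto simp: k_def)
        moreover have "h \<le> D" using Suc.prems(1) by simp
        moreover have "y' < 2 ^ pp (D - h)" "wt y' \<le> w (D - h)" using \<open>y' < _\<close> y'(2) k(2) by simp_all
        ultimately show ?thesis unfolding k(2)[symmetric] by (intro Suc.IH)
      qed
    qed
    also have "\<dots> = par \<omega> t (Suc k) (rep(k := j)) (pp (Suc k)) x" by (rule extend_par[OF x])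
    also have "\<dots> = ?q x" unfolding par_def by (intro sum.cong refl F_step[OF j(2)]) auto
    finally show ?thesis .
  qed
  \<comment> \<open>Fewer than half of the copies are bad, so the strict majority is right whether
    the true parity is 1 or 0.\<close>
  have maj: "of_bool (M < 2 * card {j. j < M \<and> e j x = 1}) = ?q x" if x: "x < 2 ^ pp (Suc k)" for x
  proof -
    have "\<not> fails_at \<omega> t k rep x"
      using good t k x Suc.prems(2) unfolding good_tape_def k_def by blast
    then have b: "2 * card {j. j < M \<and> bad \<omega> t k rep x j} < M" by (simp add: fails_at_def)
    show ?thesis
    proof (cases "?q x = 1")
      case True
      have "{..<M} \<subseteq> {j. j < M \<and> bad \<omega> t k rep x j} \<union> {j. j < M \<and> e j x = 1}"
        using e[OF _ _ x] True by auto
      then have "M \<le> card ({j. j < M \<and> bad \<omega> t k rep x j} \<union> {j. j < M \<and> e j x = 1})"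
        using card_mono[of "{j. j < M \<and> bad \<omega> t k rep x j} \<union> {j. j < M \<and> e j x = 1}" "{..<M}"] by simp
      also have "\<dots> \<le> card {j. j < M \<and> bad \<omega> t k rep x j} + card {j. j < M \<and> e j x = 1}" by (rule card_Un_le)
      finally show ?thesis using b True by simp
    next
      case False
      then have q: "?q x = 0" by simp
      have "{j. j < M \<and> e j x = 1} \<subseteq> {j. j < M \<and> bad \<omega> t k rep x j}"
      proof clarify
        fix j assume j: "j < M" "e j x = 1"
        show "bad \<omega> t k rep x j"
        proof (rule ccontr)
          assume "\<not> ?thesis"
          then have "e j x = ?q x" by (rule e[OF j(1) _ x])
          then show False using q j(2) by simp
        qed
      qed
      then have "card {j. j < M \<and> e j x = 1} \<le> card {j. j < M \<and> bad \<omega> t k rep x j}" by (intro card_mono) auto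
      then show ?thesis using b q by simp
    qed
  qed
  have "tab \<omega> t (Suc h) rep y = (\<Sum>x\<in>A. of_bool (M < 2 * card {j. j < M \<and> e j x = 1}))"
    by (simp only: tab.simps Let_def A k_def[symmetric] e_def)
  also have "\<dots> = (\<Sum>x\<in>A. ?q x)" using maj by (intro sum.cong refl) (auto simp: A_def)
  \<comment> \<open>Completions of \<open>y\<close> are grouped by their longer prefixes; the
    filtered form of the inner set is the one required for regrouping.\<close>
  also have "\<dots> = (\<Sum>x\<in>A. \<Sum>z\<in>{z \<in> {z. z < 2 ^ n \<and> z mod 2 ^ pp k = y}. z mod 2 ^ pp (Suc k) = x}. F \<omega> t k rep z)"
  proof (intro sum.cong refl)
    fix x assume "x \<in> A"
    have "z mod 2 ^ pp (Suc k) mod 2 ^ pp k = z mod 2 ^ pp k" for z :: nat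
      using pp_mono[of k] by (simp add: mod_mod_cancel le_imp_power_dvd)
    then have "{z \<in> {z. z < 2 ^ n \<and> z mod 2 ^ pp k = y}. z mod 2 ^ pp (Suc k) = x} = {z. z < 2 ^ n \<and> z mod 2 ^ pp (Suc k) = x}"
      using \<open>x \<in> A\<close> by (auto simp: A_def)
    then show "?q x = (\<Sum>z\<in>{z \<in> {z. z < 2 ^ n \<and> z mod 2 ^ pp k = y}. z mod 2 ^ pp (Suc k) = x}. F \<omega> t k rep z)"
      by (simp add: par_def)
  qed
  also have "\<dots> = (\<Sum>z | z < 2 ^ n \<and> z mod 2 ^ pp k = y. F \<omega> t k rep z)"
  proof (rule sum.group)
    show "(\<lambda>z. z mod 2 ^ pp (Suc k)) ` {z. z < 2 ^ n \<and> z mod 2 ^ pp k = y} \<subseteq> A"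
      using pp_mono[of k] by (auto simp: A_def mod_mod_cancel le_imp_power_dvd)
  qed (auto simp: A_def)
  finally show ?case by (simp only: par_def k_def)
qed

definition isolated :: "(nat \<Rightarrow> bool) \<Rightarrow> nat \<Rightarrow> nat \<Rightarrow> bool" where
  "isolated \<omega> \<tau> \<kappa> \<longleftrightarrow> (\<exists>!z. is_sol z \<and> (\<forall>q<\<kappa>. hash \<omega> \<tau> q z = 0))"

lemma F_0:
  assumes "\<kappa> \<le> n + 1" "z < 2 ^ n"
  shows "F \<omega> (\<tau>, \<kappa>, \<iota>) 0 rep z = of_bool ((is_sol z \<and> (\<forall>q<\<kappa>. hash \<omega> \<tau> q z = 0)) \<and> bt z \<iota> = 1)"
proof -
  have "(\<forall>i<M. vec0 \<omega> (\<tau>, \<kappa>, \<iota>) z i = 0) \<longleftrightarrow>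
    (\<forall>j<m. sysval j z = 0) \<and> (\<forall>q<\<kappa>. hash \<omega> \<tau> q z = 0) \<and> bt z \<iota> = 1" (is "?l \<longleftrightarrow> ?r")
  proof
    assume l: ?l
    have "sysval j z = 0" if "j < m" for j using l[rule_format, of j] that m_M by (simp add: vec0_def)
    moreover have "hash \<omega> \<tau> q z = 0" if "q < \<kappa>" for q
      using l[rule_format, of "m + q"] that m_M assms(1) by (simp add: vec0_def)
    moreover have "bt z \<iota> = 1"
      using l[rule_format, of "m + n + 1"] m_M by (cases "bt z \<iota>") (auto simp: vec0_def)
    ultimately show ?r by blast
  next
    assume ?r
    then show ?l by (auto simp: vec0_def)
  qed
  then show ?thesis using assms(2) by (auto simp: F_def is_sol_def)
qed

text \<open>If \<open>z\<close> is the only survivor, the number of survivors with variable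
  \<open>\<iota>\<close> equal to 1 is 1 or 0 according to that bit of \<open>z\<close>, so the
  parities spell out \<open>z\<close>.\<close>

lemma cand_isolated:
  assumes good: "good_tape \<omega>" and "\<tau> < M" "\<kappa> \<le> n + 1" "isolated \<omega> \<tau> \<kappa>"
  shows "is_sol (cand \<omega> \<tau> \<kappa>)"
proof -
  obtain z where z: "is_sol z" "\<forall>q<\<kappa>. hash \<omega> \<tau> q z = 0"
    and uniq: "\<And>z'. is_sol z' \<Longrightarrow> \<forall>q<\<kappa>. hash \<omega> \<tau> q z' = 0 \<Longrightarrow> z' = z"
    using assms(4) unfolding isolated_def by blast
  have zn: "z < 2 ^ n" using z by (simp add: is_sol_def)
  have "tab \<omega> (\<tau>, \<kappa>, \<iota>) D (\<lambda>_. 0) 0 = bt z \<iota>" if "\<iota> < n" for \<iota>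
  proof -
    have "tab \<omega> (\<tau>, \<kappa>, \<iota>) D (\<lambda>_. 0) 0 = par \<omega> (\<tau>, \<kappa>, \<iota>) (D - D) (\<lambda>_. 0) (pp (D - D)) 0"
      by (rule tab_correct[OF good]) (use assms that in \<open>auto simp: params_def\<close>)
    also have "\<dots> = (\<Sum>x\<in>{..<2 ^ n}. F \<omega> (\<tau>, \<kappa>, \<iota>) 0 (\<lambda>_. 0) x)"
      by (simp add: par_def lessThan_def)
    also have "\<dots> = (\<Sum>x\<in>{..<2 ^ n}. if x = z then bt z \<iota> else 0)"
    proof (intro sum.cong refl)
      fix x :: nat assume "x \<in> {..<2 ^ n}"
      then have "F \<omega> (\<tau>, \<kappa>, \<iota>) 0 (\<lambda>_. 0) x = of_bool ((is_sol x \<and> (\<forall>q<\<kappa>. hash \<omega> \<tau> q x = 0)) \<and> bt x \<iota> = 1)"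
        using assms(3) by (intro F_0) auto
      also have "(is_sol x \<and> (\<forall>q<\<kappa>. hash \<omega> \<tau> q x = 0)) \<longleftrightarrow> x = z"
        using z uniq by blast
      also have "of_bool (x = z \<and> bt x \<iota> = 1) = (if x = z then bt z \<iota> else 0)"
        by (cases "bt x \<iota>") auto
      finally show "F \<omega> (\<tau>, \<kappa>, \<iota>) 0 (\<lambda>_. 0) x = (if x = z then bt z \<iota> else 0)" .
    qed
    also have "\<dots> = bt z \<iota>" using zn by simp
    finally show ?thesis .
  qed
  then have "cand \<omega> \<tau> \<kappa> = (\<Sum>\<iota><n. b2n (bt z \<iota>) * 2 ^ \<iota>)" by (simp add: cand_def)
  also have "\<dots> = (\<Sum>\<iota>\<in>set_decode z. 2 ^ \<iota>)"
  proof -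
    have "set_decode z \<subseteq> {..<n}" using zn by (simp add: less_power_iff_set_decode)
    then show ?thesis by (intro sum.mono_neutral_cong_right) (auto simp: bt_def)
  qed
  also have "\<dots> = z" using set_decode_inverse[of z] by (simp add: set_encode_def)
  finally show ?thesis using z by simp
qed

end

section \<open>Counting bad tapes\<close>

text \<open>The involution exchanges the elements with \<open>v\<close> and those without
  it.\<close>

lemma card_halve:
  assumes "finite A" "\<And>\<omega>. \<omega> \<in> A \<Longrightarrow> f \<omega> \<in> A \<and> f (f \<omega>) = \<omega> \<and> v (f \<omega>) = (\<not> v \<omega>)"
  shows "card {\<omega> \<in> A. \<not> v \<omega>} * 2 = card A"
proof -
  have "bij_betw f {\<omega> \<in> A. \<not> v \<omega>} {\<omega> \<in> A. v \<omega>}"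
    by (rule bij_betw_byWitness[where f' = f]) (use assms(2) in auto)
  then have "card {\<omega> \<in> A. \<not> v \<omega>} = card {\<omega> \<in> A. v \<omega>}" by (rule bij_betw_same_card)
  moreover have "card A = card {\<omega> \<in> A. \<not> v \<omega>} + card {\<omega> \<in> A. v \<omega>}"
    using assms(1) by (subst card_Un_disjoint[symmetric]) (auto intro: arg_cong[where f = card])
  ultimately show ?thesis by simp
qed

text \<open>Since \<open>f q\<close> toggles \<open>v q\<close> and nothing else, the \<open>v q\<close> behave like independent fair coins.\<close>

lemma card_constraints:
  assumes "finite Q" "finite A"
    and "\<And>q \<omega>. q \<in> Q \<Longrightarrow> \<omega> \<in> A \<Longrightarrow> f q \<omega> \<in> A \<and> f q (f q \<omega>) = \<omega> \<and> v q (f q \<omega>) = (\<not> v q \<omega>)"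
    and "\<And>q q' \<omega>. q \<in> Q \<Longrightarrow> q' \<in> Q \<Longrightarrow> q' \<noteq> q \<Longrightarrow> \<omega> \<in> A \<Longrightarrow> v q' (f q \<omega>) = v q' \<omega>"
  shows "card {\<omega> \<in> A. \<forall>q\<in>Q. \<not> v q \<omega>} * 2 ^ card Q = card A"
  using assms
proof (induction Q rule: finite_induct)
  case (insert q Q)
  let ?A = "{\<omega> \<in> A. \<forall>q\<in>Q. \<not> v q \<omega>}"
  have 1: "card {\<omega> \<in> ?A. \<not> v q \<omega>} * 2 = card ?A"
  proof (rule card_halve[where f = "f q"])
    fix \<omega> assume "\<omega> \<in> ?A"
    moreover have "q' \<noteq> q" if "q' \<in> Q" for q' using that insert.hyps by blast
    ultimately show "f q \<omega> \<in> ?A \<and> f q (f q \<omega>) = \<omega> \<and> v q (f q \<omega>) = (\<not> v q \<omega>)"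
      using insert.prems(2)[of q \<omega>] insert.prems(3)[of q _ \<omega>] by auto
  qed (use insert.prems in simp)
  have 2: "card ?A * 2 ^ card Q = card A" using insert.prems by (intro insert.IH) auto
  have "{\<omega> \<in> A. \<forall>q\<in>insert q Q. \<not> v q \<omega>} = {\<omega> \<in> ?A. \<not> v q \<omega>}" by auto
  moreover have "(2::nat) ^ card (insert q Q) = 2 * 2 ^ card Q" using insert.hyps by simp
  ultimately show ?case using 1 2 by (simp only: mult.assoc[symmetric])
qed simp

definition flip :: "nat \<Rightarrow> (nat \<Rightarrow> bool) \<Rightarrow> nat \<Rightarrow> bool" where
  "flip a \<omega> = fun_upd \<omega> a (\<not> \<omega> a)"

lemma flip_flip [simp]: "flip a (flip a \<omega>) = \<omega>"
  by (simp add: flip_def fun_eq_iff)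

context instance_context
begin

text \<open>False beyond \<open>N\<close>, so that the set is finite and probabilities become ratios
  of cardinalities.\<close>

definition tapes :: "(nat \<Rightarrow> bool) set" where "tapes = {\<omega>. \<forall>i\<ge>N. \<not> \<omega> i}"

lemma finite_tapes [simp]: "finite tapes"
proof -
  have "tapes = PiE_dflt {..<N} False (\<lambda>_. UNIV)"
    by (auto simp: tapes_def PiE_dflt_def not_less)
  then show ?thesis by (simp only:) (rule finite_PiE_dflt; simp)
qed

lemma flip_tapes: "\<omega> \<in> tapes \<Longrightarrow> a < N \<Longrightarrow> flip a \<omega> \<in> tapes"
  by (auto simp: tapes_def flip_def)

lemma digits: "a < M \<Longrightarrow> a' < M \<Longrightarrow> b * M + a = b' * M + a' \<longleftrightarrow> b = b' \<and> a = a'" for a b :: nat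
proof
  assume *: "a < M" "a' < M" "b * M + a = b' * M + a'"
  have "b = (b * M + a) div M" "a = (b * M + a) mod M" using *(1) by simp_all
  moreover have "b' = (b' * M + a') div M" "a' = (b' * M + a') mod M" using *(2) by simp_all
  ultimately show "b = b' \<and> a = a'" using *(3) by metis
qed simp

lemma idx_inject:
  "j < M \<Longrightarrow> i < M \<Longrightarrow> c < M \<Longrightarrow> j' < M \<Longrightarrow> i' < M \<Longrightarrow> c' < M \<Longrightarrow>
   idx k j i c = idx k' j' i' c' \<longleftrightarrow> k = k' \<and> j = j' \<and> i = i' \<and> c = c'"
  unfolding idx_def by (simp add: digits)

lemma idx_less_N:
  assumes "k \<le> D" "j < M" "i < M" "c < M"
  shows "idx k j i c < N"
proof -
  have step: "a * M + b < a' * M" if "a < a'" "b < M" for a a' b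
  proof -
    have "a * M + b < (a + 1) * M" using that by simp
    also have "\<dots> \<le> a' * M" using that by (intro mult_le_mono) auto
    finally show ?thesis .
  qed
  have "idx k j i c < Suc D * M * M * M"
    unfolding idx_def using assms by (intro step) auto
  then show ?thesis by (simp only: N_def mult.assoc)
qed

lemma tp_flip:
  "j < M \<Longrightarrow> i < M \<Longrightarrow> c < M \<Longrightarrow> j' < M \<Longrightarrow> i' < M \<Longrightarrow> c' < M \<Longrightarrow>
   tp (flip (idx k j i c) \<omega>) k' j' i' c' = tp \<omega> k' j' i' c' + of_bool (k = k' \<and> j = j' \<and> i = i' \<and> c = c')"
  by (auto simp: tp_def flip_def idx_inject)

lemma hash_flip:
  assumes "j < M" "i < M" "c < M" "\<tau> < M" "q < M"
  shows "hash (flip (idx k j i c) \<omega>) \<tau> q x =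
    hash \<omega> \<tau> q x + of_bool (k = D \<and> j = \<tau> \<and> i = q) * (if c = n then 1 else if c < n then bt x c else 0)"
proof -
  have n: "n < M" using n_M by simp
  let ?e = "of_bool (k = D \<and> j = \<tau> \<and> i = q) :: bit"
  have "hash (flip (idx k j i c) \<omega>) \<tau> q x = tp \<omega> D \<tau> q n + ?e * of_bool (c = n) +
     (\<Sum>v<n. tp \<omega> D \<tau> q v * bt x v + ?e * (if c = v then bt x v else 0))"
    unfolding hash_def using assms n
    by (intro arg_cong2[where f = "(+)"] sum.cong refl) (auto simp: tp_flip distrib_right)
  also have "\<dots> = hash \<omega> \<tau> q x + ?e * (of_bool (c = n) + (\<Sum>v<n. if c = v then bt x v else 0))"
    by (simp add: hash_def sum.distrib sum_distrib_left[symmetric] algebra_simps)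
  also have "(\<Sum>v<n. if c = v then bt x v else 0) = (if c < n then bt x c else 0)" by simp
  finally show ?thesis by (auto split: if_splits)
qed

text \<open>Matrices of level \<open>k\<close> are first applied in passing from level
  \<open>k\<close> to \<open>Suc k\<close>, and hash coefficients lie in block \<open>D\<close>. The
  flipped bits are therefore fresh with respect to the vectors that they compress.\<close>

lemma vec_flip:
  assumes "k' \<le> k" "k < D" "j < M" "i < M" "c < M" "t \<in> params" "\<And>i. i < k' \<Longrightarrow> rep i < M"
  shows "vec (flip (idx k j i c) \<omega>) t k' rep x = vec \<omega> t k' rep x"
  using assms(1,7)
proof (induction k')
  case 0
  obtain \<tau> \<kappa> \<iota> where t: "t = (\<tau>, \<kappa>, \<iota>)" "\<tau> < M" using assms(6) by (auto simp: params_def)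
  have "hash (flip (idx k j i c) \<omega>) \<tau> q x = hash \<omega> \<tau> q x" if "q < n + 1" for q
    using that assms t n_M by (subst hash_flip) auto
  then show ?case by (auto simp: vec0_def t fun_eq_iff)
next
  case (Suc k')
  have "nn (Suc k') + 4 \<le> M" using nn_le[of "Suc k'"] n_M by linarith
  then show ?case using Suc assms(2-5)
    by (auto simp: apply_tape_def fun_eq_iff tp_flip intro!: sum.cong)
qed

text \<open>A failure yields a set of \<open>h\<close> copies, half of the \<open>M\<close> rounded
  up, and for each of them a nonzero vector that it annihilates. There are at most
  \<open>2 ^ M * 2 ^ (nn (Suc k) * h)\<close> such choices, each met by at most one in
  \<open>2 ^ (l * h)\<close> tapes. The four surplus rows in \<open>l\<close> leave the factor
  \<open>2 ^ M / 2 ^ (4 * h)\<close>, which is at most \<open>1 / 2 ^ M\<close>.\<close>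

lemma card_fails_at:
  assumes t: "t \<in> params" and k: "k < D" and rep: "\<And>i. i < k \<Longrightarrow> rep i < M"
  shows "card {\<omega> \<in> tapes. fails_at \<omega> t k rep y} * 2 ^ M \<le> card tapes"
proof -
  define l where "l = nn (Suc k) + 4"
  define h where "h = (M + 1) div 2"
  define Z where "Z = {z. z < 2 ^ n \<and> z mod 2 ^ pp (Suc k) = y}"
  define Js where "Js = {J. J \<subseteq> {..<M} \<and> card J = h}"
  define Ev where "Ev = (\<lambda>(J, xs). {\<omega> \<in> tapes. (\<forall>j\<in>J. F \<omega> t k rep (xs j) = 0) \<and>
     (\<forall>j\<in>J. \<forall>i<l. apply_tape \<omega> k j (vec \<omega> t k rep (xs j)) i = 0)})"
  define I where "I = (SIGMA J:Js. J \<rightarrow>\<^sub>E Z)"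
  have lM: "l \<le> M" using nn_le[of "Suc k"] n_M unfolding l_def by linarith
  have finJ: "finite Js" "\<And>J. J \<in> Js \<Longrightarrow> finite J"
    unfolding Js_def by (auto intro: finite_subset[of _ "Pow {..<M}"] finite_subset[of _ "{..<M}"])
  have finZ: "finite Z" unfolding Z_def by simp
  have finI: "finite I" unfolding I_def using finJ finZ by (auto intro!: finite_SigmaI finite_PiE)
  have cardZ: "card Z \<le> 2 ^ nn (Suc k)"
  proof -
    have "card Z \<le> card {..<(2::nat) ^ nn (Suc k)}"
    proof (rule card_inj_on_le)
      show "inj_on (\<lambda>z. z div 2 ^ pp (Suc k)) Z"
        unfolding inj_on_def Z_def by (metis (mono_tags, lifting) div_mult_mod_eq mem_Collect_eq)
      have "z div 2 ^ pp (Suc k) < 2 ^ nn (Suc k)" if "z < 2 ^ n" for z :: nat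
        using that pp_nn(2)[of "Suc k"]
        by (subst div_less_iff_less_mult) (simp_all add: add.commute flip: power_add)
      then show "(\<lambda>z. z div 2 ^ pp (Suc k)) ` Z \<subseteq> {..<2 ^ nn (Suc k)}" by (auto simp: Z_def)
    qed simp
    then show ?thesis by simp
  qed
  have cardI: "card I \<le> 2 ^ M * 2 ^ (nn (Suc k) * h)"
  proof -
    have fin: "finite (J \<rightarrow>\<^sub>E Z)" if "J \<in> Js" for J
      using finJ(2)[OF that] finZ by (intro finite_PiE) auto
    have card: "card (J \<rightarrow>\<^sub>E Z) = card Z ^ h" if "J \<in> Js" for J
      using finJ(2)[OF that] that by (simp add: card_PiE Js_def)
    have "card I = (\<Sum>J\<in>Js. card (J \<rightarrow>\<^sub>E Z))"
      unfolding I_def using finJ(1) fin by (intro card_SigmaI) auto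
    also have "\<dots> = (\<Sum>J\<in>Js. card Z ^ h)" using card by (rule sum.cong[OF refl])
    finally have "card I = (\<Sum>J\<in>Js. card Z ^ h)" .
    also have "\<dots> = card Js * card Z ^ h" by simp
    also have "\<dots> \<le> 2 ^ M * (2 ^ nn (Suc k)) ^ h"
      using card_mono[of "Pow {..<M}" Js] cardZ
      by (intro mult_le_mono power_mono) (auto simp: Js_def card_Pow)
    finally show ?thesis by (simp add: power_mult)
  qed
  have sub: "{\<omega> \<in> tapes. fails_at \<omega> t k rep y} \<subseteq> (\<Union>e\<in>I. Ev e)"
  proof clarify
    fix \<omega> assume \<omega>: "\<omega> \<in> tapes" and f: "fails_at \<omega> t k rep y"
    then have "h \<le> card {j. j < M \<and> bad \<omega> t k rep y j}" by (simp add: fails_at_def h_def)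
    then obtain J where J: "J \<subseteq> {j. j < M \<and> bad \<omega> t k rep y j}" "card J = h"
      by (meson obtain_subset_with_card_n)
    then have "\<forall>j\<in>J. \<exists>z. z \<in> Z \<and> F \<omega> t k rep z = 0 \<and> (\<forall>i<l. apply_tape \<omega> k j (vec \<omega> t k rep z) i = 0)"
      unfolding bad_def Z_def l_def by blast
    then obtain g where g: "\<And>j. j \<in> J \<Longrightarrow> g j \<in> Z \<and> F \<omega> t k rep (g j) = 0 \<and> (\<forall>i<l. apply_tape \<omega> k j (vec \<omega> t k rep (g j)) i = 0)"
      by metis
    have "(J, restrict g J) \<in> I" using J g by (auto simp: I_def Js_def)
    moreover have "\<omega> \<in> Ev (J, restrict g J)" using g \<omega> by (auto simp: Ev_def)
    ultimately show "\<omega> \<in> (\<Union>e\<in>I. Ev e)" by blast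
  qed
  have ev: "card (Ev e) * 2 ^ (l * h) \<le> card tapes" if e: "e \<in> I" for e
  proof -
    obtain J xs where e': "e = (J, xs)" "J \<in> Js" using e by (auto simp: I_def)
    have JM: "J \<subseteq> {..<M}" "card J = h" using e' by (auto simp: Js_def)
    define A where "A = {\<omega> \<in> tapes. \<forall>j\<in>J. F \<omega> t k rep (xs j) = 0}"
    \<comment> \<open>A pivot: flipping the matrix bit in the column of a nonzero entry toggles the
      product of that row with the vector and leaves the other products alone.\<close>
    define p where "p \<omega> j = (LEAST c. c < M \<and> vec \<omega> t k rep (xs j) c \<noteq> 0)" for \<omega> j
    have p: "p \<omega> j < M \<and> vec \<omega> t k rep (xs j) (p \<omega> j) \<noteq> 0" if "\<omega> \<in> A" "j \<in> J" for \<omega> j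
    proof -
      have "F \<omega> t k rep (xs j) = 0" using that by (simp add: A_def)
      then have "\<exists>c. c < M \<and> vec \<omega> t k rep (xs j) c \<noteq> 0" by (auto simp: F_def)
      then show ?thesis unfolding p_def by (rule LeastI_ex)
    qed
    define f where "f = (\<lambda>(j, i) \<omega>. flip (idx k j i (p \<omega> j)) \<omega>)"
    define v where "v = (\<lambda>(j, i) \<omega>. (\<Sum>c<M. tp \<omega> k j i c * vec \<omega> t k rep (xs j) c) \<noteq> 0)"
    \<comment> \<open>The vectors do not see the flipped bits, so the pivots stay where they are and
      \<open>f\<close> is an involution.\<close>
    have vf: "vec (f q \<omega>) t k rep x = vec \<omega> t k rep x" if "q \<in> J \<times> {..<l}" "\<omega> \<in> A" for q \<omega> x
    proof -
      obtain j i where q: "q = (j, i)" "j \<in> J" "i < l" using \<open>q \<in> _\<close> by auto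
      then show ?thesis using p[OF that(2) q(2)] JM lM k t rep
        unfolding f_def q by (auto intro!: vec_flip)
    qed
    have pf: "p (f q \<omega>) j' = p \<omega> j'" if "q \<in> J \<times> {..<l}" "\<omega> \<in> A" for q \<omega> j'
      unfolding p_def by (simp only: vf[OF that])
    have vflip: "v (j', i') (f (j, i) \<omega>) = (v (j', i') \<omega> \<noteq> ((j', i') = (j, i)))"
      if q: "(j, i) \<in> J \<times> {..<l}" "(j', i') \<in> J \<times> {..<l}" "\<omega> \<in> A" for j i j' i' \<omega>
    proof -
      have lt: "j < M" "i < M" "j' < M" "i' < M" "p \<omega> j < M" using q JM lM p[of \<omega> j] by auto
      have "(\<Sum>c<M. tp (f (j, i) \<omega>) k j' i' c * vec (f (j, i) \<omega>) t k rep (xs j') c)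
        = (\<Sum>c<M. tp \<omega> k j' i' c * vec \<omega> t k rep (xs j') c + (if c = p \<omega> j then of_bool (j = j' \<and> i = i') * vec \<omega> t k rep (xs j') c else 0))"
        unfolding vf[OF q(1,3)] unfolding f_def prod.case
        using lt by (intro sum.cong refl) (auto simp: tp_flip distrib_right)
      also have "\<dots> = (\<Sum>c<M. tp \<omega> k j' i' c * vec \<omega> t k rep (xs j') c) + of_bool (j = j' \<and> i = i') * vec \<omega> t k rep (xs j') (p \<omega> j)"
        using lt by (simp add: sum.distrib)
      finally show ?thesis
        using p[OF q(3), of j] q unfolding v_def prod.case
        by (cases "\<Sum>c<M. tp \<omega> k j' i' c * vec \<omega> t k rep (xs j') c") auto
    qed
    have "card {\<omega> \<in> A. \<forall>q\<in>J \<times> {..<l}. \<not> v q \<omega>} * 2 ^ card (J \<times> {..<l}) = card A"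
    proof (rule card_constraints[where f = f])
      show "finite (J \<times> {..<l})" using finJ e' by simp
      show "finite A" by (simp add: A_def)
      fix q \<omega> assume q: "q \<in> J \<times> {..<l}" and \<omega>: "\<omega> \<in> A"
      obtain j i where ji: "q = (j, i)" "j \<in> J" "i < l" using q by auto
      have "f q \<omega> \<in> tapes" using \<omega> ji JM lM p[OF \<omega> ji(2)] k
        by (auto simp: f_def A_def intro!: flip_tapes idx_less_N)
      then have 1: "f q \<omega> \<in> A" using \<omega> vf[OF q \<omega>] by (simp add: A_def F_def)
      have 2: "f q (f q \<omega>) = \<omega>" using pf[OF q \<omega>, of j] by (simp add: f_def ji)
      have 3: "v q (f q \<omega>) = (\<not> v q \<omega>)" using vflip[of j i j i \<omega>] q \<omega> ji by simp
      show "f q \<omega> \<in> A \<and> f q (f q \<omega>) = \<omega> \<and> v q (f q \<omega>) = (\<not> v q \<omega>)" using 1 2 3 by blast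
    next
      fix q q' \<omega> assume "q \<in> J \<times> {..<l}" "q' \<in> J \<times> {..<l}" "q' \<noteq> q" "\<omega> \<in> A"
      then show "v q' (f q \<omega>) = v q' \<omega>" using vflip by (cases q; cases q') blast
    qed
    moreover have "Ev e = {\<omega> \<in> A. \<forall>q\<in>J \<times> {..<l}. \<not> v q \<omega>}"
      by (auto simp: Ev_def e' A_def v_def apply_tape_def l_def)
    moreover have "card A \<le> card tapes" unfolding A_def by (intro card_mono) auto
    moreover have "card (J \<times> {..<l}) = l * h" using JM(2) by (simp add: card_cartesian_product mult.commute)
    ultimately show ?thesis by (simp only:)
  qed
  have "card {\<omega> \<in> tapes. fails_at \<omega> t k rep y} \<le> (\<Sum>e\<in>I. card (Ev e))"
  proof -
    have "card {\<omega> \<in> tapes. fails_at \<omega> t k rep y} \<le> card (\<Union>e\<in>I. Ev e)"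
      using sub finI by (intro card_mono) (auto simp: Ev_def)
    also have "\<dots> \<le> (\<Sum>e\<in>I. card (Ev e))" by (rule card_UN_le[OF finI])
    finally show ?thesis .
  qed
  then have "card {\<omega> \<in> tapes. fails_at \<omega> t k rep y} * 2 ^ (l * h) \<le> (\<Sum>e\<in>I. card (Ev e) * 2 ^ (l * h))"
    by (simp add: sum_distrib_right[symmetric])
  also have "\<dots> \<le> (\<Sum>e\<in>I. card tapes)" using ev by (rule sum_mono)
  also have "\<dots> \<le> 2 ^ M * 2 ^ (nn (Suc k) * h) * card tapes" using cardI by simp
  finally have "card {\<omega> \<in> tapes. fails_at \<omega> t k rep y} * (2 ^ (nn (Suc k) * h) * 2 ^ (4 * h)) \<le> 2 ^ M * 2 ^ (nn (Suc k) * h) * card tapes"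
    by (simp add: l_def algebra_simps power_add)
  then have "2 ^ (nn (Suc k) * h) * (card {\<omega> \<in> tapes. fails_at \<omega> t k rep y} * 2 ^ (4 * h)) \<le> 2 ^ (nn (Suc k) * h) * (2 ^ M * card tapes)"
    by (simp only: mult_ac)
  then have 1: "card {\<omega> \<in> tapes. fails_at \<omega> t k rep y} * 2 ^ (4 * h) \<le> 2 ^ M * card tapes"
    by (rule mult_left_le_imp_le) simp
  have "M + M \<le> 4 * h" by (simp add: h_def)
  then have "(2::nat) ^ (M + M) \<le> 2 ^ (4 * h)" by (intro power_increasing) auto
  then have "card {\<omega> \<in> tapes. fails_at \<omega> t k rep y} * 2 ^ (M + M) \<le> 2 ^ M * card tapes"
    using 1 by (meson le_trans mult_le_mono2)
  then have "2 ^ M * (card {\<omega> \<in> tapes. fails_at \<omega> t k rep y} * 2 ^ M) \<le> 2 ^ M * card tapes"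
    by (simp add: power_add mult_ac)
  then show ?thesis by (rule mult_left_le_imp_le) simp
qed

text \<open>The union ranges over trial, number of hash equations, inspected variable, level, the
  choices of copies above it, at most \<open>M ^ D\<close>, and at most \<open>2 ^ n\<close>
  prefixes.\<close>

lemma card_not_good:
  "card {\<omega> \<in> tapes. \<not> good_tape \<omega>} * 2 ^ M \<le> (M * (n + 2) * n) * D * M ^ D * 2 ^ n * card tapes"
proof -
  define I where "I = params \<times> (SIGMA k:{..<D}. ({..<k} \<rightarrow>\<^sub>E {..<M}) \<times> {..<(2::nat) ^ n})"
  define Ev where "Ev = (\<lambda>(t, k, rep, y). {\<omega> \<in> tapes. fails_at \<omega> t k rep y})"
  have finI: "finite I" by (auto simp: I_def params_def intro!: finite_SigmaI finite_PiE)
  have M1: "1 \<le> M" using n_M by simp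
  have "card (SIGMA k:{..<D}. ({..<k} \<rightarrow>\<^sub>E {..<M}) \<times> {..<(2::nat) ^ n}) = (\<Sum>k<D. M ^ k * 2 ^ n)"
    by (subst card_SigmaI) (auto intro!: finite_PiE sum.cong simp: card_cartesian_product card_PiE)
  also have "\<dots> \<le> (\<Sum>k<D. M ^ D * 2 ^ n)"
    using M1 by (intro sum_mono mult_le_mono power_increasing) auto
  also have "\<dots> = D * (M ^ D * 2 ^ n)" by simp
  finally have "card params * card (SIGMA k:{..<D}. ({..<k} \<rightarrow>\<^sub>E {..<M}) \<times> {..<(2::nat) ^ n}) \<le> card params * (D * (M ^ D * 2 ^ n))"
    by (rule mult_le_mono2)
  moreover have "card params = M * (n + 2) * n" by (simp only: params_def card_cartesian_product card_lessThan mult.assoc)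
  ultimately have "card I \<le> (M * (n + 2) * n) * (D * (M ^ D * 2 ^ n))"
    unfolding I_def card_cartesian_product by (simp only:)
  then have cardI: "card I \<le> (M * (n + 2) * n) * D * M ^ D * 2 ^ n" by (simp only: mult.assoc)
  have sub: "{\<omega> \<in> tapes. \<not> good_tape \<omega>} \<subseteq> (\<Union>e\<in>I. Ev e)"
  proof clarify
    fix \<omega> assume \<omega>: "\<omega> \<in> tapes" and "\<not> good_tape \<omega>"
    then obtain t k rep y where *: "t \<in> params" "k < D" "\<forall>i<k. rep i < M" "y < 2 ^ pp (Suc k)" "fails_at \<omega> t k rep y"
      unfolding good_tape_def by blast
    \<comment> \<open>The event reads \<open>rep\<close> only below \<open>k\<close>; restricting it
      leaves finitely many choices.\<close>
    let ?rep = "restrict rep {..<k}"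
    have v: "vec \<omega> t k ?rep = vec \<omega> t k rep" by (rule ext, rule vec_cong) simp
    have "fails_at \<omega> t k ?rep y" using *(5) by (simp add: fails_at_def bad_def F_def v)
    moreover have "y < 2 ^ n" using *(4) by (rule less_le_trans) (simp add: pp_le)
    ultimately show "\<omega> \<in> (\<Union>e\<in>I. Ev e)" using * \<omega>
      by (intro UN_I[of "(t, k, ?rep, y)"]) (auto simp: I_def Ev_def)
  qed
  have "card {\<omega> \<in> tapes. \<not> good_tape \<omega>} \<le> card (\<Union>e\<in>I. Ev e)"
    using sub finI by (intro card_mono) (auto simp: Ev_def)
  also have "\<dots> \<le> (\<Sum>e\<in>I. card (Ev e))" by (rule card_UN_le[OF finI])
  finally have "card {\<omega> \<in> tapes. \<not> good_tape \<omega>} * 2 ^ M \<le> (\<Sum>e\<in>I. card (Ev e) * 2 ^ M)"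
    by (simp add: sum_distrib_right[symmetric])
  also have "\<dots> \<le> (\<Sum>e\<in>I. card tapes)"
  proof (rule sum_mono)
    fix e assume "e \<in> I"
    then obtain t k rep y where "e = (t, k, rep, y)" "t \<in> params" "k < D" "\<And>i. i < k \<Longrightarrow> rep i < M"
      by (auto simp: I_def PiE_def Pi_def)
    then show "card (Ev e) * 2 ^ M \<le> card tapes" by (auto simp: Ev_def intro!: card_fails_at)
  qed
  also have "\<dots> \<le> (M * (n + 2) * n) * D * M ^ D * 2 ^ n * card tapes"
    using cardI by simp
  finally show ?thesis .
qed

end

section \<open>Isolating a solution by random affine equations\<close>

lemma real_eq_divide_power: "a * 2 ^ k = b \<Longrightarrow> real a = real b / 2 ^ k"
  by auto

context instance_context
begin

definition block :: "nat \<Rightarrow> nat \<Rightarrow> nat \<Rightarrow> nat" where "block \<tau> q c = idx D \<tau> q c"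

lemma hash_block:
  assumes "\<tau> < M" "\<tau>' < M" "q < n + 1" "q' < n + 1" "c \<le> n"
  shows "hash (flip (block \<tau> q c) \<omega>) \<tau>' q' x =
    hash \<omega> \<tau>' q' x + of_bool (\<tau> = \<tau>' \<and> q = q') * (if c = n then 1 else bt x c)"
  using assms n_M unfolding block_def by (subst hash_flip) auto

text \<open>Flipping the constant term of an equation toggles its value. Here \<open>A\<close> is
  any set closed under flips in the block of trial \<open>\<tau>\<close>, so that the outcomes of
  other trials can be conditioned on.\<close>

lemma card_survive:
  assumes A: "finite A" "\<And>\<omega> q c. \<omega> \<in> A \<Longrightarrow> q < n + 1 \<Longrightarrow> c \<le> n \<Longrightarrow> flip (block \<tau> q c) \<omega> \<in> A"
    and "\<tau> < M" "\<kappa> \<le> n + 1"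
  shows "card {\<omega> \<in> A. \<forall>q<\<kappa>. hash \<omega> \<tau> q z = 0} * 2 ^ \<kappa> = card A"
proof -
  have "card {\<omega> \<in> A. \<forall>q\<in>{..<\<kappa>}. \<not> hash \<omega> \<tau> q z \<noteq> 0} * 2 ^ card {..<\<kappa>} = card A"
  proof (rule card_constraints[where f = "\<lambda>q. flip (block \<tau> q n)"])
    fix q \<omega> assume "q \<in> {..<\<kappa>}" "\<omega> \<in> A"
    then show "flip (block \<tau> q n) \<omega> \<in> A \<and> flip (block \<tau> q n) (flip (block \<tau> q n) \<omega>) = \<omega> \<and>
      (hash (flip (block \<tau> q n) \<omega>) \<tau> q z \<noteq> 0) = (\<not> hash \<omega> \<tau> q z \<noteq> 0)"
      using assms by (cases "hash \<omega> \<tau> q z") (auto simp: hash_block)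
  qed (use assms in \<open>auto simp: hash_block\<close>)
  then show ?thesis by (simp add: Ball_def)
qed

text \<open>Two distinct points differ in some coordinate \<open>c\<close>. The constant term
  toggles the value at the point where \<open>c\<close> is 0 but not the sum of both values; the
  coefficient of \<open>c\<close> does the opposite. Hence both values behave like independent
  coins.\<close>

lemma card_survive_pair:
  assumes A: "finite A" "\<And>\<omega> q c. \<omega> \<in> A \<Longrightarrow> q < n + 1 \<Longrightarrow> c \<le> n \<Longrightarrow> flip (block \<tau> q c) \<omega> \<in> A"
    and "\<tau> < M" "\<kappa> \<le> n + 1" and z: "z < 2 ^ n" "z' < 2 ^ n" "z \<noteq> z'"
  shows "card {\<omega> \<in> A. \<forall>q<\<kappa>. hash \<omega> \<tau> q z = 0 \<and> hash \<omega> \<tau> q z' = 0} * 2 ^ (2 * \<kappa>) = card A"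
proof -
  have main: "card {\<omega> \<in> A. \<forall>q<\<kappa>. hash \<omega> \<tau> q x = 0 \<and> hash \<omega> \<tau> q y = 0} * 2 ^ (2 * \<kappa>) = card A"
    if c: "c < n" "bt x c = 0" "bt y c = 1" for x y c
  proof -
    define v where "v = (\<lambda>(q, b) \<omega>. if b then hash \<omega> \<tau> q x + hash \<omega> \<tau> q y \<noteq> 0 else hash \<omega> \<tau> q x \<noteq> 0)"
    define f where "f = (\<lambda>(q, b). flip (block \<tau> q (if b then c else n)))"
    have "card {\<omega> \<in> A. \<forall>q\<in>{..<\<kappa>} \<times> (UNIV :: bool set). \<not> v q \<omega>} * 2 ^ card ({..<\<kappa>} \<times> (UNIV :: bool set)) = card A"
    proof (rule card_constraints[where f = f])
      fix q \<omega> assume q: "q \<in> {..<\<kappa>} \<times> (UNIV :: bool set)" "\<omega> \<in> A"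
      obtain p b where p: "q = (p, b)" "p < \<kappa>" using q by auto
      show "f q \<omega> \<in> A \<and> f q (f q \<omega>) = \<omega> \<and> v q (f q \<omega>) = (\<not> v q \<omega>)"
        using q(2) p c assms(3,4) A(2)[of \<omega> p "if b then c else n"]
        by (cases b; cases "hash \<omega> \<tau> p x"; cases "hash \<omega> \<tau> p y") (auto simp: f_def v_def hash_block)
    next
      fix q q' \<omega> assume q: "q \<in> {..<\<kappa>} \<times> (UNIV :: bool set)" "q' \<in> {..<\<kappa>} \<times> (UNIV :: bool set)" "q' \<noteq> q" "\<omega> \<in> A"
      obtain p b p' b' where p: "q = (p, b)" "p < \<kappa>" "q' = (p', b')" "p' < \<kappa>" using q by auto
      show "v q' (f q \<omega>) = v q' \<omega>"
        using q(3) p c assms(3,4)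
        by (cases b; cases b'; cases "hash \<omega> \<tau> p' x"; cases "hash \<omega> \<tau> p' y") (auto simp: f_def v_def hash_block)
    qed (use assms in auto)
    moreover have "{\<omega> \<in> A. \<forall>q\<in>{..<\<kappa>} \<times> (UNIV :: bool set). \<not> v q \<omega>} = {\<omega> \<in> A. \<forall>q<\<kappa>. hash \<omega> \<tau> q x = 0 \<and> hash \<omega> \<tau> q y = 0}"
    proof -
      have "(\<forall>q\<in>{..<\<kappa>} \<times> (UNIV :: bool set). \<not> v q \<omega>) \<longleftrightarrow> (\<forall>q<\<kappa>. \<not> v (q, False) \<omega> \<and> \<not> v (q, True) \<omega>)" for \<omega>
        by (auto simp: all_bool_eq)
      then show ?thesis by (auto simp: v_def)
    qed
    ultimately show ?thesis by (simp add: card_cartesian_product mult.commute)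
  qed
  have "set_decode z \<noteq> set_decode z'" using z(3) by (simp add: set_decode_eq_iff)
  moreover have "set_decode z \<subseteq> {..<n}" "set_decode z' \<subseteq> {..<n}" using z by (simp_all add: less_power_iff_set_decode)
  ultimately obtain c where c: "c < n" "c \<in> set_decode z \<longleftrightarrow> c \<notin> set_decode z'" by blast
  show ?thesis
  proof (cases "c \<in> set_decode z")
    case True
    then show ?thesis using main[of c z' z] c by (simp add: bt_def conj_commute)
  next
    case False
    then show ?thesis using main[of c z z'] c by (simp add: bt_def)
  qed
qed

text \<open>Valiant--Vazirani: the number \<open>s\<close> of survivors satisfies \<open>[s = 1] \<ge> s - s (s - 1)\<close>.\<close>

lemma card_isolated:
  assumes A: "finite A" "\<And>\<omega> q c. \<omega> \<in> A \<Longrightarrow> q < n + 1 \<Longrightarrow> c \<le> n \<Longrightarrow> flip (block \<tau> q c) \<omega> \<in> A"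
    and "\<tau> < M" "\<kappa> \<le> n + 1" and S: "2 * card {z. is_sol z} \<le> 2 ^ \<kappa>" "2 ^ \<kappa> \<le> 4 * card {z. is_sol z}"
  shows "3 * real (card A) \<le> 16 * real (card {\<omega> \<in> A. isolated \<omega> \<tau> \<kappa>})"
proof -
  let ?S = "{z. is_sol z}"
  define e where "e z \<omega> = (\<forall>q<\<kappa>. hash \<omega> \<tau> q z = 0)" for z \<omega>
  define s where "s \<omega> = card {z \<in> ?S. e z \<omega>}" for \<omega>
  have finS: "finite ?S" by (rule finite_subset[of _ "{..<2 ^ n}"]) (auto simp: is_sol_def)
  have iso: "isolated \<omega> \<tau> \<kappa> \<longleftrightarrow> s \<omega> = 1" for \<omega>
    unfolding isolated_def s_def e_def by (auto simp: card_1_singleton_iff Ex1_def set_eq_iff)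
  have point: "real (s \<omega>) - real (s \<omega>) * (real (s \<omega>) - 1) \<le> of_bool (isolated \<omega> \<tau> \<kappa>)" for \<omega>
  proof -
    have "x * (2 - x) \<le> of_bool (x = 1)" if "x = 0 \<or> x = 1 \<or> x \<ge> 2" for x :: real
      using that by (auto simp: mult_nonneg_nonpos)
    moreover have "s \<omega> = 0 \<or> s \<omega> = 1 \<or> s \<omega> \<ge> 2" by linarith
    then have "real (s \<omega>) = 0 \<or> real (s \<omega>) = 1 \<or> real (s \<omega>) \<ge> 2" by auto
    moreover have "real (s \<omega>) - real (s \<omega>) * (real (s \<omega>) - 1) = real (s \<omega>) * (2 - real (s \<omega>))" by (simp add: algebra_simps)
    ultimately show ?thesis unfolding iso by (simp only: of_nat_eq_1_iff[symmetric, where 'a = real])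
  qed
  define r where "r = real (card ?S) / 2 ^ \<kappa>"
  have single: "real (card {\<omega> \<in> A. e z \<omega>}) = real (card A) / 2 ^ \<kappa>" for z
  proof -
    have "card {\<omega> \<in> A. e z \<omega>} * 2 ^ \<kappa> = card A" unfolding e_def by (rule card_survive) (use assms in auto)
    then show ?thesis by (rule real_eq_divide_power)
  qed
  have pair: "real (card {\<omega> \<in> A. e z \<omega> \<and> e z' \<omega>}) = real (card A) / 2 ^ (2 * \<kappa>)"
    if "is_sol z" "is_sol z'" "z \<noteq> z'" for z z'
  proof -
    have "card {\<omega> \<in> A. \<forall>q<\<kappa>. hash \<omega> \<tau> q z = 0 \<and> hash \<omega> \<tau> q z' = 0} * 2 ^ (2 * \<kappa>) = card A"
      by (rule card_survive_pair) (use assms that in \<open>auto simp: is_sol_def\<close>)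
    moreover have "{\<omega> \<in> A. \<forall>q<\<kappa>. hash \<omega> \<tau> q z = 0 \<and> hash \<omega> \<tau> q z' = 0} = {\<omega> \<in> A. e z \<omega> \<and> e z' \<omega>}"
      unfolding e_def by auto
    ultimately have "card {\<omega> \<in> A. e z \<omega> \<and> e z' \<omega>} * 2 ^ (2 * \<kappa>) = card A" by (simp only:)
    then show ?thesis by (rule real_eq_divide_power)
  qed
  have s_eq: "real (s \<omega>) = (\<Sum>z\<in>?S. of_bool (e z \<omega>))" for \<omega>
    using finS by (simp add: s_def Int_def)
  have cnt: "(\<Sum>\<omega>\<in>A. of_bool (P \<omega>)) = real (card {\<omega> \<in> A. P \<omega>})" for P
    using A(1) by (simp add: Int_def)
  have sum1: "(\<Sum>\<omega>\<in>A. real (s \<omega>)) = r * real (card A)"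
  proof -
    have "(\<Sum>\<omega>\<in>A. real (s \<omega>)) = (\<Sum>z\<in>?S. \<Sum>\<omega>\<in>A. of_bool (e z \<omega>))"
      unfolding s_eq by (rule sum.swap)
    then show ?thesis unfolding cnt single by (simp add: r_def)
  qed
  have sum2: "(\<Sum>\<omega>\<in>A. real (s \<omega>) * (real (s \<omega>) - 1)) \<le> r ^ 2 * real (card A)"
  proof -
    have sq: "real (s \<omega>) * (real (s \<omega>) - 1) = (\<Sum>z\<in>?S. \<Sum>z'\<in>?S - {z}. of_bool (e z \<omega> \<and> e z' \<omega>))" for \<omega>
    proof -
      have "(\<Sum>z'\<in>?S - {z}. of_bool (e z \<omega> \<and> e z' \<omega>)) = of_bool (e z \<omega>) * (real (s \<omega>) - 1)" if "z \<in> ?S" for z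
      proof (cases "e z \<omega>")
        case True
        have "real (s \<omega>) = of_bool (e z \<omega>) + (\<Sum>z'\<in>?S - {z}. of_bool (e z' \<omega>))"
          unfolding s_eq by (rule sum.remove[OF finS that])
        then show ?thesis using True by simp
      qed simp
      then have "(\<Sum>z\<in>?S. \<Sum>z'\<in>?S - {z}. of_bool (e z \<omega> \<and> e z' \<omega>)) = (\<Sum>z\<in>?S. of_bool (e z \<omega>) * (real (s \<omega>) - 1))"
        by (intro sum.cong refl) auto
      then show ?thesis by (simp add: s_eq sum_distrib_right)
    qed
    have "(\<Sum>\<omega>\<in>A. real (s \<omega>) * (real (s \<omega>) - 1)) = (\<Sum>z\<in>?S. \<Sum>z'\<in>?S - {z}. \<Sum>\<omega>\<in>A. of_bool (e z \<omega> \<and> e z' \<omega>))"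
      unfolding sq by (subst sum.swap, intro sum.cong refl, rule sum.swap)
    also have "\<dots> = (\<Sum>z\<in>?S. \<Sum>z'\<in>?S - {z}. real (card A) / 2 ^ (2 * \<kappa>))"
      unfolding cnt using pair by (intro sum.cong refl) auto
    also have "\<dots> \<le> (\<Sum>z\<in>?S. \<Sum>z'\<in>?S. real (card A) / 2 ^ (2 * \<kappa>))"
      using finS by (intro sum_mono sum_mono2) auto
    also have "\<dots> = r ^ 2 * real (card A)"
      by (simp add: r_def power2_eq_square power_mult power_divide) (simp add: power_mult_distrib[symmetric] power2_eq_square mult.commute power_mult)
    finally show ?thesis .
  qed
  have r: "1 / 4 \<le> r" "r \<le> 1 / 2"
  proof -
    have "real (2 * card ?S) \<le> real (2 ^ \<kappa>)" using S(1) by (simp only: of_nat_le_iff)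
    moreover have "real (2 ^ \<kappa>) \<le> real (4 * card ?S)" using S(2) by (simp only: of_nat_le_iff)
    ultimately show "1 / 4 \<le> r" "r \<le> 1 / 2" by (simp_all add: r_def field_simps)
  qed
  \<comment> \<open>The factors are the two roots of \<open>r - r ^ 2 = 3 / 16\<close>; between
    them, in particular for \<open>r\<close> from 1/4 to 1/2, this function is at least
    3/16.\<close>
  have "0 \<le> (r - 1 / 4) * (3 / 4 - r)" using r by (intro mult_nonneg_nonneg) auto
  moreover have "(r - 1 / 4) * (3 / 4 - r) = r - r ^ 2 - 3 / 16" by (simp add: power2_eq_square field_simps)
  ultimately have "3 / 16 \<le> r - r ^ 2" by linarith
  then have "3 / 16 * real (card A) \<le> (r - r ^ 2) * real (card A)" by (intro mult_right_mono) auto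
  also have "\<dots> \<le> (\<Sum>\<omega>\<in>A. real (s \<omega>)) - (\<Sum>\<omega>\<in>A. real (s \<omega>) * (real (s \<omega>) - 1))"
    using sum1 sum2 by (simp add: left_diff_distrib)
  also have "\<dots> = (\<Sum>\<omega>\<in>A. real (s \<omega>) - real (s \<omega>) * (real (s \<omega>) - 1))" by (simp add: sum_subtractf)
  also have "\<dots> \<le> (\<Sum>\<omega>\<in>A. of_bool (isolated \<omega> \<tau> \<kappa>))" by (intro sum_mono point)
  also have "\<dots> = real (card {\<omega> \<in> A. isolated \<omega> \<tau> \<kappa>})" by (rule cnt)
  finally show ?thesis by simp
qed

text \<open>Trials use disjoint blocks of the tape, so a condition on earlier trials is invariant
  under flips in the next block. Each trial then isolates a solution on at least 3/16 of the
  remaining tapes.\<close>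

lemma card_never_isolated:
  assumes "\<kappa> \<le> n + 1" "2 * card {z. is_sol z} \<le> 2 ^ \<kappa>" "2 ^ \<kappa> \<le> 4 * card {z. is_sol z}"
  shows "r \<le> M \<Longrightarrow> real (card {\<omega> \<in> tapes. \<forall>\<tau><r. \<not> isolated \<omega> \<tau> \<kappa>}) \<le> (13 / 16) ^ r * real (card tapes)"
proof (induction r)
  case (Suc r)
  let ?A = "{\<omega> \<in> tapes. \<forall>\<tau><r. \<not> isolated \<omega> \<tau> \<kappa>}"
  let ?B = "{\<omega> \<in> ?A. isolated \<omega> r \<kappa>}"
  have fin: "finite ?A" by simp
  have "3 * real (card ?A) \<le> 16 * real (card ?B)"
  proof (rule card_isolated[OF fin])
    fix \<omega> q c assume \<omega>: "\<omega> \<in> ?A" and q: "q < n + 1" "c \<le> n"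
    have "flip (block r q c) \<omega> \<in> tapes"
      unfolding block_def using \<omega> q Suc.prems n_M by (intro flip_tapes idx_less_N) auto
    moreover have "isolated (flip (block r q c) \<omega>) \<tau> \<kappa> \<longleftrightarrow> isolated \<omega> \<tau> \<kappa>" if "\<tau> < r" for \<tau>
    proof -
      have "hash (flip (block r q c) \<omega>) \<tau> q' z = hash \<omega> \<tau> q' z" if "q' < \<kappa>" for q' z
        using that \<open>\<tau> < r\<close> q Suc.prems assms(1) by (subst hash_block) auto
      then show ?thesis unfolding isolated_def by auto
    qed
    ultimately show "flip (block r q c) \<omega> \<in> ?A" using \<omega> by auto
  qed (use assms Suc.prems in auto)
  moreover have "{\<omega> \<in> tapes. \<forall>\<tau><Suc r. \<not> isolated \<omega> \<tau> \<kappa>} = ?A - ?B" by (auto simp: less_Suc_eq)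
  moreover have "card (?A - ?B) = card ?A - card ?B" by (intro card_Diff_subset) auto
  moreover have "card ?B \<le> card ?A" by (intro card_mono) auto
  ultimately have "real (card {\<omega> \<in> tapes. \<forall>\<tau><Suc r. \<not> isolated \<omega> \<tau> \<kappa>}) \<le> 13 / 16 * real (card ?A)"
    by (simp add: of_nat_diff)
  then show ?case using Suc by simp
qed simp

text \<open>
  The first summand accounts for no trial isolating a solution, the second one, by a union bound
  over all votes, for a wrong majority.
\<close>

definition err :: real where
  "err = (13 / 16) ^ M + real ((M * (n + 2) * n) * D * M ^ D * 2 ^ n) / 2 ^ M"

definition success :: "(nat \<Rightarrow> bool) \<Rightarrow> bool" where
  "success \<omega> \<longleftrightarrow> ((\<exists>z. is_sol z) \<longrightarrow> (\<exists>(\<tau>, \<kappa>)\<in>trials. is_sol (cand \<omega> \<tau> \<kappa>)))"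

lemma card_failure: "real (card {\<omega> \<in> tapes. \<not> success \<omega>}) \<le> err * real (card tapes)"
proof (cases "\<exists>z. is_sol z")
  case False
  moreover have "0 \<le> err * real (card tapes)" unfolding err_def by (intro mult_nonneg_nonneg add_nonneg_nonneg) auto
  ultimately show ?thesis by (simp add: success_def)
next
  case True
  let ?s = "card {z. is_sol z}"
  have finS: "finite {z. is_sol z}" by (rule finite_subset[of _ "{..<2 ^ n}"]) (auto simp: is_sol_def)
  have s1: "1 \<le> ?s" using True finS by (simp add: Suc_le_eq card_gt_0_iff)
  have "?s \<le> card {..<(2::nat) ^ n}" by (intro card_mono) (auto simp: is_sol_def)
  then have sn: "2 * ?s \<le> 2 ^ (n + 1)" by simp
  \<comment> \<open>Minimality provides the upper bound on \<open>2 ^ \<kappa>\<close>, which brings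
    the expected number of survivors between 1/4 and 1/2.\<close>
  define \<kappa> where "\<kappa> = (LEAST k. 2 * ?s \<le> 2 ^ k)"
  have k1: "2 * ?s \<le> 2 ^ \<kappa>" unfolding \<kappa>_def using sn by (rule LeastI)
  have kn: "\<kappa> \<le> n + 1" unfolding \<kappa>_def using sn by (rule Least_le)
  have k2: "2 ^ \<kappa> \<le> 4 * ?s"
  proof (cases \<kappa>)
    case 0
    then show ?thesis using s1 by simp
  next
    case (Suc k')
    then have "\<not> 2 * ?s \<le> 2 ^ k'" unfolding \<kappa>_def using not_less_Least by (metis lessI)
    then show ?thesis using Suc by simp
  qed
  have sub: "{\<omega> \<in> tapes. \<not> success \<omega>} \<subseteq> {\<omega> \<in> tapes. \<forall>\<tau><M. \<not> isolated \<omega> \<tau> \<kappa>} \<union> {\<omega> \<in> tapes. \<not> good_tape \<omega>}"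
  proof -
    have "success \<omega>" if "good_tape \<omega>" "\<tau> < M" "isolated \<omega> \<tau> \<kappa>" for \<omega> \<tau>
    proof -
      have "(\<tau>, \<kappa>) \<in> trials" using that(2) kn by (simp add: trials_def)
      then show ?thesis using cand_isolated[OF that(1,2) kn that(3)] unfolding success_def by blast
    qed
    then show ?thesis by blast
  qed
  have "card {\<omega> \<in> tapes. \<not> good_tape \<omega>} * 2 ^ M \<le> ((M * (n + 2) * n) * D * M ^ D * 2 ^ n) * card tapes"
    by (rule card_not_good)
  then have "real (card {\<omega> \<in> tapes. \<not> good_tape \<omega>} * 2 ^ M) \<le> real (((M * (n + 2) * n) * D * M ^ D * 2 ^ n) * card tapes)"
    by (simp only: of_nat_le_iff)
  then have g: "real (card {\<omega> \<in> tapes. \<not> good_tape \<omega>}) \<le> real ((M * (n + 2) * n) * D * M ^ D * 2 ^ n) / 2 ^ M * real (card tapes)"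
    by (simp only: of_nat_mult of_nat_power of_nat_numeral) (simp add: field_simps)
  have "card {\<omega> \<in> tapes. \<not> success \<omega>} \<le> card ({\<omega> \<in> tapes. \<forall>\<tau><M. \<not> isolated \<omega> \<tau> \<kappa>} \<union> {\<omega> \<in> tapes. \<not> good_tape \<omega>})"
    using sub by (intro card_mono) auto
  also have "\<dots> \<le> card {\<omega> \<in> tapes. \<forall>\<tau><M. \<not> isolated \<omega> \<tau> \<kappa>} + card {\<omega> \<in> tapes. \<not> good_tape \<omega>}"
    by (rule card_Un_le)
  finally have "real (card {\<omega> \<in> tapes. \<not> success \<omega>}) \<le> real (card {\<omega> \<in> tapes. \<forall>\<tau><M. \<not> isolated \<omega> \<tau> \<kappa>}) + real (card {\<omega> \<in> tapes. \<not> good_tape \<omega>})"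
    by linarith
  also have "\<dots> \<le> (13 / 16) ^ M * real (card tapes) + real ((M * (n + 2) * n) * D * M ^ D * 2 ^ n) / 2 ^ M * real (card tapes)"
    by (intro add_mono g card_never_isolated[OF kn k1 k2]) simp
  finally show ?thesis by (simp only: err_def distrib_right)
qed

end

section \<open>Distribution of the runs\<close>

context instance_context
begin

lemma solver_eq: "solver = Seq fill_tape main"
  by (simp add: solver_def main_def)

lemma input_le: "x \<in> set (encode_system n E) \<Longrightarrow> x \<le> M"
proof -
  assume "x \<in> set (encode_system n E)"
  then consider "x = n" | "x = m" | P where "P \<in> set E" "x = length P"
    | P u where "P \<in> set E" "u \<in> set P" "x = length u" | P u where "P \<in> set E" "u \<in> set P" "x \<in> set u"
    by (auto simp: encode_system_def encode_anf_def encode_monomial_def m_def)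
  then show ?thesis
  proof cases
    case 3
    then show ?thesis using in_E(3) by (simp add: M_def trans_le_add2)
  next
    case 4
    then show ?thesis using in_anf(3) n_M by fastforce
  next
    case 5
    then show ?thesis using in_anf(1) n_M by fastforce
  qed (use n_M m_M in auto)
qed

lemma inp_less_B: "inp a < 2 ^ B"
proof (rule B_less)
  show "inp a \<le> M + 4"
    using input_le[of "encode_system n E ! a"] by (auto simp: inp_def input_memory_def intro: le_trans)
qed

lemma conc_less_B: "(\<And>r i. \<sigma> r i < 2 ^ B) \<Longrightarrow> conc b0 K inp \<sigma> a < 2 ^ B"
  using inp_less_B by (simp add: conc_def)

definition tape_rows :: "(nat \<Rightarrow> bool) \<Rightarrow> nat \<Rightarrow> rows" where
  "tape_rows \<omega> j = (\<lambda>r i. if r = rTAPE then of_bool (\<omega> i) else if r = rI \<and> i = 0 then j else 0)"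

definition tape_state :: "(nat \<Rightarrow> bool) \<Rightarrow> nat \<Rightarrow> memory" where
  "tape_state \<omega> j = conc b0 K inp (tape_rows \<omega> j)"

lemma B_pos: "1 \<le> B"
  by (simp add: B_def)

lemma N_less_B: "j \<le> N \<Longrightarrow> j < 2 ^ B"
  by (rule less_power_B) (simp add: B_def)

lemma tape_state_less_B: "j \<le> N \<Longrightarrow> tape_state \<omega> j a < 2 ^ B"
  unfolding tape_state_def by (rule conc_less_B) (auto simp: tape_rows_def N_less_B le_1_less_B)

lemma tape_state_0: "tape_state (\<lambda>_. False) 0 = input_memory (encode_system n E)"
proof -
  have "tape_rows (\<lambda>_. False) 0 = (\<lambda>r i. 0)" by (auto simp: tape_rows_def fun_eq_iff)
  moreover have "conc b0 K inp (\<lambda>r i. 0) = inp"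
    using length_encoding by (auto simp: conc_def inp_def input_memory_def fun_eq_iff)
  ultimately show ?thesis by (simp add: tape_state_def inp_def)
qed

abbreviation "fill_test \<equiv> Minus (Times (Const (Suc D)) (Times Mx (Times Mx Mx))) (reg rI)"
abbreviation "fill_body \<equiv> Seq (Flip (addr rTAPE (reg rI))) (putr rI (Plus (reg rI) (Const 1)))"

definition W_fill :: nat where "W_fill = prog_weight fill_tape * B"

lemma val_fill_test: "exp_val (tape_state \<omega> j) fill_test = N - j"
proof -
  have "val \<sigma> fill_test = Suc D * (M * (M * M)) - \<sigma> rI 0" for \<sigma>
    by (simp only: exp_val.simps val_Mx val_get row_less(1))
  then show ?thesis by (simp add: tape_state_def tape_rows_def N_def del: mult_Suc)
qed

lemma exec_fill_body:
  assumes "j < N"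
  shows "\<exists>c. (\<forall>b. exp_cost (tape_state \<omega> j) fill_test + c b \<le> W_fill) \<and>
    exec fill_body (tape_state \<omega> j) = bind_spmf coin_spmf (\<lambda>b. return_spmf (tape_state (fun_upd \<omega> j b) (Suc j), c b))"
proof -
  let ?s = "tape_state \<omega> j"
  let ?t = "\<lambda>b. conc b0 K inp (tape_rows (fun_upd \<omega> j b) j)"
  let ?e = "Plus (reg rI) (Const 1)"
  define c where "c b = (exp_cost ?s (addr rTAPE (reg rI)) + 1) + (exp_cost (?t b) (addr rI (Const 0)) + exp_cost (?t b) ?e)" for b
  have v: "exp_val ?s (addr rTAPE (reg rI)) = b0 + (rTAPE + K * j)"
    by (simp add: tape_state_def tape_rows_def)
  have u: "upd (tape_rows \<omega> j) rTAPE j (if b then 1 else 0) = tape_rows (fun_upd \<omega> j b) j"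
    "upd (tape_rows (fun_upd \<omega> j b) j) rI 0 (Suc j) = tape_rows (fun_upd \<omega> j b) (Suc j)" for b
    by (auto simp: tape_rows_def upd_def fun_eq_iff)
  have 1: "?s(b0 + (rTAPE + K * j) := (if b then 1 else 0)) = ?t b" for b
    unfolding tape_state_def by (subst conc_upd) (simp_all only: u row_less)
  have 2: "(?t b)(b0 + (rI + K * 0) := Suc j) = tape_state (fun_upd \<omega> j b) (Suc j)" for b
    unfolding tape_state_def by (subst conc_upd) (simp_all only: u row_less)
  have e: "exp_val (?t b) ?e = Suc j" "exp_val (?t b) (addr rI (Const 0)) = b0 + (rI + K * 0)" for b
    by (simp_all add: tape_rows_def)
  have exec2: "exec (putr rI ?e) (?t b) = return_spmf (tape_state (fun_upd \<omega> j b) (Suc j), exp_cost (?t b) (addr rI (Const 0)) + exp_cost (?t b) ?e)" for b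
    unfolding put_def exec.simps e 2 ..
  have "exec fill_body ?s = bind_spmf coin_spmf (\<lambda>b. return_spmf (tape_state (fun_upd \<omega> j b) (Suc j), c b))"
    unfolding exec.simps(4) exec.simps(3) v 1 bind_spmf_assoc return_bind_spmf prod.case exec2 c_def ..
  moreover have "exp_cost ?s fill_test + c b \<le> W_fill" for b
  proof -
    have s: "?s i < 2 ^ B" for i using assms by (intro tape_state_less_B) simp
    have t: "?t b i < 2 ^ B" for i
      using tape_state_less_B[of j "fun_upd \<omega> j b" i] assms by (simp add: tape_state_def)
    have "exp_cost ?s fill_test + c b \<le> exp_weight fill_test * B + ((exp_weight (addr rTAPE (reg rI)) * B + 1) + (exp_weight (addr rI (Const 0)) * B + exp_weight ?e * B))"
      unfolding c_def by (intro add_mono exp_cost_le s t B_pos order_refl)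
    also have "\<dots> \<le> W_fill" using B_pos unfolding W_fill_def fill_tape_def put_def
      by (simp add: algebra_simps del: exp_weight.simps)
    finally show ?thesis .
  qed
  ultimately show ?thesis by blast
qed

text \<open>Generalised to a start in the middle: the cells below \<open>j\<close> are already drawn
  and recorded in \<open>\<omega>\<close>, the others are still to be drawn. Each round peels one
  coordinate off the product distribution.\<close>

lemma exec_fill_loop:
  assumes "j \<le> N" "\<And>i. j \<le> i \<Longrightarrow> \<not> \<omega> i"
  shows "map_spmf fst (exec fill_tape (tape_state \<omega> j)) =
      map_spmf (\<lambda>\<omega>'. tape_state (\<lambda>i. if i < j then \<omega> i else \<omega>' i) N) (spmf_of_pmf (Pi_pmf {j..<N} False (\<lambda>_. pmf_of_set UNIV)))
    \<and> (\<forall>(s, t)\<in>set_spmf (exec fill_tape (tape_state \<omega> j)). t \<le> (N - j + 1) * W_fill)"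
  using assms
proof (induction "N - j" arbitrary: j \<omega>)
  case 0
  then have [simp]: "j = N" by simp
  have "exp_val (tape_state \<omega> N) fill_test = 0" unfolding val_fill_test by simp
  then have x: "exec fill_tape (tape_state \<omega> N) = return_spmf (tape_state \<omega> N, exp_cost (tape_state \<omega> N) fill_test)"
    unfolding fill_tape_def exec.simps by (subst exec_while.simps) simp
  have "exp_cost (tape_state \<omega> N) fill_test \<le> exp_weight fill_test * B"
    by (intro exp_cost_le tape_state_less_B B_pos) simp
  also have "\<dots> \<le> W_fill" unfolding W_fill_def fill_tape_def
    by (intro mult_le_mono1) (simp del: exp_weight.simps)
  finally have "exp_cost (tape_state \<omega> N) fill_test \<le> W_fill" .
  moreover have "(\<lambda>i. if i < N then \<omega> i else False) = \<omega>" using 0(3) by (auto simp: fun_eq_iff)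
  ultimately show ?case by (simp add: x)
next
  case (Suc a)
  then have j: "j < N" by simp
  obtain c where c: "\<And>b. exp_cost (tape_state \<omega> j) fill_test + c b \<le> W_fill"
    and body: "exec fill_body (tape_state \<omega> j) = bind_spmf coin_spmf (\<lambda>b. return_spmf (tape_state (fun_upd \<omega> j b) (Suc j), c b))"
    using exec_fill_body[OF j] by blast
  let ?r = "\<lambda>b. exec fill_tape (tape_state (fun_upd \<omega> j b) (Suc j))"
  have IH: "map_spmf fst (?r b) = map_spmf (\<lambda>\<omega>'. tape_state (\<lambda>i. if i < Suc j then (fun_upd \<omega> j b) i else \<omega>' i) N)
      (spmf_of_pmf (Pi_pmf {Suc j..<N} False (\<lambda>_. pmf_of_set UNIV)))"
    "\<forall>(s, t)\<in>set_spmf (?r b). t \<le> (N - Suc j + 1) * W_fill" for b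
    using Suc.hyps(1)[of "Suc j" "fun_upd \<omega> j b"] Suc.hyps(2) Suc.prems(2) j by auto
  have "exp_val (tape_state \<omega> j) fill_test \<noteq> 0" using val_fill_test j by simp
  then have x: "exec fill_tape (tape_state \<omega> j) = bind_spmf coin_spmf (\<lambda>b. bind_spmf (?r b)
     (\<lambda>(s2, t2). return_spmf (s2, exp_cost (tape_state \<omega> j) fill_test + c b + t2)))"
    unfolding fill_tape_def exec.simps(6)
    by (subst exec_while.simps) (simp only: if_False body bind_spmf_assoc return_bind_spmf prod.case)
  have "map_spmf fst (exec fill_tape (tape_state \<omega> j)) = bind_spmf coin_spmf (\<lambda>b. map_spmf fst (?r b))"
    unfolding x by (simp add: map_spmf_bind_spmf o_def split_beta map_spmf_conv_bind_spmf)
  also have "\<dots> = map_spmf (\<lambda>\<omega>'. tape_state (\<lambda>i. if i < j then \<omega> i else \<omega>' i) N) (spmf_of_pmf (Pi_pmf {j..<N} False (\<lambda>_. pmf_of_set UNIV)))"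
  proof -
    have "{j..<N} = insert j {Suc j..<N}" using j by auto
    then have P: "Pi_pmf {j..<N} False (\<lambda>_. pmf_of_set UNIV) =
      bind_pmf (pmf_of_set UNIV) (\<lambda>b. map_pmf (\<lambda>f. f(j := b)) (Pi_pmf {Suc j..<N} False (\<lambda>_. pmf_of_set UNIV)))"
      by (simp add: Pi_pmf_insert' map_pmf_def)
    have f: "(\<lambda>i. if i < Suc j then (fun_upd \<omega> j b) i else \<omega>' i) = (\<lambda>i. if i < j then \<omega> i else (\<omega>'(j := b)) i)" for b \<omega>'
      by (auto simp: fun_eq_iff less_Suc_eq)
    have coin: "coin_spmf = spmf_of_pmf (pmf_of_set UNIV)" by simp
    show ?thesis
      by (simp only: IH P coin f bind_spmf_of_pmf map_spmf_of_pmf map_bind_pmf spmf_of_pmf_bind pmf.map_comp comp_def)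
  qed
  finally have 1: "map_spmf fst (exec fill_tape (tape_state \<omega> j)) =
    map_spmf (\<lambda>\<omega>'. tape_state (\<lambda>i. if i < j then \<omega> i else \<omega>' i) N) (spmf_of_pmf (Pi_pmf {j..<N} False (\<lambda>_. pmf_of_set UNIV)))" .
  have 2: "t \<le> (N - j + 1) * W_fill" if st: "(s, t) \<in> set_spmf (exec fill_tape (tape_state \<omega> j))" for s t
  proof -
    obtain b s2 t2 where t: "(s2, t2) \<in> set_spmf (?r b)" "t = exp_cost (tape_state \<omega> j) fill_test + c b + t2"
      using st unfolding x by (auto simp: set_bind_spmf)
    have "t2 \<le> (N - Suc j + 1) * W_fill" using IH(2) t(1) by fast
    moreover have "N - j + 1 = Suc (N - Suc j + 1)" using j by simp
    ultimately show ?thesis using t(2) c[of b] by simp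
  qed
  show ?case using 1 2 by blast
qed

definition T_total :: nat where
  "T_total = (N + 1) * W_fill + T_main * (prog_weight main * B)"

lemma solution_iff:
  assumes "length x = n"
  shows "x \<in> solutions n E \<longleftrightarrow> is_sol (set_encode {i. i < n \<and> x ! i = 1})"
proof -
  let ?z = "set_encode {i. i < n \<and> x ! i = 1}"
  have dec: "set_decode ?z = {i. i < n \<and> x ! i = 1}" by simp
  have "bt ?z i = x ! i" if "i < n" for i
    using that by (cases "x ! i") (auto simp: bt_def dec)
  then have "anf_eval (E ! j) x = sysval j ?z" if "j < m" for j
    unfolding anf_eval_def sysval_def
    using in_anf(1)[of "E ! j"] that by (intro arg_cong[where f = sum_list] arg_cong[where f = prod_list] map_cong refl) (force simp: m_def)
  moreover have "?z < 2 ^ n" by (auto simp: less_power_iff_set_decode)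
  ultimately show ?thesis using assms unfolding solutions_def is_sol_def
    by (auto simp: m_def in_set_conv_nth all_set_conv_all_nth)
qed

lemma correct_output:
  assumes "result \<omega> s" "success \<omega>"
  shows "correct_output n E s"
proof (cases "\<exists>z. is_sol z")
  case True
  then obtain x where x: "s 0 = 1" "is_sol x" "\<And>i. i < n \<Longrightarrow> s (Suc i) = b2n (bt x i)"
    using assms by (auto simp: result_def success_def split: if_splits)
  let ?x = "map (bt x) [0..<n]"
  have "set_decode x \<subseteq> {..<n}" using x(2) by (simp add: is_sol_def less_power_iff_set_decode)
  then have "{i. i < n \<and> ?x ! i = 1} = set_decode x" by (auto simp: bt_def)
  then have "?x \<in> solutions n E" using x(2) solution_iff[of ?x] by simp
  then show ?thesis using x unfolding correct_output_def outputs_solution_def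
    by (intro disjI1 conjI bexI[of _ ?x]) (auto simp: b2n_def)
next
  case False
  then have "solutions n E = {}" using solution_iff by (auto simp: solutions_def)
  moreover have "s 0 = 0" using assms(1) False by (auto simp: result_def split: if_splits)
  ultimately show ?thesis by (simp add: correct_output_def outputs_unsolvable_def)
qed

lemma run_main:
  "\<exists>s t. exec main (tape_state \<omega> N) = return_spmf (s, t) \<and> t \<le> T_main * (prog_weight main * B) \<and> result \<omega> s"
proof -
  obtain s k where 1: "big B main (tape_state \<omega> N) s k" "k \<le> T_main" "result \<omega> s"
    using main_spec[of \<omega> "tape_rows \<omega> N"] by (auto simp: tape_state_def tapeok_def tape_rows_def)
  then obtain t where "t \<le> k * (prog_weight main * B)" "exec main (tape_state \<omega> N) = return_spmf (s, t)"
    using big_exec[OF 1(1)] tape_state_less_B B_pos by blast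
  then show ?thesis using 1 by (meson le_trans mult_le_mono1)
qed

lemma tapes_pmf: "Pi_pmf {0..<N} False (\<lambda>_. pmf_of_set UNIV) = pmf_of_set tapes"
proof -
  have "tapes = PiE_dflt {0..<N} False (\<lambda>_. UNIV)"
    by (auto simp: tapes_def PiE_dflt_def not_less)
  then show ?thesis by (simp add: Pi_pmf_of_set)
qed

lemma tapes_nonempty: "tapes \<noteq> {}"
  by (auto simp: tapes_def intro!: exI[of _ "\<lambda>_. False"])

text \<open>After the tape is filled, the final memory is a function of the tape. Its distribution
  is the image of the uniform distribution on \<open>tapes\<close>, so success is a matter of
  counting, while the time bound holds for every tape.\<close>

lemma run_solver:
  shows "runs_within (run_on solver n E) (real T_total)" "success_prob solver n E \<ge> 1 - err"
proof -
  let ?s0 = "input_memory (encode_system n E)"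
  let ?p = "spmf_of_pmf (pmf_of_set tapes)"
  obtain fin tm where fin: "\<And>\<omega>. exec main (tape_state \<omega> N) = return_spmf (fin \<omega>, tm \<omega>)"
    "\<And>\<omega>. tm \<omega> \<le> T_main * (prog_weight main * B)" "\<And>\<omega>. result \<omega> (fin \<omega>)"
    using run_main by metis
  have fill: "map_spmf fst (exec fill_tape ?s0) = map_spmf (\<lambda>\<omega>. tape_state \<omega> N) ?p"
    "\<forall>(s, t)\<in>set_spmf (exec fill_tape ?s0). t \<le> (N + 1) * W_fill"
    using exec_fill_loop[of 0 "\<lambda>_. False"] by (simp_all add: tape_state_0 tapes_pmf)
  have run: "run_on solver n E = bind_spmf (exec fill_tape ?s0) (\<lambda>(s1, t1).
       bind_spmf (exec main s1) (\<lambda>(s2, t2). return_spmf (s2, t1 + t2)))"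
    unfolding run_on_def solver_eq exec.simps ..
  have "map_spmf fst (run_on solver n E) = bind_spmf (map_spmf fst (exec fill_tape ?s0)) (\<lambda>s1. map_spmf fst (exec main s1))"
    unfolding run by (simp add: map_spmf_bind_spmf bind_map_spmf o_def split_beta map_spmf_conv_bind_spmf)
  also have "\<dots> = map_spmf fin ?p"
    unfolding fill(1) bind_map_spmf comp_def fin(1) map_spmf_conv_bind_spmf[of fin] by (simp del: bind_spmf_of_pmf)
  finally have fst: "map_spmf fst (run_on solver n E) = map_spmf fin ?p" .
  have "lossless_spmf (map_spmf fst (run_on solver n E))" unfolding fst by simp
  then have "lossless_spmf (run_on solver n E)" by simp
  moreover have "t \<le> T_total" if st: "(s, t) \<in> set_spmf (run_on solver n E)" for s t
  proof -
    obtain s1 t1 t2 where 1: "(s1, t1) \<in> set_spmf (exec fill_tape ?s0)" "(s, t2) \<in> set_spmf (exec main s1)" "t = t1 + t2"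
      using st unfolding run by (auto simp: set_bind_spmf)
    have "s1 \<in> set_spmf (map_spmf fst (exec fill_tape ?s0))" using 1(1) by force
    then obtain \<omega> where "s1 = tape_state \<omega> N" unfolding fill(1) by auto
    then have "t2 = tm \<omega>" using 1(2) fin(1) by simp
    then show ?thesis using fin(2)[of \<omega>] fill(2) 1(1,3) unfolding T_total_def by fastforce
  qed
  ultimately show "runs_within (run_on solver n E) (real T_total)" unfolding runs_within_def by auto
  have "success_prob solver n E = measure (measure_spmf (map_spmf fst (run_on solver n E))) {s. correct_output n E s}"
    unfolding success_prob_def measure_map_spmf by (intro arg_cong2[where f = measure] refl) auto
  also have "\<dots> = measure (measure_pmf (pmf_of_set tapes)) {\<omega>. correct_output n E (fin \<omega>)}"
    unfolding fst measure_map_spmf by (simp add: measure_spmf_spmf_of_pmf vimage_def)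
  finally have eq: "success_prob solver n E = measure (measure_pmf (pmf_of_set tapes)) {\<omega>. correct_output n E (fin \<omega>)}" .
  have "measure (measure_pmf (pmf_of_set tapes)) {\<omega>. \<not> success \<omega>} = real (card {\<omega> \<in> tapes. \<not> success \<omega>}) / real (card tapes)"
    using tapes_nonempty by (simp add: measure_pmf_of_set Int_def)
  also have "\<dots> \<le> err"
    using card_failure tapes_nonempty by (simp add: divide_le_eq card_gt_0_iff)
  finally have "1 - err \<le> 1 - measure (measure_pmf (pmf_of_set tapes)) {\<omega>. \<not> success \<omega>}" by simp
  also have "\<dots> = measure (measure_pmf (pmf_of_set tapes)) {\<omega>. success \<omega>}"
    using measure_pmf.prob_compl[of "{\<omega>. \<not> success \<omega>}" "pmf_of_set tapes"]
    by (simp add: Compl_eq_Diff_UNIV[symmetric] Collect_neg_eq[symmetric])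
  also have "\<dots> \<le> success_prob solver n E"
    unfolding eq using correct_output fin(3) by (intro measure_pmf.finite_measure_mono) auto
  finally show "success_prob solver n E \<ge> 1 - err" .
qed

end

section \<open>Asymptotics\<close>

lemma sum_power_card_Pow: "(\<Sum>V\<in>Pow {..<p}. y ^ card V) = (1 + y :: real) ^ p"
proof (induction p)
  case (Suc p)
  have "(\<Sum>V\<in>Pow {..<Suc p}. y ^ card V) = (\<Sum>V\<in>Pow {..<p}. y ^ card V + y ^ card (insert p V))"
    unfolding lessThan_Suc by (rule sum_Pow_insert) auto
  also have "\<dots> = (\<Sum>V\<in>Pow {..<p}. (1 + y) * y ^ card V)"
  proof (intro sum.cong refl)
    fix V assume "V \<in> Pow {..<p}"
    then have "finite V" "p \<notin> V" using finite_subset by auto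
    then show "y ^ card V + y ^ card (insert p V) = (1 + y) * y ^ card V" by (simp add: distrib_right)
  qed
  also have "\<dots> = (1 + y) ^ Suc p" using Suc by (simp add: sum_distrib_left[symmetric])
  finally show ?case .
qed simp

text \<open>As \<open>y\<close> is at most 1, a counted point has \<open>y ^ wt v\<close> at least
  \<open>y ^ W\<close>, and over the whole cube these values sum to
  \<open>(1 + y) ^ p\<close>.\<close>

lemma card_low_weight:
  assumes "0 < y" "y \<le> 1"
  shows "real (card {v. v < 2 ^ p \<and> wt v \<le> W}) * y ^ W \<le> (1 + y) ^ p"
proof -
  let ?L = "{v. v < (2::nat) ^ p \<and> wt v \<le> W}"
  have "real (card ?L) * y ^ W = (\<Sum>v\<in>?L. y ^ W)" by simp
  also have "\<dots> \<le> (\<Sum>v\<in>?L. y ^ wt v)" using assms by (intro sum_mono power_decreasing) auto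
  also have "\<dots> \<le> (\<Sum>v<2 ^ p. y ^ wt v)" using assms by (intro sum_mono2) auto
  also have "\<dots> = (\<Sum>V\<in>Pow {..<p}. y ^ card V)"
    by (rule sum.reindex_bij_betw[OF bij_betw_set_decode])
  finally show ?thesis by (simp add: sum_power_card_Pow)
qed

lemma power_times_geometric:
  fixes r :: real
  assumes "0 < r" "r < 1"
  shows "(\<lambda>k. real k ^ a * r ^ k) \<longlonglongrightarrow> 0"
  using assms by real_asymp

context instance_context
begin

text \<open>
  Points are counted with weight \<open>y ^ wt\<close>; the condition on \<open>y\<close> makes the resulting bound
  independent of the position \<open>p\<close> in the definition of \<open>U\<close>.
\<close>

lemma card_U_le:
  assumes y: "0 < y" "y \<le> 1" "1 \<le> (1 + y) * y ^ (d - 1)"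
  shows "real (card U) \<le> real (n + 1) * 2 ^ S * (1 + y) ^ n / y ^ (4 * d)"
proof -
  define W where "W p = (d - 1) * (n - p) + 4 * d" for p
  define L where "L p = {v. v < (2::nat) ^ p \<and> wt v \<le> W p}" for p
  define A where "A p = {x. x < 2 ^ (p + S) \<and> wt (x mod 2 ^ p) \<le> W p}" for p
  have finL: "finite (L p)" for p unfolding L_def by simp
  have A: "card (A p) \<le> 2 ^ S * card (L p)" for p
  proof -
    have "card (A p) \<le> card ({..<(2::nat) ^ S} \<times> L p)"
    proof (rule card_inj_on_le)
      show "inj_on (\<lambda>x. (x div 2 ^ p, x mod 2 ^ p)) (A p)"
        unfolding inj_on_def by (metis Pair_inject div_mult_mod_eq)
      have "x div 2 ^ p < 2 ^ S" if "x < 2 ^ (p + S)" for x :: nat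
        using that by (subst div_less_iff_less_mult) (simp_all add: power_add mult.commute)
      then show "(\<lambda>x. (x div 2 ^ p, x mod 2 ^ p)) ` A p \<subseteq> {..<2 ^ S} \<times> L p"
        by (auto simp: A_def L_def)
    qed (use finL in simp)
    then show ?thesis by (simp add: card_cartesian_product)
  qed
  have L: "real (card (L p)) \<le> (1 + y) ^ n / y ^ (4 * d)" if "p \<le> n" for p
  proof -
    have "real (card (L p)) * y ^ W p \<le> (1 + y) ^ p" unfolding L_def using y by (intro card_low_weight) auto
    also have "\<dots> \<le> (1 + y) ^ p * ((1 + y) * y ^ (d - 1)) ^ (n - p)"
      using y mult_left_mono[OF one_le_power[OF y(3), of "n - p"], of "(1 + y) ^ p"] by simp
    also have "\<dots> = (1 + y) ^ n * y ^ ((d - 1) * (n - p))"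
      using that by (simp add: power_mult_distrib power_mult mult.assoc[symmetric] flip: power_add)
    finally have "real (card (L p)) * y ^ (4 * d) * y ^ ((d - 1) * (n - p)) \<le> (1 + y) ^ n * y ^ ((d - 1) * (n - p))"
      by (simp add: W_def power_add mult_ac)
    then have "real (card (L p)) * y ^ (4 * d) \<le> (1 + y) ^ n" using y by simp
    then show ?thesis using y by (simp add: field_simps)
  qed
  have "U \<subseteq> (\<Union>p\<in>{..n}. A p)" by (auto simp: U_def A_def W_def)
  then have "card U \<le> card (\<Union>p\<in>{..n}. A p)" by (intro card_mono) (auto simp: A_def)
  also have "\<dots> \<le> (\<Sum>p\<le>n. card (A p))" by (rule card_UN_le) simp
  also have "\<dots> \<le> (\<Sum>p\<le>n. 2 ^ S * card (L p))" by (intro sum_mono A)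
  finally have "real (card U) \<le> real (\<Sum>p\<le>n. 2 ^ S * card (L p))" by (simp only: of_nat_le_iff)
  also have "\<dots> = (\<Sum>p\<le>n. 2 ^ S * real (card (L p)))" by simp
  also have "\<dots> \<le> (\<Sum>p\<le>n. 2 ^ S * ((1 + y) ^ n / y ^ (4 * d)))" using L by (intro sum_mono mult_left_mono) auto
  also have "\<dots> = real (n + 1) * 2 ^ S * (1 + y) ^ n / y ^ (4 * d)" by simp
  finally show ?thesis .
qed

lemma card_U_pos: "1 \<le> card U"
  using zero_in_U by (simp add: Suc_le_eq card_gt_0_iff) blast

lemma M_power: "a \<le> b \<Longrightarrow> M ^ a \<le> M ^ b" and M_power_pos: "1 \<le> M ^ a" and M_pos: "1 \<le> M"
  using n_M by (auto intro: power_increasing simp: Suc_le_eq)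

lemma n_le_M: "n \<le> M" "n + 1 \<le> M" "n + 2 \<le> M" "8 \<le> M"
  using n_M by auto

lemma T_leaf_le: "T_leaf \<le> (80 + 21 * D) * M ^ 3"
proof -
  have M2: "1 \<le> M" "M \<le> M ^ 3" "M ^ 2 \<le> M ^ 3" "1 \<le> M ^ 3" "1 \<le> M ^ 2"
    using M_power[of 1 3] M_power[of 2 3] M_power_pos[of 3] M_power_pos[of 2] M_pos by auto
  have "M * (M * (4 * n + 8)) \<le> M * (M * (12 * M))" using n_le_M by (intro mult_le_mono) auto
  then have 1: "M * (M * (4 * n + 8)) \<le> 12 * M ^ 3" by (simp add: power3_eq_cube)
  have "(n + 1) * (3 * n + 6) \<le> M * (9 * M)" using n_le_M by (intro mult_le_mono) auto
  then have 2: "(n + 1) * (3 * n + 6) \<le> 9 * M ^ 3" using M2 by (simp add: power2_eq_square)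
  have "D * (M * (3 * M + 12) + 6) \<le> D * (21 * M ^ 3)"
  proof (rule mult_le_mono2)
    have "M * (3 * M + 12) + 6 = 3 * M ^ 2 + 12 * M + 6" by (simp add: power2_eq_square algebra_simps)
    then show "M * (3 * M + 12) + 6 \<le> 21 * M ^ 3" using M2 by linarith
  qed
  then have 3: "D * (M * (3 * M + 12) + 6) \<le> 21 * D * M ^ 3" by (simp add: mult.assoc mult.left_commute)
  have "T_leaf = M * (M * (4 * n + 8)) + 11 * M + 5 + ((n + 1) * (3 * n + 6) + 3) + (D * (M * (3 * M + 12) + 6) + 2) + (5 * M + 3)"
    by (simp add: T_leaf_def distrib_left)
  also have "\<dots> \<le> 80 * M ^ 3 + 21 * D * M ^ 3" using 1 2 3 M2 by linarith
  finally show ?thesis by (simp add: distrib_right)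
qed

text \<open>A level repeats the next one \<open>M\<close> times, once for the whole table and not
  once per entry. Hence \<open>card U\<close> enters linearly, whatever the depth.\<close>

lemma T_level_le: "T_level h \<le> (86 + 21 * D + 62 * h) * (card U * M ^ (3 + h))"
proof (induction h)
  case 0
  have "card U * (T_leaf + 4) \<le> card U * ((84 + 21 * D) * M ^ 3)"
  proof (rule mult_le_mono2)
    have "(84 + 21 * D) * M ^ 3 = (80 + 21 * D) * M ^ 3 + 4 * M ^ 3" by (simp add: algebra_simps)
    then show "T_leaf + 4 \<le> (84 + 21 * D) * M ^ 3" using T_leaf_le M_power_pos[of 3] by linarith
  qed
  moreover have "card U * ((84 + 21 * D) * M ^ 3) = (84 + 21 * D) * (card U * M ^ 3)" by (simp only: mult.left_commute)
  moreover have "1 * 1 \<le> card U * M ^ 3" using card_U_pos M_power_pos by (intro mult_le_mono) auto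
  ultimately have "T_level 0 \<le> (84 + 21 * D) * (card U * M ^ 3) + 2 * (card U * M ^ 3)"
    unfolding T_level.simps by linarith
  then show ?case by (simp add: distrib_right)
next
  case (Suc h)
  let ?P = "card U * M ^ (3 + Suc h)"
  have u: "card U * M \<le> ?P" "card U * M ^ 2 \<le> ?P" "card U \<le> ?P" "1 \<le> ?P" "M \<le> ?P"
    using M_power[of 1 "3 + Suc h"] M_power[of 2 "3 + Suc h"] M_power_pos[of "3 + Suc h"] card_U_pos
      mult_le_mono[of 1 "card U" M "M ^ (3 + Suc h)"] mult_le_mono[of 1 "card U" 1 "M ^ (3 + Suc h)"]
    by auto
  have "M * (n * (card U * 6 + 4)) \<le> M * (M * (10 * card U))" using n_le_M card_U_pos by (intro mult_le_mono) auto
  also have "\<dots> = 10 * (card U * M ^ 2)" by (simp add: power2_eq_square mult_ac)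
  also have "\<dots> \<le> 10 * ?P" using u(2) by linarith
  finally have 1: "M * (n * (card U * 6 + 4)) \<le> 10 * ?P" .
  have "M * T_level h \<le> M * ((86 + 21 * D + 62 * h) * (card U * M ^ (3 + h)))" using Suc by (rule mult_le_mono2)
  also have "\<dots> = (86 + 21 * D + 62 * h) * ?P" by (simp only: power_Suc add_Suc_right mult_ac)
  finally have 2: "M * T_level h \<le> (86 + 21 * D + 62 * h) * ?P" .
  have "T_level (Suc h) = 14 * card U + M * T_level h + 10 * (card U * M) + 2 * (M * (n * (card U * 6 + 4))) + 10 * M + 8"
    by (simp add: T_trans_def algebra_simps)
  also have "\<dots> \<le> (86 + 21 * D + 62 * h) * ?P + 62 * ?P" using u 1 2 by linarith
  finally show ?case by (simp add: distrib_right)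
qed

text \<open>The three powers of \<open>M\<close> beyond \<open>T_level D\<close> stand for the bits
  of a candidate, the numbers of hash equations and the trials.\<close>

lemma T_main_le: "T_main \<le> (185 + 83 * D) * (card U * M ^ (D + 6))"
proof -
  define P where "P = card U * M ^ (D + 3)"
  define Q where "Q = card U * M ^ (D + 6)"
  define c where "c = 86 + 83 * D"
  have M3: "M ^ a \<le> P" if "a \<le> 3" for a
    unfolding P_def using card_U_pos M_power[of a "D + 3"] that mult_le_mono[of 1 "card U" "M ^ a" "M ^ (D + 3)"] by simp
  have P1: "1 \<le> P" "M \<le> P" "M ^ 2 \<le> P" "M ^ 3 \<le> P" using M3[of 0] M3[of 1] M3[of 2] M3[of 3] by auto
  have Q: "Q = M * (M * (M * P))" by (simp add: Q_def P_def power_add power3_eq_cube mult_ac eval_nat_numeral)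
  have MP: "P \<le> M * P" "M * P \<le> M * (M * P)" "M * (M * P) \<le> Q" unfolding Q using M_pos by auto
  have L: "T_level D \<le> c * P" using T_level_le[of D] by (simp add: c_def P_def add.commute algebra_simps)
  have "M * (M * (4 * n + 8)) \<le> M * (M * (12 * M))" using n_le_M by (intro mult_le_mono) auto
  also have "\<dots> = 12 * M ^ 3" by (simp add: power3_eq_cube)
  also have "\<dots> \<le> 12 * P" using P1 by simp
  finally have 1: "M * (M * (4 * n + 8)) \<le> 12 * P" .
  have "n * (T_level D + 3) \<le> M * (c * P + 3 * P)" using L P1 n_le_M by (intro mult_le_mono) auto
  then have 2: "n * (T_level D + 3) \<le> (c + 3) * (M * P)" by (simp add: algebra_simps)
  have "T_try = n * (T_level D + 3) + M * (M * (4 * n + 8)) + 16 * M + 16" by (simp add: T_try_def algebra_simps)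
  also have "\<dots> \<le> (c + 3) * (M * P) + 44 * (M * P)" using 1 2 P1 MP by linarith
  also have "\<dots> = (c + 47) * (M * P)" by (simp only: distrib_right[symmetric] add.assoc) simp
  finally have T: "T_try \<le> (c + 47) * (M * P)" .
  have "(n + 2) * (T_try + 2) \<le> M * ((c + 47) * (M * P) + 2 * (M * P))"
    using T MP P1 n_le_M by (intro mult_le_mono add_mono) auto
  then have "(n + 2) * (T_try + 2) \<le> (c + 49) * (M * (M * P))" by (simp add: algebra_simps)
  then have "M * ((n + 2) * (T_try + 2)) \<le> M * ((c + 49) * (M * (M * P)))" by (rule mult_le_mono2)
  then have 3: "M * ((n + 2) * (T_try + 2)) \<le> (c + 49) * Q" by (simp add: Q mult.left_commute)
  have s: "T_search = M * ((n + 2) * (T_try + 2)) + 4 * M + 2" by (simp add: T_search_def distrib_left)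
  have "n * (card U * (5 * n + 16)) \<le> M * (card U * (21 * M))" using n_le_M by (intro mult_le_mono) auto
  also have "\<dots> \<le> 21 * P"
    using M_power[of 2 "D + 3"] by (simp add: P_def power2_eq_square mult_ac)
  finally have 4: "n * (card U * (5 * n + 16)) \<le> 21 * P" .
  have "T_main = 3 * M + n * (card U * (5 * n + 16)) + 8 * n + T_search + 11" by (simp add: T_main_def distrib_left)
  also have "\<dots> \<le> (c + 49) * Q + 50 * Q" unfolding s using 3 4 P1 MP n_le_M by linarith
  finally show ?thesis by (simp add: c_def Q_def distrib_right)
qed

text \<open>Independent of \<open>n\<close>: the program, and with it the weight of its expressions,
  is fixed by \<open>d\<close> and \<open>D\<close>.\<close>

definition c_total :: nat where
  "c_total = ((D + 2) * prog_weight fill_tape + (185 + 83 * D) * prog_weight main) * (d + D + 10)"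

lemma T_total_le: "T_total \<le> c_total * (card U * M ^ (D + 9))"
proof -
  have M3: "1 \<le> M ^ 3" "M \<le> M ^ 3" "M ^ 2 \<le> M ^ 3" using M_power[of 1 3] M_power[of 2 3] M_power_pos[of 3] by auto
  have "(n + 1) ^ (2 * d) = ((n + 1) ^ d) ^ 2" by (simp add: power_mult mult.commute)
  also have "\<dots> \<le> M ^ 2" by (intro power_mono) (auto simp: M_def)
  finally have "b0 \<le> (d + 4) * M ^ 3" unfolding b0_def using M3 by (intro mult_le_mono) auto
  moreover have N: "N = Suc D * M ^ 3" by (simp add: N_def power3_eq_cube)
  ultimately have "B \<le> (d + 4) * M ^ 3 + Suc D * M ^ 3 + 5 * M ^ 3" unfolding B_def using M3 by linarith
  then have B: "B \<le> (d + D + 10) * M ^ 3" by (simp add: algebra_simps)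
  have "N + 1 \<le> (D + 2) * M ^ 3" using N M3 by simp
  then have "(N + 1) * W_fill \<le> (D + 2) * M ^ 3 * (prog_weight fill_tape * ((d + D + 10) * M ^ 3))"
    unfolding W_fill_def using B by (intro mult_le_mono) auto
  also have "\<dots> = (D + 2) * prog_weight fill_tape * (d + D + 10) * (M ^ 3 * M ^ 3)" by (simp only: mult_ac)
  also have "M ^ 3 * M ^ 3 = M ^ 6" by (simp flip: power_add)
  also have "(D + 2) * prog_weight fill_tape * (d + D + 10) * M ^ 6 \<le> (D + 2) * prog_weight fill_tape * (d + D + 10) * (card U * M ^ (D + 9))"
    using M_power[of 6 "D + 9"] card_U_pos mult_le_mono[of 1 "card U" "M ^ 6" "M ^ (D + 9)"]
    by (intro mult_le_mono) auto
  finally have 1: "(N + 1) * W_fill \<le> (D + 2) * prog_weight fill_tape * (d + D + 10) * (card U * M ^ (D + 9))" .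
  have "T_main * (prog_weight main * B) \<le> (185 + 83 * D) * (card U * M ^ (D + 6)) * (prog_weight main * ((d + D + 10) * M ^ 3))"
    using T_main_le B by (intro mult_le_mono) auto
  also have "\<dots> = (185 + 83 * D) * prog_weight main * (d + D + 10) * (card U * (M ^ (D + 6) * M ^ 3))" by (simp only: mult_ac)
  also have "M ^ (D + 6) * M ^ 3 = M ^ (D + 9)"
    using power_add[of M "D + 6" 3] by (simp add: add.assoc)
  finally show ?thesis using 1 unfolding T_total_def c_total_def by (simp only: distrib_right)
qed

lemma T_total_real_le:
  assumes y: "0 < y" "y \<le> 1" "1 \<le> (1 + y) * y ^ (d - 1)"
  shows "real T_total \<le> (real c_total * 9 ^ (D + 9) * 2 / y ^ (4 * d)) * (real (n + 1) ^ (d * (D + 9) + 1) * (2 powr (1 / real D) * (1 + y)) ^ n)"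
proof -
  have "n + 1 \<le> (n + 1) ^ d" using d2 by (intro self_le_power) auto
  then have "M \<le> 9 * (n + 1) ^ d" unfolding M_def by linarith
  then have "M ^ (D + 9) \<le> (9 * (n + 1) ^ d) ^ (D + 9)" by (intro power_mono) auto
  then have "real (M ^ (D + 9)) \<le> real ((9 * (n + 1) ^ d) ^ (D + 9))" by (simp only: of_nat_le_iff)
  also have "\<dots> = 9 ^ (D + 9) * real (n + 1) ^ (d * (D + 9))"
    by (simp only: power_mult_distrib of_nat_mult of_nat_power power_mult of_nat_numeral)
  finally have 1: "real (M ^ (D + 9)) \<le> 9 ^ (D + 9) * real (n + 1) ^ (d * (D + 9))" .
  \<comment> \<open>The free continuation of prefixes costs \<open>2 ^ S\<close>; up to a factor 2
    this is \<open>2 powr (1 / D)\<close> per variable.\<close>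
  have "real S \<le> real n / real D + 1" unfolding S_def using of_nat_div_le_of_nat[of n D, where 'a = real] by simp
  then have "(2::real) powr real S \<le> 2 powr (real n / real D + 1)" by (intro powr_mono) auto
  also have "\<dots> = 2 * (2 powr (1 / real D)) ^ n"
    by (simp add: powr_add powr_powr powr_realpow[symmetric] mult.commute)
  finally have 2: "(2::real) ^ S \<le> 2 * (2 powr (1 / real D)) ^ n" by (simp add: powr_realpow)
  have "real (card U) \<le> real (n + 1) * 2 ^ S * (1 + y) ^ n / y ^ (4 * d)" by (rule card_U_le[OF y])
  also have "\<dots> \<le> real (n + 1) * (2 * (2 powr (1 / real D)) ^ n) * (1 + y) ^ n / y ^ (4 * d)"
    using 2 y by (intro divide_right_mono mult_right_mono mult_left_mono) auto
  finally have 3: "real (card U) \<le> real (n + 1) * (2 * (2 powr (1 / real D)) ^ n) * (1 + y) ^ n / y ^ (4 * d)" .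
  have "real T_total \<le> real (c_total * (card U * M ^ (D + 9)))" using T_total_le by (simp only: of_nat_le_iff)
  also have "\<dots> = real c_total * (real (card U) * real (M ^ (D + 9)))" by simp
  also have "\<dots> \<le> real c_total * ((real (n + 1) * (2 * (2 powr (1 / real D)) ^ n) * (1 + y) ^ n / y ^ (4 * d)) * (9 ^ (D + 9) * real (n + 1) ^ (d * (D + 9))))"
    using 1 3 y by (intro mult_left_mono mult_mono) auto
  also have "\<dots> = (real c_total * 9 ^ (D + 9) * 2 / y ^ (4 * d)) * (real (n + 1) ^ (d * (D + 9) + 1) * (2 powr (1 / real D) * (1 + y)) ^ n)"
    by (simp only: power_mult_distrib power_add power_one_right times_divide_eq_left times_divide_eq_right mult_ac)
  finally show ?thesis .
qed

text \<open>Failure to isolate has base 13/16. The votes contribute the smaller base 3/4 once the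
  factor \<open>2 ^ n\<close> has been absorbed.\<close>

lemma err_le: "err \<le> real (D + 1) * (real M ^ (D + 3) * (13 / 16) ^ M)"
proof -
  have M1: "1 \<le> real M" using M_pos by simp
  have "real ((M * (n + 2) * n) * D * M ^ D * 2 ^ n) \<le> real ((M * M * M) * D * M ^ D * 2 ^ n)"
    using n_le_M by (intro of_nat_mono mult_le_mono) auto
  also have "\<dots> = real D * (real M ^ (D + 3) * 2 ^ n)" by (simp add: power_add power3_eq_cube mult_ac)
  also have "\<dots> \<le> real D * (real M ^ (D + 3) * (3 / 2) ^ M)"
  proof -
    \<comment> \<open>This is where \<open>4 * n\<close> in \<open>M\<close> is used:
      \<open>2\<close> is at most \<open>(3 / 2) ^ 4\<close>, so \<open>2 ^ n\<close> is at most
      \<open>(3 / 2) ^ M\<close>.\<close>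
    have "(2::real) ^ n \<le> ((3 / 2) ^ 4) ^ n" by (intro power_mono) (simp_all add: power_divide)
    also have "\<dots> = (3 / 2) ^ (4 * n)" by (simp add: power_mult)
    also have "\<dots> \<le> (3 / 2) ^ M" using n_M by (intro power_increasing) auto
    finally show ?thesis by (intro mult_left_mono) auto
  qed
  finally have "real ((M * (n + 2) * n) * D * M ^ D * 2 ^ n) / 2 ^ M \<le> real D * (real M ^ (D + 3) * (3 / 2) ^ M) / 2 ^ M"
    by (intro divide_right_mono) auto
  also have "\<dots> = real D * (real M ^ (D + 3) * (3 / 4) ^ M)"
    by (simp add: power_divide flip: power_mult_distrib)
  also have "\<dots> \<le> real D * (real M ^ (D + 3) * (13 / 16) ^ M)"
    by (intro mult_left_mono power_mono) auto
  finally have "err \<le> (13 / 16) ^ M + real D * (real M ^ (D + 3) * (13 / 16) ^ M)" unfolding err_def by linarith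
  moreover have "(13 / 16) ^ M \<le> real M ^ (D + 3) * (13 / 16) ^ M"
    using one_le_power[OF M1, of "D + 3"] by simp
  moreover have "real (D + 1) * (real M ^ (D + 3) * (13 / 16) ^ M) =
      real M ^ (D + 3) * (13 / 16) ^ M + real D * (real M ^ (D + 3) * (13 / 16) ^ M)"
    by (simp add: distrib_right)
  ultimately show ?thesis by linarith
qed

end

section \<open>From the bounds to the asymptotic statement\<close>

text \<open>Time and error bounds depend on \<open>d\<close>, \<open>D\<close> and \<open>n\<close>
  only. The empty system makes them accessible for all \<open>n\<close> without fixing an
  instance.\<close>

lemma instance_context_Nil: "2 \<le> d \<Longrightarrow> 1 \<le> D \<Longrightarrow> instance_context d D n []"
  by unfold_locales (auto simp: instances_def is_system_def)

lemma err_small: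
  assumes d: "2 \<le> d" "1 \<le> D"
  shows "\<forall>\<^sub>F n in sequentially. instance_context.err d D n \<le> 1 / real n ^ c"
proof -
  define MM where "MM n = instance_context.M d n" for n
  have nM: "n \<le> MM n" "1 \<le> MM n" and err: "instance_context.err d D n \<le> real (D + 1) * (real (MM n) ^ (D + 3) * (13 / 16) ^ MM n)" for n
  proof -
    interpret instance_context d D n "[]" by (rule instance_context_Nil[OF d])
    show "n \<le> MM n" "1 \<le> MM n" using n_le_M M_pos by (auto simp: MM_def)
    show "err \<le> real (D + 1) * (real (MM n) ^ (D + 3) * (13 / 16) ^ MM n)" using err_le by (simp add: MM_def)
  qed
  have "(\<lambda>k. real (D + 1) * (real k ^ (D + 3 + c) * (13 / 16) ^ k)) \<longlonglongrightarrow> real (D + 1) * 0"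
    by (intro tendsto_mult tendsto_const power_times_geometric) auto
  then have "\<forall>\<^sub>F k in sequentially. real (D + 1) * (real k ^ (D + 3 + c) * (13 / 16) ^ k) < 1"
    by (rule order_tendstoD(2)) simp
  moreover have "filterlim MM at_top sequentially"
    by (rule filterlim_at_top_mono[OF filterlim_ident]) (use nM in auto)
  ultimately have "\<forall>\<^sub>F n in sequentially. real (D + 1) * (real (MM n) ^ (D + 3 + c) * (13 / 16) ^ MM n) < 1"
    by (rule eventually_compose_filterlim)
  then show ?thesis using eventually_gt_at_top[of 0]
  proof eventually_elim
    case (elim n)
    have "real n ^ c * instance_context.err d D n \<le> real n ^ c * (real (D + 1) * (real (MM n) ^ (D + 3) * (13 / 16) ^ MM n))"
      by (intro mult_left_mono err) auto
    also have "\<dots> \<le> real (MM n) ^ c * (real (D + 1) * (real (MM n) ^ (D + 3) * (13 / 16) ^ MM n))"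
      using nM by (intro mult_right_mono power_mono) auto
    also have "\<dots> = real (D + 1) * (real (MM n) ^ (D + 3 + c) * (13 / 16) ^ MM n)" by (simp only: power_add mult_ac)
    finally have "real n ^ c * instance_context.err d D n \<le> 1" using elim by linarith
    then show ?case using elim by (simp add: field_simps)
  qed
qed

text \<open>By the strict inequality the ratio \<open>r\<close> of the bases is below 1, and its
  powers swallow the polynomial factor.\<close>

lemma T_total_bigo:
  assumes d: "2 \<le> d" "1 \<le> D" and y: "0 < y" "y \<le> 1" "1 \<le> (1 + y) * y ^ (d - 1)"
    and \<theta>: "2 powr (1 / real D) * (1 + y) < 2 powr \<theta>"
  shows "(\<lambda>n. real (instance_context.T_total d D n)) \<in> O(\<lambda>n. 2 powr (\<theta> * real n))"
proof -
  define \<rho> where "\<rho> = 2 powr (1 / real D) * (1 + y)"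
  define e where "e = d * (D + 9) + 1"
  define C where "C = real (instance_context.c_total d D) * 9 ^ (D + 9) * 2 / y ^ (4 * d)"
  define r where "r = \<rho> / 2 powr \<theta>"
  have C0: "0 \<le> C" using y by (simp add: C_def)
  have \<rho>0: "0 < \<rho>" using y by (simp add: \<rho>_def)
  have r: "0 < r" "r < 1" using \<rho>0 \<theta> by (simp_all add: r_def \<rho>_def divide_less_eq)
  have T: "real (instance_context.T_total d D n) \<le> C * (real (n + 1) ^ e * \<rho> ^ n)" for n
  proof -
    interpret instance_context d D n "[]" by (rule instance_context_Nil[OF d])
    show ?thesis unfolding C_def e_def \<rho>_def by (rule T_total_real_le[OF y])
  qed
  have "(\<lambda>k. real k ^ e * r ^ k) \<longlonglongrightarrow> 0" by (rule power_times_geometric[OF r])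
  then have "(\<lambda>n. real (Suc n) ^ e * r ^ Suc n) \<longlonglongrightarrow> 0" by (rule LIMSEQ_Suc)
  then have "\<forall>\<^sub>F n in sequentially. real (Suc n) ^ e * r ^ Suc n < 1" by (rule order_tendstoD(2)) simp
  then have "\<forall>\<^sub>F n in sequentially. real (instance_context.T_total d D n) \<le> C / r * 2 powr (\<theta> * real n)"
  proof eventually_elim
    case (elim n)
    have "2 powr (\<theta> * real n) = (2 powr \<theta>) ^ n" by (simp add: powr_powr[symmetric] powr_realpow)
    then have "\<rho> ^ n = r ^ n * 2 powr (\<theta> * real n)" by (simp add: r_def power_divide)
    then have "real (n + 1) ^ e * \<rho> ^ n = real (Suc n) ^ e * r ^ Suc n / r * 2 powr (\<theta> * real n)"
      using r(1) by simp
    also have "\<dots> \<le> 1 / r * 2 powr (\<theta> * real n)"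
      using elim r(1) by (intro mult_right_mono divide_right_mono) auto
    finally have "C * (real (n + 1) ^ e * \<rho> ^ n) \<le> C * (1 / r * 2 powr (\<theta> * real n))"
      using C0 by (intro mult_left_mono) auto
    then show ?case using T[of n] by simp
  qed
  then show ?thesis by (intro bigoI[of _ "C / r"]) (auto elim: eventually_mono)
qed

text \<open>The depth is chosen last: \<open>2 powr (1 / D)\<close> tends to 1, and the strict
  inequality for \<open>1 + y\<close> leaves room for it. The resulting \<open>D\<close> does not
  depend on \<open>n\<close>.\<close>

lemma solver_works:
  assumes d: "2 \<le> d" and y: "0 < y" "y \<le> 1" "1 \<le> (1 + y) * y ^ (d - 1)" and \<theta>: "1 + y < 2 powr \<theta>"
  shows "\<exists>p T. solves_whp p d \<and> has_running_time p d T \<and> T \<in> O(\<lambda>n. 2 powr (\<theta> * real n))"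
proof -
  have "(\<lambda>D. 2 powr (1 / real D) * (1 + y)) \<longlonglongrightarrow> 2 powr 0 * (1 + y)"
    by (intro tendsto_mult tendsto_powr tendsto_const lim_1_over_n) auto
  then have "\<forall>\<^sub>F D in sequentially. 2 powr (1 / real D) * (1 + y) < 2 powr \<theta>"
    by (rule order_tendstoD(2)) (use \<theta> in simp)
  then have "\<exists>D\<ge>1. 2 powr (1 / real D) * (1 + y) < 2 powr \<theta>"
    using eventually_happens'[OF sequentially_bot eventually_conj[OF _ eventually_ge_at_top[of 1]]] by blast
  then obtain D where D: "1 \<le> D" "2 powr (1 / real D) * (1 + y) < 2 powr \<theta>" by blast
  let ?p = "params.solver d D"
  let ?T = "\<lambda>n. real (instance_context.T_total d D n)"
  have ctx: "instance_context d D n E" if "E \<in> instances d n" for n E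
    using d D(1) that by (rule instance_context.intro)
  have "solves_whp ?p d" unfolding solves_whp_def
  proof
    fix c
    show "\<forall>\<^sub>F n in sequentially. \<forall>E\<in>instances d n. success_prob ?p n E \<ge> 1 - 1 / real n ^ c"
      using err_small[OF d D(1), of c]
    proof eventually_elim
      case (elim n)
      show ?case
      proof
        fix E assume "E \<in> instances d n"
        then have "success_prob ?p n E \<ge> 1 - instance_context.err d D n"
          by (rule instance_context.run_solver(2)[OF ctx])
        then show "success_prob ?p n E \<ge> 1 - 1 / real n ^ c" using elim by linarith
      qed
    qed
  qed
  moreover have "has_running_time ?p d ?T"
    unfolding has_running_time_def using instance_context.run_solver(1)[OF ctx] by blast
  moreover have "?T \<in> O(\<lambda>n. 2 powr (\<theta> * real n))" by (rule T_total_bigo[OF d D(1) y D(2)])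
  ultimately show ?thesis by blast
qed

section \<open>Numerical estimates of the exponents\<close>

text \<open>The difference of the two sides vanishes at 0 and is nondecreasing, its derivative being
  half the square of \<open>1 - inverse (1 - x)\<close>.\<close>

lemma ln_one_minus_ge:
  assumes "0 \<le> b" "b < (1::real)"
  shows "- b - b\<^sup>2 / (2 * (1 - b)) \<le> ln (1 - b)"
proof -
  let ?f = "\<lambda>x. x / 2 + 1 / 2 * inverse (1 - x) + ln (1 - x)"
  have "?f 0 \<le> ?f b"
  proof (rule DERIV_nonneg_imp_nondecreasing[OF assms(1)])
    fix x assume x: "0 \<le> x" "x \<le> b"
    then have "x < 1" using assms by simp
    then have "(?f has_real_derivative 1 / 2 + (inverse (1 - x))\<^sup>2 / 2 - inverse (1 - x)) (at x)"
      by (auto intro!: derivative_eq_intros simp: power2_eq_square inverse_eq_divide)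
        (simp add: frac_eq_eq, simp add: algebra_simps)
    moreover have "1 / 2 + u\<^sup>2 / 2 - u = (1 - u)\<^sup>2 / 2" for u :: real
      by (simp add: power2_diff field_simps)
    ultimately have "(?f has_real_derivative (1 - inverse (1 - x))\<^sup>2 / 2) (at x)" by (simp only:)
    then show "\<exists>y. (?f has_real_derivative y) (at x) \<and> 0 \<le> y" by - (intro exI conjI, assumption, simp)
  qed
  moreover have "b / 2 + inverse (1 - b) / 2 = 1 / 2 + b + b\<^sup>2 / (2 * (1 - b))"
    using assms by (simp add: field_simps power2_eq_square)
  ultimately show ?thesis by simp
qed

text \<open>With this \<open>b\<close> the number \<open>exp (- b / 2)\<close> is
  \<open>2 powr (- 1 / (2 * d))\<close>, so the last claim is the strict inequality
  \<open>1 - x < exp (- x)\<close> at \<open>x = b / 2\<close>. The third claim is the condition on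
  \<open>y = 1 - b\<close>: in logarithms the linear terms leave \<open>b / 2\<close>, which exceeds
  the quadratic corrections.\<close>

lemma exponent_large_degree:
  fixes d :: nat
  assumes "3 \<le> d"
  defines "b \<equiv> ln 2 / real d"
  shows "0 < b" "b \<le> 1 / 4" "1 \<le> (2 - b) * (1 - b) ^ (d - 1)" "2 - b < 2 powr (1 - 1 / (2 * real d))"
proof -
  have l: "0 < ln (2::real)" "ln (2::real) \<le> 25 / 36" using ln2_le_25_over_36 by auto
  show b0: "0 < b" using l assms by simp
  have "b \<le> (25 / 36) / 3" unfolding b_def using l assms by (intro frac_le) auto
  then show b1: "b \<le> 1 / 4" by simp
  have db: "real (d - 1) * b = ln 2 - b" using assms by (simp add: b_def of_nat_diff field_simps)
  have "ln 2 - b \<le> ln 2 * (1 - b)" using l b0 by (simp add: algebra_simps)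
  also have "\<dots> \<le> 25 / 36 * (1 - b)" using l b1 by (intro mult_right_mono) auto
  finally have q: "(ln 2 - b) / (1 - b) \<le> 25 / 36" using b1 by (simp add: divide_le_eq)
  have "real (d - 1) * ln (1 - b) \<ge> real (d - 1) * (- b - b\<^sup>2 / (2 * (1 - b)))"
    using b0 b1 by (intro mult_left_mono ln_one_minus_ge) auto
  also have "real (d - 1) * (- b - b\<^sup>2 / (2 * (1 - b))) = - (real (d - 1) * b) - (real (d - 1) * b) / (1 - b) * (b / 2)"
    using b1 by (simp add: power2_eq_square field_simps)
  also have "\<dots> = - (ln 2 - b) - (ln 2 - b) / (1 - b) * (b / 2)" unfolding db ..
  finally have 1: "real (d - 1) * ln (1 - b) \<ge> - (ln 2 - b) - (ln 2 - b) / (1 - b) * (b / 2)" .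
  have "(ln 2 - b) / (1 - b) * (b / 2) \<le> 25 / 36 * (b / 2)" using q b0 by (intro mult_right_mono) auto
  then have 2: "real (d - 1) * ln (1 - b) \<ge> - ln 2 + b - 25 / 72 * b" using 1 by linarith
  have "ln (1 - b / 2) \<ge> - (b / 2) - (b / 2)\<^sup>2 / (2 * (1 - b / 2))" using b0 b1 by (intro ln_one_minus_ge) auto
  moreover have "(b / 2)\<^sup>2 / (2 * (1 - b / 2)) \<le> (b / 2) * (1 / 8) / 1"
  proof (rule frac_le)
    show "(b / 2)\<^sup>2 \<le> (b / 2) * (1 / 8)"
      using b0 b1 unfolding power2_eq_square by (intro mult_left_mono) auto
  qed (use b0 b1 in auto)
  ultimately have 3: "ln (1 - b / 2) \<ge> - (9 / 16) * b" by linarith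
  have "ln (2 - b) = ln 2 + ln (1 - b / 2)" using ln_mult[of 2 "1 - b / 2"] b1 by simp
  then have "ln ((2 - b) * (1 - b) ^ (d - 1)) = ln 2 + ln (1 - b / 2) + real (d - 1) * ln (1 - b)"
    using b0 b1 by (simp add: ln_mult ln_realpow)
  \<comment> \<open>The logarithms of 2 cancel and the coefficient of \<open>b\<close> is 1 - 25/72
    - 9/16 = 13/144.\<close>
  also have "\<dots> \<ge> 0" using 2 3 b0 by linarith
  finally have "0 \<le> ln ((2 - b) * (1 - b) ^ (d - 1))" .
  moreover have "0 < (2 - b) * (1 - b) ^ (d - 1)" using b1 by simp
  ultimately show "1 \<le> (2 - b) * (1 - b) ^ (d - 1)" by (simp only: ln_ge_zero_iff)
  have "ln (1 - b / 2) \<le> (1 - b / 2) - 1" "ln (1 - b / 2) \<noteq> (1 - b / 2) - 1"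
    using ln_le_minus_one[of "1 - b / 2"] ln_eq_minus_one[of "1 - b / 2"] b0 b1 by auto
  then have "exp (ln (1 - b / 2)) < exp (- (b / 2))" by simp
  then have "1 + (- (b / 2)) < exp (- (b / 2))" using b1 by simp
  moreover have "2 powr (1 - 1 / (2 * real d)) = 2 * exp (- (b / 2))"
    by (simp add: powr_def b_def exp_diff[symmetric] left_diff_distrib exp_diff exp_minus field_simps)
  ultimately show "2 - b < 2 powr (1 - 1 / (2 * real d))" by simp
qed

text \<open>
  For \<open>d = 2\<close> the optimal \<open>y\<close> is the inverse of the golden ratio, rounded up here; 109/157 lies
  between the binary logarithm of \<open>1 + y\<close> and 0.6943.
\<close>

lemma exponent_quadratic: "1 + 61804 / 100000 < (2::real) powr 0.6943"
proof -
  let ?x = "161804 / 100000 :: real"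
  \<comment> \<open>Repeated squaring with bounds rounded up to nine significant digits keeps the
    numbers short.\<close>
  have sq: "?x ^ (2 * k) \<le> b" if "?x ^ k \<le> a" "a\<^sup>2 \<le> b" for a b k
  proof -
    have "?x ^ (2 * k) = (?x ^ k)\<^sup>2" by (simp only: power_mult[symmetric] mult.commute)
    also have "\<dots> \<le> a\<^sup>2" using that(1) by (intro power_mono) simp_all
    finally show ?thesis using that(2) by linarith
  qed
  have 1: "?x ^ 1 \<le> 161804 / 100000" by simp
  have 2: "?x ^ 2 \<le> 261805345 / 100000000" using sq[OF 1, of "261805345 / 100000000"] by (simp add: power2_eq_square)
  have 4: "?x ^ 4 \<le> 685420387 / 100000000" using sq[OF 2, of "685420387 / 100000000"] by (simp add: power2_eq_square)
  have 8: "?x ^ 8 \<le> 469801107 / 10000000" using sq[OF 4, of "469801107 / 10000000"] by (simp add: power2_eq_square)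
  have 16: "?x ^ 16 \<le> 220713081 / 100000" using sq[OF 8, of "220713081 / 100000"] by (simp add: power2_eq_square)
  have 32: "?x ^ 32 \<le> 487142642 / 100" using sq[OF 16, of "487142642 / 100"] by (simp add: power2_eq_square)
  have 64: "?x ^ 64 \<le> 237307954 * 100000" using sq[OF 32, of "237307954 * 100000"] by (simp add: power2_eq_square)
  have 128: "?x ^ 128 \<le> 563150651 * 1000000000000000000" using sq[OF 64, of "563150651 * 1000000000000000000"] by (simp add: power2_eq_square)
  \<comment> \<open>The binary expansion 157 = 128 + 16 + 8 + 4 + 1.\<close>
  have "?x ^ 157 = ?x ^ 128 * (?x ^ 16 * (?x ^ 8 * (?x ^ 4 * ?x ^ 1)))"
    by (simp only: power_add[symmetric]) simp
  also have "\<dots> \<le> (563150651 * 1000000000000000000) * ((220713081 / 100000) * ((469801107 / 10000000) * ((685420387 / 100000000) * (161804 / 100000))))"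
    by (intro mult_mono 128 16 8 4 1) simp_all
  also have "\<dots> < 2 ^ 109" by simp
  finally have less: "?x ^ 157 < 2 ^ 109" .
  have "(2::real) ^ 109 = 2 powr (109 / 157 * 157)"
    using powr_realpow[of "2::real" 109] by simp
  also have "\<dots> = (2 powr (109 / 157)) powr real 157" by (simp only: powr_powr of_nat_numeral)
  also have "\<dots> = (2 powr (109 / 157)) ^ 157" by (rule powr_realpow) simp
  finally have "?x ^ 157 < (2 powr (109 / 157)) ^ 157" using less by (simp only:)
  then have "161804 / 100000 < (2::real) powr (109 / 157)" by (rule power_less_imp_less_base) simp
  also have "\<dots> < 2 powr 0.6943" by simp
  finally show ?thesis by simp
qed

theorem theorem1:
  fixes d :: nat
  assumes "d \<ge> 2"
  shows "\<exists>(p :: prog) (T :: nat \<Rightarrow> real).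
           solves_whp p d \<and> has_running_time p d T \<and>
           (d = 2 \<longrightarrow> T \<in> O(\<lambda>n. 2 powr (0.6943 * real n))) \<and>
           (d > 2 \<longrightarrow> T \<in> O(\<lambda>n. 2 powr ((1 - 1 / (2 * real d)) * real n)))"
proof (cases "d = 2")
  case True
  have "\<exists>p T. solves_whp p d \<and> has_running_time p d T \<and> T \<in> O(\<lambda>n. 2 powr (0.6943 * real n))"
    by (rule solver_works[of d "61804 / 100000"]) (use True exponent_quadratic in auto)
  then show ?thesis using True by auto
next
  case False
  then have d: "3 \<le> d" using assms by simp
  note b = exponent_large_degree[OF d]
  have "\<exists>p T. solves_whp p d \<and> has_running_time p d T \<and> T \<in> O(\<lambda>n. 2 powr ((1 - 1 / (2 * real d)) * real n))"
    by (rule solver_works[of d "1 - ln 2 / real d"]) (use assms b in auto)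
  then show ?thesis using False by auto
qed

end
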